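(* Let $A, X_3, S, P$ be operators on a complex Hilbert space $\mathcal{H}$. Then: (1) $(A, S, P)$ is a $\mathbb{P}$-unitary if and only if $(A, S/2, S/2, P)$ is an $\mathbb{H}$-unitary; (2) $(A, X_3)$ is a commuting pair of unitaries if and only if $(A, 0, 0, X_3)$ is an $\mathbb{H}$-unitary.
   Context: All operators are bounded linear maps on complex Hilbert spaces; $\mathbb{D}$ is the open unit disc in $\mathbb{C}$. The tetrablock is $\mathbb{E}=\{(x_1,x_2,x_3)\in\mathbb{C}^3 : 1-x_1z_1-x_2z_2+x_3z_1z_2\neq 0 \text{ whenever } |z_1|\le 1, |z_2|\le 1\}$. The hexablock is $\mathbb{H}=\{(a,x_1,x_2,x_3)\in\mathbb{C}\times\mathbb{E} : \sup_{z_1,z_2\in\mathbb{D}}\left|\frac{a\sqrt{(1-|z_1|^2)(1-|z_2|^2)}}{1-x_1z_1-x_2z_2+x_3z_1z_2}\right|<1\}$. The symmetrized bidisc is $\mathbb{G}_2=\{(z_1+z_2,z_1z_2): |z_1|,|z_2|<1\}$ and the pentablock is $\mathbb{P}=\{(a,s,p)\in\mathbb{C}\times\mathbb{G}_2 : \sup_{z\in\mathbb{D}}\left|\frac{a(1-|z|^2)}{1-sz+pz^2}\right|<1\}$. For a bounded domain $\Omega\subset\mathbb{C}^n$, the distinguished boundary $b\Omega$ is the smallest closed subset of $\overline{\Omega}$ on which every function continuous on $\overline{\Omega}$ and analytic in $\Omega$ attains its maximum modulus. For $\Omega\in\{\mathbb{H},\mathbb{P}\}$, an $\Omega$-unitary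 is a commuting tuple of normal operators whose Taylor joint spectrum is contained in $b\Omega$. *)

theory Defs
  imports "HOL-Analysis.Analysis"
begin

section \<open>Complex Hilbert spaces\<close>

text \<open>
  A complex inner product space is presented on top of \<^class>\<open>real_inner\<close>: the real inner
  product is the real part of the complex one.  Together with conjugate symmetry this gives
  \<open>cinner x x = (norm x)\<^sup>2\<close>, so norm and topology are those of the complex inner product.
  The complex inner product is linear in its first argument.
\<close>

class complex_inner = real_inner +
  fixes scaleC :: "complex \<Rightarrow> 'a \<Rightarrow> 'a" (infixr "*\<^sub>C" 75)
    and cinner :: "'a \<Rightarrow> 'a \<Rightarrow> complex"
  assumes scaleC_add_right: "c *\<^sub>C (x + y) = c *\<^sub>C x + c *\<^sub>C y"
    and scaleC_add_left: "(c + d) *\<^sub>C x = c *\<^sub>C x + d *\<^sub>C x"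
    and scaleC_scaleC: "c *\<^sub>C d *\<^sub>C x = (c * d) *\<^sub>C x"
    and scaleC_of_real: "complex_of_real r *\<^sub>C x = r *\<^sub>R x"
    and cinner_commute: "cinner x y = cnj (cinner y x)"
    and cinner_add_left: "cinner (x + y) z = cinner x z + cinner y z"
    and cinner_scaleC_left: "cinner (c *\<^sub>C x) y = c * cinner x y"
    and inner_eq_Re_cinner: "inner x y = Re (cinner x y)"

lemma cinner_self: "cinner x x = complex_of_real ((norm x)\<^sup>2)"
proof (rule complex_eqI)
  show "Re (cinner x x) = Re (complex_of_real ((norm x)\<^sup>2))"
    by (simp add: inner_eq_Re_cinner [symmetric] power2_norm_eq_inner)
  show "Im (cinner x x) = Im (complex_of_real ((norm x)\<^sup>2))"
    using arg_cong [OF cinner_commute [of x x], of Im] by simp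
qed

class chilbert_space = complex_inner + banach

instantiation complex :: chilbert_space
begin

definition scaleC_complex_def: "scaleC = ((*) :: complex \<Rightarrow> complex \<Rightarrow> complex)"

definition cinner_complex_def: "cinner (x :: complex) y = x * cnj y"

instance
  by standard
    (auto simp: scaleC_complex_def cinner_complex_def inner_complex_def algebra_simps
      scaleR_conv_of_real)

end


section \<open>Operators\<close>

text \<open>
  Elements of \<open>'a \<Rightarrow>\<^sub>L 'a\<close> are bounded and real linear; an operator is one that is complex
  linear.
\<close>

definition complex_linear_op :: "('a::complex_inner \<Rightarrow>\<^sub>L 'a) \<Rightarrow> bool" where
  "complex_linear_op T \<longleftrightarrow> (\<forall>c x. T (c *\<^sub>C x) = c *\<^sub>C T x)"

text \<open>For an operator on a Hilbert space this adjoint exists and is unique.\<close>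

definition cadjoint :: "('a::complex_inner \<Rightarrow>\<^sub>L 'a) \<Rightarrow> 'a \<Rightarrow>\<^sub>L 'a" where
  "cadjoint T = (SOME S :: 'a \<Rightarrow>\<^sub>L 'a. \<forall>x y. cinner (T x) y = cinner x (S y))"

definition commuting_ops :: "('a::complex_inner \<Rightarrow>\<^sub>L 'a) \<Rightarrow> ('a \<Rightarrow>\<^sub>L 'a) \<Rightarrow> bool" where
  "commuting_ops S T \<longleftrightarrow> S o\<^sub>L T = T o\<^sub>L S"

definition normal_op :: "('a::complex_inner \<Rightarrow>\<^sub>L 'a) \<Rightarrow> bool" where
  "normal_op T \<longleftrightarrow> cadjoint T o\<^sub>L T = T o\<^sub>L cadjoint T"

definition unitary_op :: "('a::complex_inner \<Rightarrow>\<^sub>L 'a) \<Rightarrow> bool" where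
  "unitary_op T \<longleftrightarrow> cadjoint T o\<^sub>L T = id_blinfun \<and> T o\<^sub>L cadjoint T = id_blinfun"


section \<open>Taylor joint spectrum\<close>

text \<open>
  The Koszul complex of a commuting \<open>n\<close>-tuple on \<open>H\<close> has the spaces \<open>H \<otimes> \<Lambda>\<^sup>k \<complex>\<^sup>n\<close>, an element
  being written as \<open>\<Sum>\<^sub>J f J \<otimes> e\<^sub>J\<close> over index sets \<open>J\<close> with \<open>k\<close> elements, where
  \<open>e\<^sub>J\<close> is the wedge product of the \<open>e\<^sub>j\<close> (\<open>j \<in> J\<close>) in increasing order.  The differential is
  \<open>x \<otimes> \<omega> \<mapsto> \<Sum>\<^sub>j T\<^sub>j x \<otimes> (e\<^sub>j \<and> \<omega>)\<close>.  (In the numeral type \<open>n\<close> the index \<open>n\<close> is \<open>0\<close> and hence comes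
  first in the order; the complex is up to isomorphism independent of the order.)
\<close>

definition koszul_space :: "nat \<Rightarrow> ('n::{finite,linorder} set \<Rightarrow> 'a::complex_inner) set" where
  "koszul_space k = {f. \<forall>J. card J \<noteq> k \<longrightarrow> f J = 0}"

definition koszul_diff ::
  "('n::{finite,linorder} \<Rightarrow> 'a::complex_inner \<Rightarrow> 'a) \<Rightarrow> ('n set \<Rightarrow> 'a) \<Rightarrow> 'n set \<Rightarrow> 'a" where
  "koszul_diff T f = (\<lambda>J. \<Sum>j\<in>J. (- 1) ^ card {i \<in> J. i < j} *\<^sub>R T j (f (J - {j})))"

definition koszul_exact :: "('n::{finite,linorder} \<Rightarrow> 'a::complex_inner \<Rightarrow> 'a) \<Rightarrow> bool" where
  "koszul_exact T \<longleftrightarrow>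
     {f \<in> koszul_space 0. koszul_diff T f = (\<lambda>J. 0)} = {\<lambda>J. 0} \<and>
     (\<forall>k. {f \<in> koszul_space (Suc k). koszul_diff T f = (\<lambda>J. 0)} = koszul_diff T ` koszul_space k)"

definition taylor_spectrum ::
  "('a::complex_inner \<Rightarrow>\<^sub>L 'a) ^ 'n::{finite,linorder} \<Rightarrow> (complex ^ 'n::{finite,linorder}) set" where
  "taylor_spectrum T = {w. \<not> koszul_exact (\<lambda>i x. (T $ i) x - (w $ i) *\<^sub>C x)}"


section \<open>Distinguished boundary\<close>

text \<open>Analyticity in several variables: complex Frechet differentiability on an open set.\<close>

definition analytic_in :: "(complex ^ 'n \<Rightarrow> complex) \<Rightarrow> (complex ^ 'n) set \<Rightarrow> bool" where
  "analytic_in f \<Omega> \<longleftrightarrow>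
     (\<forall>z\<in>\<Omega>. \<exists>D. (f has_derivative D) (at z) \<and> (\<forall>c v. D (c *s v) = c * D v))"

definition max_modulus_set :: "(complex ^ 'n) set \<Rightarrow> (complex ^ 'n) set \<Rightarrow> bool" where
  "max_modulus_set \<Omega> B \<longleftrightarrow> closed B \<and> B \<subseteq> closure \<Omega> \<and>
     (\<forall>f. continuous_on (closure \<Omega>) f \<and> analytic_in f \<Omega> \<longrightarrow>
        (\<exists>z\<in>B. \<forall>w\<in>closure \<Omega>. cmod (f w) \<le> cmod (f z)))"

definition distinguished_boundary :: "(complex ^ 'n) set \<Rightarrow> (complex ^ 'n) set" where
  "distinguished_boundary \<Omega> = (LEAST B. max_modulus_set \<Omega> B)"


section \<open>The domains\<close>

text \<open>
  The suprema are taken in \<^typ>\<open>ereal\<close>, so that they are genuine suprema without a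
  boundedness side condition.
\<close>

definition tetrablock :: "(complex ^ 3) set" where
  "tetrablock = {x. \<forall>z1 z2. cmod z1 \<le> 1 \<and> cmod z2 \<le> 1 \<longrightarrow>
     1 - x$1 * z1 - x$2 * z2 + x$3 * z1 * z2 \<noteq> 0}"

definition hexablock :: "(complex ^ 4) set" where
  "hexablock = {vector [a, x1, x2, x3] | a x1 x2 x3.
     vector [x1, x2, x3] \<in> tetrablock \<and>
     (SUP (z1, z2) \<in> {z. cmod z < 1} \<times> {z. cmod z < 1}.
        ereal (cmod (a * complex_of_real (sqrt ((1 - (cmod z1)\<^sup>2) * (1 - (cmod z2)\<^sup>2))) /
          (1 - x1 * z1 - x2 * z2 + x3 * z1 * z2)))) < 1}"

definition symmetrized_bidisc :: "(complex ^ 2) set" where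
  "symmetrized_bidisc = {vector [z1 + z2, z1 * z2] | z1 z2. cmod z1 < 1 \<and> cmod z2 < 1}"

definition pentablock :: "(complex ^ 3) set" where
  "pentablock = {vector [a, s, p] | a s p.
     vector [s, p] \<in> symmetrized_bidisc \<and>
     (SUP z \<in> {z. cmod z < 1}.
        ereal (cmod (a * complex_of_real (1 - (cmod z)\<^sup>2) / (1 - s * z + p * z\<^sup>2)))) < 1}"


definition domain_unitary ::
  "(complex ^ 'n::{finite,linorder}) set \<Rightarrow> ('a::chilbert_space \<Rightarrow>\<^sub>L 'a) ^ 'n::{finite,linorder} \<Rightarrow> bool" where
  "domain_unitary \<Omega> T \<longleftrightarrow>
     (\<forall>i j. commuting_ops (T $ i) (T $ j)) \<and>
     (\<forall>i. normal_op (T $ i)) \<and>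
     taylor_spectrum T \<subseteq> distinguished_boundary \<Omega>"

end

theory Submission
  imports Defs "HOL-Complex_Analysis.Riemann_Mapping"
begin

text \<open>
A commuting tuple of normal operators is unitary for a domain when its Taylor spectrum lies in the
distinguished boundary, so the two boundaries are computed and the spectra of the tuples compared.

The boundaries.  The hexablock is swept out by the points
\<open>(y (u + v x), b1 + cnj b2 x, b2 + cnj b1 x, x)\<close> with \<open>\<bar>x\<bar>, \<bar>y\<bar> < 1\<close>, where \<open>\<bar>b1\<bar> + \<bar>b2\<bar> < 1\<close> and
\<open>u + v x\<close>, \<open>u > 0\<close>, is the affine function without zeros in the closed disc for which
\<open>\<bar>u + v x\<bar>\<^sup>2 + \<bar>b1 + cnj b2 x\<bar>\<^sup>2 = 1\<close> on the unit circle.  Letting \<open>x\<close> and \<open>y\<close> run through suitable disc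
automorphisms gives, through every point of the hexablock, an analytic disc whose boundary lies in
\<open>K = {(a, x1, x2, x3) | \<bar>x3\<bar> = 1, x1 = cnj x2 x3, \<bar>a\<bar>\<^sup>2 + \<bar>x1\<bar>\<^sup>2 = 1}\<close>,
so \<open>K\<close> carries the maximum of every admissible function.  On the other hand
\<open>2\<bar>a\<bar>\<^sup>2 + \<bar>x1\<bar>\<^sup>2 + \<bar>x2\<bar>\<^sup>2 + \<bar>x3\<bar>\<^sup>2 \<le> 3\<close> on the hexablock, with equality on \<open>K\<close>; a strictly convex ellipsoid
has a peaking affine function at each boundary point, so no point of \<open>K\<close> can be dropped
(\<open>distinguished_boundary_eqI\<close>).  The
pentablock is the slice \<open>x1 = x2\<close> of the hexablock, with \<open>s = x1 + x2\<close>, and the same discs and the same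
ellipsoid serve there.  In particular \<open>(a, s, p)\<close> is in the one boundary iff \<open>(a, s/2, s/2, p)\<close> is in
the other, and \<open>(a, 0, 0, x3)\<close> is in \<open>K\<close> iff \<open>\<bar>a\<bar> = \<bar>x3\<bar> = 1\<close>.

The spectra.  Contraction with a basis vector \<open>e\<^sub>q\<close> is a homotopy of the Koszul complex from \<open>T\<^sub>q\<close> to
zero.  Hence the complex is exact as soon as some \<open>T\<^sub>q\<close> is invertible or some difference \<open>T\<^sub>p - T\<^sub>q\<close> is a
nonzero scalar; and adjoining to a tuple a copy of one of its entries does not affect exactness
(\<open>koszul_exact_adjoin_duplicate\<close>).  This gives \<open>\<sigma>(A, S/2, S/2, P) = {(a, s/2, s/2, p) | (a, s, p) \<in> \<sigma>(A, S, P)}\<close> and the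
spectrum of \<open>(A, 0, 0, X)\<close> for unitary \<open>A\<close> and \<open>X\<close>.

For the converse in the second part, an approximate eigenvalue \<open>a\<close> of the normal operator \<open>A\<close> extends to
a joint approximate eigenvalue \<open>(a, z)\<close> of \<open>(A, X)\<close>: approximate eigenvectors of \<open>A\<close> at \<open>a\<close> are those of
\<open>A\<^sup>*\<close> at \<open>cnj a\<close>, hence \<open>X\<close> and \<open>X\<^sup>*\<close> both respect them, and the top of the numerical range of a symmetric
operator on them is an approximate eigenvalue (\<open>approximate_eigenvalue_symmetric\<close>).  Then \<open>(a, 0, 0, z)\<close> is in the Taylor spectrum, so \<open>a\<close> is
unimodular.  A normal operator with unimodular approximate eigenvalues is unitary, as the same
argument applied to \<open>A\<^sup>* A\<close> shows.
\<close>

section \<open>Exactness of Koszul complexes\<close>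

definition koszul_sign :: "'n::{finite,linorder} \<Rightarrow> 'n set \<Rightarrow> real" where
  "koszul_sign q K = (- 1) ^ card {i \<in> K. i < q}"

text \<open>
Interior multiplication by the dual basis vector of \<open>e\<^sub>q\<close>.
\<close>

definition koszul_contract :: "'n::{finite,linorder} \<Rightarrow> ('n set \<Rightarrow> 'a::complex_inner) \<Rightarrow> 'n set \<Rightarrow> 'a" where
  "koszul_contract q f K = (if q \<in> K then 0 else koszul_sign q K *\<^sub>R f (insert q K))"

lemma koszul_diff_sign: "koszul_diff T f J = (\<Sum>j\<in>J. koszul_sign j J *\<^sub>R T j (f (J - {j})))"
  by (simp add: koszul_diff_def koszul_sign_def)

lemma koszul_sign_insert:
  assumes "q \<notin> K"
  shows "koszul_sign j (insert q K) = (if q < j then - koszul_sign j K else koszul_sign j K)"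
proof (cases "q < j")
  case True
  then have "{i \<in> insert q K. i < j} = insert q {i \<in> K. i < j}" by auto
  then show ?thesis using True assms by (simp add: koszul_sign_def)
next
  case False
  then have "{i \<in> insert q K. i < j} = {i \<in> K. i < j}" by auto
  then show ?thesis using False by (simp add: koszul_sign_def)
qed

lemma koszul_sign_squared [simp]: "koszul_sign q K * koszul_sign q K = 1"
  by (simp add: koszul_sign_def flip: power_mult_distrib)

lemma koszul_sign_insert_self [simp]: "koszul_sign q (insert q K) = koszul_sign q K"
proof -
  have "{i \<in> insert q K. i < q} = {i \<in> K. i < q}" by auto
  then show ?thesis by (simp add: koszul_sign_def)
qed

lemma koszul_sign_swap:
  assumes "q \<notin> K" "j \<in> K"
  shows "koszul_sign q K * koszul_sign j (insert q K) = - (koszul_sign j K * koszul_sign q (K - {j}))"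
proof -
  define L where "L = K - {j}"
  have K: "K = insert j L" "j \<notin> L" "q \<notin> L" "q \<noteq> j" using assms by (auto simp: L_def)
  have "koszul_sign j (insert q K) = koszul_sign j (insert q L)"
    unfolding K(1) insert_commute[of q j] by simp
  also have "\<dots> = (if q < j then - koszul_sign j L else koszul_sign j L)"
    using K by (simp add: koszul_sign_insert)
  finally have 1: "koszul_sign j (insert q K) = (if q < j then - koszul_sign j L else koszul_sign j L)" .
  have 2: "koszul_sign q K = (if j < q then - koszul_sign q L else koszul_sign q L)"
    using K by (simp add: koszul_sign_insert)
  have 3: "koszul_sign j K = koszul_sign j L" using K by simp
  show ?thesis unfolding 1 2 3 L_def[symmetric] using K(4) by (auto simp: not_less)
qed

text \<open>
The Cartan formula: exterior multiplication by \<open>\<Sum>\<^sub>j T\<^sub>j \<otimes> e\<^sub>j\<close> and interior multiplication by the dual of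
\<open>e\<^sub>q\<close> anticommute to \<open>T\<^sub>q\<close>.  For \<open>q \<notin> K\<close> the terms with \<open>j \<in> K\<close> cancel in pairs, because inserting \<open>q\<close> and
removing \<open>j\<close> change the signs in opposite ways.
\<close>

lemma koszul_contract_homotopy:
  fixes T :: "'n::{finite,linorder} \<Rightarrow> 'a::complex_inner \<Rightarrow> 'a"
  assumes lin: "\<And>i. linear (T i)"
  shows "koszul_diff T (koszul_contract q f) K + koszul_contract q (koszul_diff T f) K = T q (f K)"
proof (cases "q \<in> K")
  case True
  have "koszul_diff T (koszul_contract q f) K
      = (\<Sum>j\<in>K. if j = q then T q (f K) else 0)"
    unfolding koszul_diff_sign
  proof (intro sum.cong refl)
    fix j assume "j \<in> K"
    show "koszul_sign j K *\<^sub>R T j (koszul_contract q f (K - {j})) = (if j = q then T q (f K) else 0)"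
    proof (cases "j = q")
      case True
      have "koszul_sign q K = koszul_sign q (K - {q})"
        using koszul_sign_insert_self[of q "K - {q}"] \<open>q \<in> K\<close> by (simp add: insert_absorb)
      then show ?thesis using True \<open>q \<in> K\<close>
        by (simp add: koszul_contract_def linear_cmul[OF lin] insert_absorb)
    next
      case False
      then show ?thesis using \<open>q \<in> K\<close> by (simp add: koszul_contract_def linear_0[OF lin])
    qed
  qed
  also have "\<dots> = T q (f K)" using True by simp
  finally show ?thesis using True by (simp add: koszul_contract_def)
next
  case False
  have a: "koszul_contract q (koszul_diff T f) K = T q (f K) +
      (\<Sum>j\<in>K. (koszul_sign q K * koszul_sign j (insert q K)) *\<^sub>R T j (f (insert q (K - {j}))))"
  proof -
    have "koszul_diff T f (insert q K) = koszul_sign q K *\<^sub>R T q (f K) +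
      (\<Sum>j\<in>K. koszul_sign j (insert q K) *\<^sub>R T j (f (insert q K - {j})))"
      unfolding koszul_diff_sign using False by (simp add: sum.insert)
    also have "(\<Sum>j\<in>K. koszul_sign j (insert q K) *\<^sub>R T j (f (insert q K - {j})))
      = (\<Sum>j\<in>K. koszul_sign j (insert q K) *\<^sub>R T j (f (insert q (K - {j}))))"
      using False by (intro sum.cong refl) (metis insert_Diff_if singletonD)
    finally show ?thesis using False
      by (simp add: koszul_contract_def scaleR_right_distrib scaleR_right.sum)
  qed
  have b: "koszul_diff T (koszul_contract q f) K =
      (\<Sum>j\<in>K. (koszul_sign j K * koszul_sign q (K - {j})) *\<^sub>R T j (f (insert q (K - {j}))))"
    unfolding koszul_diff_sign using False
    by (intro sum.cong refl) (auto simp: koszul_contract_def linear_cmul[OF lin])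
  show ?thesis unfolding a b using False
    by (simp add: sum.distrib[symmetric] koszul_sign_swap)
qed

lemma koszul_diff_add:
  assumes "\<And>i. linear (T i)"
  shows "koszul_diff T (\<lambda>J. f J + g J) K = koszul_diff T f K + koszul_diff T g K"
  by (simp add: koszul_diff_sign linear_add[OF assms] scaleR_right_distrib sum.distrib)

lemma koszul_diff_minus:
  assumes "\<And>i. linear (T i)"
  shows "koszul_diff T (\<lambda>J. f J - g J) K = koszul_diff T f K - koszul_diff T g K"
  by (simp add: koszul_diff_sign linear_diff[OF assms] scaleR_right_diff_distrib sum_subtractf)

lemma koszul_diff_commute:
  assumes "linear R" and "\<And>i x. T i (R x) = R (T i x)"
  shows "koszul_diff T (\<lambda>J. R (f J)) K = R (koszul_diff T f K)"
  by (simp add: koszul_diff_sign assms(2) linear_sum[OF assms(1)] linear_cmul[OF assms(1)])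

lemma koszul_diff_zero [simp]:
  assumes "\<And>i. linear (T i)" shows "koszul_diff T (\<lambda>J. 0) = (\<lambda>J. 0)"
  by (simp add: koszul_diff_def linear_0[OF assms])

locale commuting_maps =
  fixes T :: "'n::{finite,linorder} \<Rightarrow> 'a::complex_inner \<Rightarrow> 'a"
  assumes lin: "linear (T i)" and commute: "T i (T j x) = T j (T i x)"
begin

lemma koszul_diff_comp: "koszul_diff T (\<lambda>J. T q (f J)) K = T q (koszul_diff T f K)"
  by (rule koszul_diff_commute[OF lin]) (rule commute)

text \<open>
Contractions commute with the square of the differential \<open>d\<close>, by two applications of the homotopy
formula: \<open>s d\<^sup>2 = (T\<^sub>q - d s) d = d (T\<^sub>q - s d) = d\<^sup>2 s\<close>.  So the value of \<open>d\<^sup>2 f\<close> at \<open>insert q J\<close> is, up to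
sign, the value of \<open>d\<^sup>2 (s f)\<close> at the smaller set \<open>J\<close>.
\<close>

lemma koszul_diff_diff: "koszul_diff T (koszul_diff T f) J = 0"
proof -
  have "finite J" by simp
  then show ?thesis
  proof (induction J arbitrary: f rule: finite_induct)
    case empty
    show ?case by (simp add: koszul_diff_def)
  next
    case (insert q J)
    let ?d = "koszul_diff T" and ?s = "koszul_contract q"
    have s: "?s f = (\<lambda>K. ?s f K)" for f :: "'n set \<Rightarrow> 'a" by simp
    have "?s (?d (?d f)) J = T q (?d f J) - ?d (?s (?d f)) J"
      using koszul_contract_homotopy[where T=T, OF lin, where q=q and f="?d f" and K=J] by (simp add: algebra_simps)
    also have "?s (?d f) = (\<lambda>K. T q (f K) - ?d (?s f) K)"
      using koszul_contract_homotopy[where T=T, OF lin, where q=q and f=f] by (simp add: algebra_simps fun_eq_iff)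
    also have "?d (\<lambda>K. T q (f K) - ?d (?s f) K) J = T q (?d f J)"
      using insert.IH[of "?s f"]
      by (simp add: koszul_diff_minus[OF lin] koszul_diff_comp)
    finally have "?s (?d (?d f)) J = 0" by simp
    then have "koszul_sign q J *\<^sub>R ?d (?d f) (insert q J) = 0"
      using insert.hyps by (simp add: koszul_contract_def)
    moreover have "koszul_sign q J \<noteq> 0" by (simp add: koszul_sign_def)
    ultimately show ?case by simp
  qed
qed

text \<open>
The differential is homogeneous of degree one, so exactness in every degree can be tested on
inhomogeneous elements.  All later arguments use this form, which keeps no track of degrees.
\<close>

lemma koszul_exact_iff:
  "koszul_exact T \<longleftrightarrow> (\<forall>f. koszul_diff T f = (\<lambda>J. 0) \<longrightarrow> (\<exists>g. koszul_diff T g = f))"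
    (is "_ \<longleftrightarrow> ?ungraded")
proof
  assume E: "koszul_exact T"
  show ?ungraded
  proof (intro allI impI)
    fix f :: "'n set \<Rightarrow> 'a" assume f0: "koszul_diff T f = (\<lambda>J. 0)"
    define part where "part k = (\<lambda>J. if card J = k then f J else 0)" for k
    have part_space: "part k \<in> koszul_space k" for k by (simp add: part_def koszul_space_def)
    have part_closed: "koszul_diff T (part k) = (\<lambda>J. 0)" for k
    proof
      fix J :: "'n set"
      have "koszul_diff T (part k) J = (if card J = Suc k then koszul_diff T f J else 0)"
      proof (cases "card J = Suc k")
        case True
        then show ?thesis unfolding koszul_diff_def by (auto simp: part_def intro!: sum.cong)
      next
        case False
        have "card (J - {j}) \<noteq> k" if "j \<in> J" for j
          using False card_Suc_Diff1[OF finite that] by metis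
        then show ?thesis using False
          by (auto simp: koszul_diff_def part_def linear_0[OF lin] intro!: sum.neutral)
      qed
      then show "koszul_diff T (part k) J = 0" by (simp add: f0)
    qed
    have "\<exists>g. koszul_diff T g = part (Suc k) \<and> g \<in> koszul_space k" for k
    proof -
      have "part (Suc k) \<in> koszul_diff T ` koszul_space k"
        using E part_space[of "Suc k"] part_closed[of "Suc k"] unfolding koszul_exact_def by blast
      then show ?thesis by (metis imageE)
    qed
    then obtain g where g: "\<And>k. koszul_diff T (g k) = part (Suc k)" by metis
    have "part 0 = (\<lambda>J. 0)"
      using E part_space[of 0] part_closed[of 0] unfolding koszul_exact_def by blast
    have "koszul_diff T (\<lambda>J. g (card J) J) J = f J" for J
    proof (cases "J = {}")
      case True
      then show ?thesis using fun_cong[OF \<open>part 0 = (\<lambda>J. 0)\<close>, of "{}"]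
        by (simp add: koszul_diff_def part_def)
    next
      case False
      then obtain k where k: "card J = Suc k" by (metis card_eq_0_iff finite not0_implies_Suc)
      have "koszul_diff T (\<lambda>J. g (card J) J) J = koszul_diff T (g k) J"
        unfolding koszul_diff_def using k by (auto intro!: sum.cong)
      then show ?thesis using k by (simp add: g part_def)
    qed
    then show "\<exists>g. koszul_diff T g = f" by blast
  qed
next
  assume U: ?ungraded
  have "f = (\<lambda>J. 0)" if f: "f \<in> koszul_space 0" "koszul_diff T f = (\<lambda>J. 0)" for f
  proof -
    obtain g where g: "koszul_diff T g = f" using U f(2) by blast
    have "f J = 0" for J
    proof (cases "J = {}")
      case True then show ?thesis by (simp add: koszul_diff_def flip: g)
    next
      case False then show ?thesis using f(1) by (simp add: koszul_space_def)
    qed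
    then show ?thesis by blast
  qed
  moreover have "(\<lambda>J. 0) \<in> {f \<in> koszul_space 0. koszul_diff T f = (\<lambda>J. 0)}"
    by (simp add: koszul_space_def lin)
  moreover have "f \<in> koszul_diff T ` koszul_space k"
    if f: "f \<in> koszul_space (Suc k)" "koszul_diff T f = (\<lambda>J. 0)" for f k
  proof -
    obtain g where g: "koszul_diff T g = f" using U f(2) by blast
    define g' where "g' = (\<lambda>J. if card J = k then g J else 0)"
    have "koszul_diff T g' J = f J" for J
    proof (cases "card J = Suc k")
      case True
      then show ?thesis unfolding g[symmetric] koszul_diff_def by (auto simp: g'_def intro!: sum.cong)
    next
      case False
      have "card (J - {j}) \<noteq> k" if "j \<in> J" for j
        using False card_Suc_Diff1[OF finite that] by metis
      then have "koszul_diff T g' J = 0"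
        by (auto simp: koszul_diff_def g'_def linear_0[OF lin] intro!: sum.neutral)
      then show ?thesis using f(1) False by (simp add: koszul_space_def)
    qed
    moreover have "g' \<in> koszul_space k" by (simp add: g'_def koszul_space_def)
    ultimately show ?thesis by (metis ext imageI)
  qed
  moreover have "koszul_diff T g \<in> {f \<in> koszul_space (Suc k). koszul_diff T f = (\<lambda>J. 0)}"
    if g: "g \<in> koszul_space k" for g k
  proof -
    have "koszul_diff T g J = 0" if "card J \<noteq> Suc k" for J
    proof -
      have "card (J - {j}) \<noteq> k" if "j \<in> J" for j
        using \<open>card J \<noteq> Suc k\<close> card_Suc_Diff1[OF finite that] by metis
      then have "g (J - {j}) = 0" if "j \<in> J" for j
        using g that unfolding koszul_space_def by blast
      then show ?thesis by (auto simp: koszul_diff_def linear_0[OF lin] intro!: sum.neutral)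
    qed
    then show ?thesis by (auto simp: koszul_space_def koszul_diff_diff)
  qed
  ultimately show "koszul_exact T" unfolding koszul_exact_def
    by (intro conjI allI) blast+
qed

text \<open>
If \<open>T\<^sub>q\<close> is invertible, then \<open>T\<^sub>q\<^sup>-\<^sup>1 s\<close> is a contracting homotopy.
\<close>

lemma koszul_exact_if_bij:
  assumes "bij (T q)"
  shows "koszul_exact T"
  unfolding koszul_exact_iff
proof (intro allI impI)
  fix f assume f: "koszul_diff T f = (\<lambda>J. 0)"
  define R where "R = inv (T q)"
  have R: "T q (R x) = x" "R (T q x) = x" for x
    using assms by (simp_all add: R_def bij_is_surj surj_f_inv_f bij_is_inj inv_f_f)
  have "linear R"
    by (rule linearI) (metis R linear_add[OF lin] linear_cmul[OF lin])+
  have comm: "T i (R x) = R (T i x)" for i x by (metis R commute)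
  have "koszul_diff T (koszul_contract q f) K = T q (f K)" for K
    using koszul_contract_homotopy[where T=T, OF lin, where q=q and f=f and K=K] by (simp add: f koszul_contract_def split: if_splits)
  then have "koszul_diff T (\<lambda>J. R (koszul_contract q f J)) K = f K" for K
    by (simp add: koszul_diff_commute[where R=R and T=T, OF \<open>linear R\<close> comm] R)
  then show "\<exists>g. koszul_diff T g = f" by blast
qed

text \<open>
The difference of two contractions is a homotopy for \<open>T\<^sub>p - T\<^sub>q\<close>.
\<close>

lemma koszul_exact_if_diff_bij:
  assumes R: "linear R" "\<And>i x. T i (R x) = R (T i x)" "\<And>x. R (T p x - T q x) = x"
  shows "koszul_exact T"
  unfolding koszul_exact_iff
proof (intro allI impI)
  fix f assume f: "koszul_diff T f = (\<lambda>J. 0)"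
  have "koszul_diff T (koszul_contract q f) K = T q (f K)" for q K
    using koszul_contract_homotopy[where T=T, OF lin, where q=q and f=f and K=K] by (simp add: f koszul_contract_def split: if_splits)
  then have "koszul_diff T (\<lambda>J. R (koszul_contract p f J - koszul_contract q f J)) K = f K" for K
    by (simp add: koszul_diff_commute[where R=R and T=T, OF R(1,2)] koszul_diff_minus[OF lin] R)
  then show "\<exists>g. koszul_diff T g = f" by blast
qed

end

text \<open>
Multiplying the coefficient of \<open>e\<^sub>J\<close> by \<open>\<Prod>j\<in>J. r j\<close> is an isomorphism between the two complexes.
\<close>

lemma koszul_exact_scaleR:
  fixes T :: "'n::{finite,linorder} \<Rightarrow> 'a::complex_inner \<Rightarrow> 'a"
  assumes "commuting_maps T" "\<And>i. r i \<noteq> 0" "koszul_exact T"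
  shows "koszul_exact (\<lambda>i x. r i *\<^sub>R T i x)"
proof -
  interpret commuting_maps T by fact
  interpret S: commuting_maps "\<lambda>i x. r i *\<^sub>R T i x"
    by unfold_locales
      (auto simp: linear_add[OF lin] linear_cmul[OF lin] scaleR_right_distrib commute mult.commute intro!: linearI)
  define m where "m J = prod r J" for J
  have m0: "m J \<noteq> 0" for J by (simp add: m_def assms)
  have d: "koszul_diff (\<lambda>i x. r i *\<^sub>R T i x) (\<lambda>J. m J *\<^sub>R f J) K = m K *\<^sub>R koszul_diff T f K" for f K
    unfolding koszul_diff_sign scaleR_right.sum
    by (intro sum.cong refl)
      (simp add: linear_cmul[OF lin] m_def prod.remove[of K] mult.commute mult.left_commute)
  show ?thesis unfolding S.koszul_exact_iff
  proof (intro allI impI)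
    fix f assume f: "koszul_diff (\<lambda>i x. r i *\<^sub>R T i x) f = (\<lambda>J. 0)"
    have "koszul_diff T (\<lambda>J. inverse (m J) *\<^sub>R f J) K = 0" for K
      using d[of "\<lambda>J. inverse (m J) *\<^sub>R f J" K] m0 by (simp add: f)
    then obtain g where g: "koszul_diff T g = (\<lambda>J. inverse (m J) *\<^sub>R f J)"
      using assms(3) unfolding koszul_exact_iff by blast
    then have "koszul_diff (\<lambda>i x. r i *\<^sub>R T i x) (\<lambda>J. m J *\<^sub>R g J) K = f K" for K
      unfolding d using m0 by simp
    then show "\<exists>g. koszul_diff (\<lambda>i x. r i *\<^sub>R T i x) g = f" by blast
  qed
qed

text \<open>
Splitting the sets \<open>J\<close> according to whether they contain \<open>t\<close> presents the complex of \<open>T\<close> as the mapping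
cone of \<open>T\<^sub>t\<close> on the complex of the remaining operators: with \<open>\<epsilon>\<close> the degree sign, the differential is
\<open>(f0, f1) \<mapsto> (d f0, d f1 + \<epsilon> (T\<^sub>t f0))\<close>.  As \<open>T\<^sub>t = T\<^sub>q\<close> is homotopic to zero by the contraction \<open>s\<close>, the map
\<open>(f0, f1) \<mapsto> (f0, f1 - \<epsilon> (s f0))\<close> carries the cone to a direct sum of two copies of the smaller complex.
That \<open>t\<close> is the largest index makes the signs come out as \<open>\<epsilon>\<close>.
\<close>

lemma koszul_exact_adjoin_duplicate:
  fixes T :: "'m::{finite,linorder} \<Rightarrow> 'a::complex_inner \<Rightarrow> 'a"
    and \<iota> :: "'n::{finite,linorder} \<Rightarrow> 'm"
  assumes cm: "commuting_maps T" and mono: "strict_mono \<iota>"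
    and top: "\<And>i. \<iota> i < t" and UNIV: "UNIV = insert t (range \<iota>)"
    and dup: "T t = T (\<iota> q)"
  shows "koszul_exact T \<longleftrightarrow> koszul_exact (\<lambda>i. T (\<iota> i))"
proof -
  interpret commuting_maps T by fact
  interpret S: commuting_maps "\<lambda>i. T (\<iota> i)" by (intro commuting_maps.intro lin commute)
  define d where "d = koszul_diff (\<lambda>i. T (\<iota> i))"
  define s where "s = (koszul_contract q :: ('n set \<Rightarrow> 'a) \<Rightarrow> _)"
  define \<epsilon> where "\<epsilon> f = (\<lambda>K. (- 1) ^ card K *\<^sub>R f K)" for f :: "'n set \<Rightarrow> 'a"
  have inj: "inj \<iota>" using mono by (rule strict_mono_imp_inj_on)
  have t: "t \<notin> range \<iota>" using top by (metis less_irrefl rangeE)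
  have d_add: "d (\<lambda>J. f J + g J) = (\<lambda>K. d f K + d g K)"
    and d_minus: "d (\<lambda>J. f J - g J) = (\<lambda>K. d f K - d g K)" for f g
    unfolding d_def by (auto simp: koszul_diff_add[OF S.lin] koszul_diff_minus[OF S.lin])
  have d_zero: "d (\<lambda>J. 0) = (\<lambda>J. 0)" unfolding d_def by (simp add: S.lin)
  have htpy: "d (s f) K + s (d f) K = T t (f K)" for f K
    unfolding d_def s_def dup by (rule koszul_contract_homotopy[OF S.lin])
  have d_\<epsilon>: "d (\<epsilon> f) K = - \<epsilon> (d f) K" for f K
  proof -
    have "(- 1) ^ card (K - {j}) = - ((- 1) ^ card K :: real)" if "j \<in> K" for j
      using card_Suc_Diff1[OF finite that] by (metis minus_minus mult_minus1 power_Suc)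
    then have "koszul_sign j K *\<^sub>R T (\<iota> j) (\<epsilon> f (K - {j}))
        = - ((- 1) ^ card K *\<^sub>R koszul_sign j K *\<^sub>R T (\<iota> j) (f (K - {j})))" if "j \<in> K" for j
      using that by (simp add: \<epsilon>_def linear_cmul[OF lin] linear_neg[OF lin])
    then show ?thesis
      by (simp add: d_def koszul_diff_sign \<epsilon>_def scaleR_right.sum sum_negf)
  qed
  have s_zero: "s (\<lambda>J. 0) = (\<lambda>J. 0)" by (auto simp: s_def koszul_contract_def)
  have \<epsilon>_zero: "\<epsilon> (\<lambda>J. 0) = (\<lambda>J. 0)" by (auto simp: \<epsilon>_def)
  have d_\<epsilon>s: "d (\<epsilon> (s f)) K = \<epsilon> (s (d f)) K - \<epsilon> (\<lambda>K. T t (f K)) K" for f K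
    unfolding d_\<epsilon> by (simp add: \<epsilon>_def scaleR_right_diff_distrib flip: htpy)
      (simp add: scaleR_right_distrib)
  have sgn: "koszul_sign (\<iota> j) (\<iota> ` K) = koszul_sign j K" for j K
  proof -
    have "{i \<in> \<iota> ` K. i < \<iota> j} = \<iota> ` {i \<in> K. i < j}"
      using strict_mono_less[OF mono] by auto
    then show ?thesis
      unfolding koszul_sign_def by (simp add: card_image inj_on_subset[OF inj])
  qed
  have remove: "\<iota> ` K - {\<iota> j} = \<iota> ` (K - {j})" for K j
    using inj by (auto dest: injD)
  have diff0: "koszul_diff T f (\<iota> ` K) = d (\<lambda>K. f (\<iota> ` K)) K" for f K
    unfolding koszul_diff_sign d_def
    by (simp add: sum.reindex[OF inj_on_subset[OF inj subset_UNIV]] sgn remove)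
  have diff1: "koszul_diff T f (insert t (\<iota> ` K))
      = d (\<lambda>K. f (insert t (\<iota> ` K))) K + \<epsilon> (\<lambda>K. T t (f (\<iota> ` K))) K" for f K
  proof -
    have tK: "t \<notin> \<iota> ` K" using t by auto
    have "{i \<in> \<iota> ` K. i < t} = \<iota> ` K" using top by auto
    then have sgn_t: "koszul_sign t (\<iota> ` K) = (- 1) ^ card K"
      by (simp add: koszul_sign_def card_image inj_on_subset[OF inj])
    have "koszul_diff T f (insert t (\<iota> ` K)) = koszul_sign t (\<iota> ` K) *\<^sub>R T t (f (\<iota> ` K))
      + (\<Sum>j\<in>\<iota> ` K. koszul_sign j (insert t (\<iota> ` K)) *\<^sub>R T j (f (insert t (\<iota> ` K) - {j})))"
      unfolding koszul_diff_sign using tK by simp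
    also have "(\<Sum>j\<in>\<iota> ` K. koszul_sign j (insert t (\<iota> ` K)) *\<^sub>R T j (f (insert t (\<iota> ` K) - {j})))
      = (\<Sum>j\<in>K. koszul_sign j K *\<^sub>R T (\<iota> j) (f (insert t (\<iota> ` (K - {j})))))"
    proof -
      have "koszul_sign (\<iota> j) (insert t (\<iota> ` K)) = koszul_sign j K" for j
        using koszul_sign_insert[OF tK, of "\<iota> j"] top[of j] by (simp add: sgn)
      moreover have "insert t (\<iota> ` K) - {\<iota> j} = insert t (\<iota> ` (K - {j}))" for j
        using top[of j] by (simp add: insert_Diff_if remove)
      ultimately show ?thesis
        by (simp add: sum.reindex[OF inj_on_subset[OF inj subset_UNIV]])
    qed
    finally show ?thesis by (simp add: sgn_t d_def koszul_diff_sign \<epsilon>_def)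
  qed
  \<comment> \<open>A form is determined by its parts without and with \<open>t\<close>, and these can be prescribed.\<close>
  have cover: "f = g" if "\<And>K. f (\<iota> ` K) = g (\<iota> ` K)"
      "\<And>K. f (insert t (\<iota> ` K)) = g (insert t (\<iota> ` K))" for f g :: "'m set \<Rightarrow> 'a"
  proof
    fix J
    have "J \<subseteq> insert t (range \<iota>)" using UNIV by blast
    then have "J = \<iota> ` (\<iota> -` J) \<or> J = insert t (\<iota> ` (\<iota> -` J))" using t by auto
    then show "f J = g J" using that by metis
  qed
  define join where "join f0 f1 J = (if t \<in> J then f1 (\<iota> -` J) else f0 (\<iota> -` J))"
    for f0 f1 :: "'n set \<Rightarrow> 'a" and J
  have vimage: "\<iota> -` (\<iota> ` K) = K" "\<iota> -` (insert t (\<iota> ` K)) = K" for K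
    using inj t by (auto dest: injD)
  have join0: "join f0 f1 (\<iota> ` K) = f0 K" and join1: "join f0 f1 (insert t (\<iota> ` K)) = f1 K" for f0 f1 K
  proof -
    have "t \<notin> \<iota> ` K" using t by auto
    then show "join f0 f1 (\<iota> ` K) = f0 K" "join f0 f1 (insert t (\<iota> ` K)) = f1 K"
      unfolding join_def vimage by auto
  qed
  show ?thesis unfolding koszul_exact_iff S.koszul_exact_iff d_def[symmetric]
  proof (intro iffI allI impI)
    fix f assume ex: "\<forall>f. koszul_diff T f = (\<lambda>J. 0) \<longrightarrow> (\<exists>g. koszul_diff T g = f)"
      and f: "d f = (\<lambda>J. 0)"
    have "koszul_diff T (join (\<lambda>K. 0) f) = (\<lambda>J. 0)"
      by (rule cover)
        (simp_all add: diff0 diff1 join0 join1 d_zero f linear_0[OF lin] \<epsilon>_zero)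
    then obtain g where g: "koszul_diff T g = join (\<lambda>K. 0) f" using ex by blast
    define g0 g1 where "g0 = (\<lambda>K. g (\<iota> ` K))" and "g1 = (\<lambda>K. g (insert t (\<iota> ` K)))"
    have dg0: "d g0 = (\<lambda>K. 0)"
      using diff0[of g] by (simp add: g join0 g0_def fun_eq_iff)
    have "d g1 K + \<epsilon> (\<lambda>K. T t (g0 K)) K = f K" for K
      using diff1[of g K] by (simp add: g join1 g0_def g1_def)
    then have "d (\<lambda>K. g1 K - \<epsilon> (s g0) K) K = f K" for K
      by (simp add: d_minus d_\<epsilon>s dg0 s_zero \<epsilon>_zero)
    then show "\<exists>g. d g = f" by blast
  next
    fix f assume ex: "\<forall>f. d f = (\<lambda>J. 0) \<longrightarrow> (\<exists>g. d g = f)"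
      and f: "koszul_diff T f = (\<lambda>J. 0)"
    define f0 f1 where "f0 = (\<lambda>K. f (\<iota> ` K))" and "f1 = (\<lambda>K. f (insert t (\<iota> ` K)))"
    have df0: "d f0 = (\<lambda>J. 0)" using diff0[of f] by (simp add: f f0_def fun_eq_iff)
    have df1: "d f1 K + \<epsilon> (\<lambda>K. T t (f0 K)) K = 0" for K
      using diff1[of f K] by (simp add: f f0_def f1_def)
    obtain g0 where g0: "d g0 = f0" using ex df0 by blast
    have "d (\<lambda>K. f1 K - \<epsilon> (s f0) K) = (\<lambda>J. 0)"
      using df1 by (simp add: d_minus d_\<epsilon>s df0 s_zero \<epsilon>_zero)
    then obtain h where h: "d h = (\<lambda>K. f1 K - \<epsilon> (s f0) K)" using ex by blast
    have "koszul_diff T (join g0 (\<lambda>K. h K + \<epsilon> (s g0) K)) = f"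
    proof (rule cover)
      fix K
      show "koszul_diff T (join g0 (\<lambda>K. h K + \<epsilon> (s g0) K)) (\<iota> ` K) = f (\<iota> ` K)"
        by (simp add: diff0 join0 g0 f0_def)
      show "koszul_diff T (join g0 (\<lambda>K. h K + \<epsilon> (s g0) K)) (insert t (\<iota> ` K)) = f (insert t (\<iota> ` K))"
        by (simp add: diff1 join0 join1 d_add d_\<epsilon>s g0 h f1_def)
    qed
    then show "\<exists>g. koszul_diff T g = f" by blast
  qed
qed

section \<open>Adjoints on complex Hilbert spaces\<close>

lemma scaleC_zero_right [simp]: "c *\<^sub>C (0::'a::complex_inner) = 0"
  using scaleC_add_right[of c "0::'a" 0] by simp

lemma scaleC_one [simp]: "1 *\<^sub>C (x::'a::complex_inner) = x"
  using scaleC_of_real[of 1 x] by simp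

lemma scaleC_minus_right: "c *\<^sub>C (- x) = - (c *\<^sub>C (x::'a::complex_inner))"
  using scaleC_add_right[of c x "- x"] by (simp add: eq_neg_iff_add_eq_0 add.commute)

lemma scaleC_diff_right: "c *\<^sub>C (x - y) = c *\<^sub>C x - c *\<^sub>C (y::'a::complex_inner)"
  using scaleC_add_right[of c x "- y"] by (simp add: scaleC_minus_right)

lemma scaleC_diff_left: "(c - d) *\<^sub>C x = c *\<^sub>C x - d *\<^sub>C (x::'a::complex_inner)"
  using scaleC_add_left[of "c - d" d x] by (simp add: algebra_simps)

lemma scaleC_minus_left: "(- c) *\<^sub>C x = - (c *\<^sub>C (x::'a::complex_inner))"
  using scaleC_diff_left[of 0 c x] scaleC_of_real[of 0 x] by simp

lemma scaleC_scaleR_commute: "c *\<^sub>C r *\<^sub>R x = r *\<^sub>R c *\<^sub>C (x::'a::complex_inner)"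
  by (simp add: scaleC_scaleC mult.commute flip: scaleC_of_real)

lemma cinner_scaleC_right: "cinner x (c *\<^sub>C y) = cnj c * cinner x (y::'a::complex_inner)"
  by (metis cinner_commute cinner_scaleC_left complex_cnj_mult)

lemma inner_scaleC_left: "inner (c *\<^sub>C x) y = inner x (cnj c *\<^sub>C (y::'a::complex_inner))"
  by (simp add: inner_eq_Re_cinner cinner_scaleC_left cinner_scaleC_right)

lemma norm_scaleC: "norm (c *\<^sub>C (x::'a::complex_inner)) = cmod c * norm x"
proof -
  have "cinner (c *\<^sub>C x) (c *\<^sub>C x) = c * cnj c * cinner x x"
    by (simp add: cinner_scaleC_left cinner_scaleC_right)
  then have "complex_of_real ((norm (c *\<^sub>C x))\<^sup>2) = c * cnj c * complex_of_real ((norm x)\<^sup>2)"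
    unfolding cinner_self .
  also have "\<dots> = complex_of_real ((cmod c * norm x)\<^sup>2)"
    by (simp add: complex_norm_square[symmetric] power_mult_distrib)
  finally have "(norm (c *\<^sub>C x))\<^sup>2 = (cmod c * norm x)\<^sup>2" unfolding of_real_eq_iff .
  then show ?thesis by simp
qed

lemma bounded_linear_scaleC: "bounded_linear (\<lambda>x. c *\<^sub>C (x::'a::complex_inner))"
  by (rule bounded_linear_intro[where K = "cmod c"])
    (auto simp: scaleC_add_right scaleC_scaleR_commute norm_scaleC)

lemma cinner_eq_inner:
  "cinner x y = Complex (inner x y) (inner x (\<i> *\<^sub>C (y::'a::complex_inner)))"
  by (simp add: inner_eq_Re_cinner cinner_scaleC_right complex_eq_iff)

text \<open>
The representing vector minimises \<open>Q x = \<parallel>x\<parallel>\<^sup>2 / 2 - f x\<close>.  By the parallelogram law a minimising sequence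
is Cauchy, and at the minimum the derivative in every direction vanishes.
\<close>

lemma riesz_representation:
  fixes f :: "'a::{real_inner,banach} \<Rightarrow> real"
  assumes "bounded_linear f"
  shows "\<exists>y. \<forall>x. f x = inner x y"
proof -
  interpret f: bounded_linear f by fact
  obtain K where K: "\<And>x. \<bar>f x\<bar> \<le> norm x * K" "K > 0" using f.pos_bounded by auto
  define Q where "Q x = (norm x)\<^sup>2 / 2 - f x" for x
  define m where "m = Inf (range Q)"
  have Q_low: "- K\<^sup>2 / 2 \<le> Q x" for x
  proof -
    have "0 \<le> (norm x - K)\<^sup>2 / 2" by simp
    then show ?thesis using K(1)[of x] by (simp add: Q_def power2_diff field_simps abs_le_iff)
  qed
  have m: "m \<le> Q x" for x unfolding m_def
    by (rule cInf_lower) (auto intro!: bdd_belowI[where m = "- K\<^sup>2 / 2"] Q_low simp: Q_low)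
  have "\<exists>x. Q x < m + 1 / Suc n" for n
    using cInf_lessD[of "range Q" "m + 1 / Suc n"] by (auto simp: m_def)
  then obtain u where u: "\<And>n. Q (u n) < m + 1 / Suc n" by metis
  have near: "(norm (x - y))\<^sup>2 \<le> 4 * (Q x - m) + 4 * (Q y - m)" for x y
  proof -
    have "Q ((1/2) *\<^sub>R (x + y)) = Q x / 2 + Q y / 2 - (norm (x - y))\<^sup>2 / 8"
      by (simp add: Q_def f.scaleR f.add power2_norm_eq_inner inner_add inner_diff
          inner_commute algebra_simps power_divide) (simp add: field_simps)
    then show ?thesis using m[of "(1/2) *\<^sub>R (x + y)"] by simp
  qed
  have "Cauchy u"
  proof (rule metric_CauchyI)
    fix e :: real assume "e > 0"
    then obtain N where N: "8 / e\<^sup>2 < real N" using reals_Archimedean2 by blast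
    have "dist (u i) (u j) < e" if "i \<ge> N" "j \<ge> N" for i j
    proof -
      have pos: "real N > 0" using N \<open>e > 0\<close> by (smt (verit) divide_pos_pos zero_less_power)
      have "1 / Suc i \<le> 1 / real N" "1 / Suc j \<le> 1 / real N"
        using that pos by (auto intro!: divide_left_mono)
      then have "(norm (u i - u j))\<^sup>2 < 8 / real N"
        using near[of "u i" "u j"] u[of i] u[of j] by simp
      also have "\<dots> < e\<^sup>2" using N pos \<open>e > 0\<close> by (simp add: field_simps)
      finally show ?thesis using \<open>e > 0\<close>
        by (metis dist_norm less_eq_real_def power2_less_imp_less)
    qed
    then show "\<exists>M. \<forall>i\<ge>M. \<forall>j\<ge>M. dist (u i) (u j) < e" by blast
  qed
  then obtain y where y: "u \<longlonglongrightarrow> y" using Cauchy_convergent_iff convergent_def by blast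
  have "(\<lambda>n. Q (u n)) \<longlonglongrightarrow> Q y" unfolding Q_def
    by (intro tendsto_intros y f.tendsto) simp
  moreover have "(\<lambda>n. m + 1 / Suc n) \<longlonglongrightarrow> m + 0"
    by (intro tendsto_intros LIMSEQ_Suc lim_1_over_n)
  ultimately have "Q y \<le> m"
    by (intro LIMSEQ_le[of "\<lambda>n. Q (u n)" _ "\<lambda>n. m + 1 / Suc n"]) (use less_imp_le[OF u] in auto)
  have "f x = inner x y" for x
  proof (rule ccontr)
    assume ne: "f x \<noteq> inner x y"
    define b where "b = f x - inner x y"
    define t where "t = b / ((norm x)\<^sup>2 + 1)"
    have pos: "(norm x)\<^sup>2 + 1 > 0" by (smt (verit) zero_le_power2)
    have "Q (y + t *\<^sub>R x) = Q y - t * b + t\<^sup>2 * (norm x)\<^sup>2 / 2"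
      by (simp add: Q_def b_def f.scaleR f.add power2_norm_eq_inner inner_add inner_commute algebra_simps)
        (simp add: field_simps power2_eq_square)
    also have "\<dots> \<le> Q y - t * b + t\<^sup>2 * ((norm x)\<^sup>2 + 1) / 2" by (simp add: field_simps)
    also have "t\<^sup>2 * ((norm x)\<^sup>2 + 1) = t * b" using pos by (simp add: t_def power2_eq_square)
    finally have "Q (y + t *\<^sub>R x) \<le> Q y - t * b / 2" by (simp add: mult.commute)
    moreover have "t * b > 0"
  proof -
    have "b * b > 0" using ne by (simp add: b_def flip: power2_eq_square)
    then show ?thesis using pos by (simp add: t_def)
  qed
    ultimately show False using m[of "y + t *\<^sub>R x"] \<open>Q y \<le> m\<close> by linarith
  qed
  then show ?thesis by blast
qed

lemma inner_eqI:
  fixes u v :: "'a::real_inner"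
  assumes "\<And>x. inner x u = inner x v"
  shows "u = v"
proof -
  have "inner (u - v) (u - v) = 0" using assms[of "u - v"] by (simp only: inner_diff_right)
  then show ?thesis by simp
qed

text \<open>
The adjoint for the real inner product is found by the Riesz representation; complex linearity of
\<open>T\<close> makes it an adjoint for the complex inner product, whose imaginary part is
\<open>inner x (\<i> *\<^sub>C y)\<close>.
\<close>

lemma cadjoint_exists:
  fixes T :: "'a::chilbert_space \<Rightarrow>\<^sub>L 'a"
  assumes "complex_linear_op T"
  shows "\<exists>S :: 'a \<Rightarrow>\<^sub>L 'a. \<forall>x y. cinner (T x) y = cinner x (S y)"
proof -
  have "\<exists>z. \<forall>x. inner (T x) y = inner x z" for y
    by (intro riesz_representation bounded_linear_inner_left_comp blinfun.bounded_linear_right)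
  then obtain S where S: "\<And>x y. inner (T x) y = inner x (S y)" by metis
  have "bounded_linear S"
  proof (rule bounded_linear_intro[where K = "norm T"])
    fix x y r
    show "S (x + y) = S x + S y" by (rule inner_eqI) (simp add: inner_add_right flip: S)
    show "S (r *\<^sub>R x) = r *\<^sub>R S x" by (rule inner_eqI) (simp flip: S)
    have "norm (S x) * norm (S x) = inner (T (S x)) x"
      by (simp add: S power2_norm_eq_inner flip: power2_eq_square)
    also have "\<dots> \<le> norm (T (S x)) * norm x" by (rule norm_cauchy_schwarz)
    also have "\<dots> \<le> norm (S x) * (norm x * norm T)"
      using mult_right_mono[OF norm_blinfun[of T "S x"] norm_ge_zero[of x]] by (simp add: mult_ac)
    finally show "norm (S x) \<le> norm x * norm T"
      by (cases "S x = 0") auto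
  qed
  moreover have "cinner (T x) y = cinner x (S y)" for x y
  proof -
    have "inner (T x) (\<i> *\<^sub>C y) = inner (T (cnj \<i> *\<^sub>C x)) y"
      using assms inner_scaleC_left[of "cnj \<i>" "T x" y] by (simp add: complex_linear_op_def)
    also have "\<dots> = inner x (\<i> *\<^sub>C S y)" using inner_scaleC_left[of "cnj \<i>" x "S y"] by (simp add: S)
    finally show ?thesis unfolding cinner_eq_inner by (simp add: S)
  qed
  ultimately show ?thesis by (metis bounded_linear_Blinfun_apply)
qed

lemma cinner_cadjoint:
  fixes T :: "'a::chilbert_space \<Rightarrow>\<^sub>L 'a"
  assumes "complex_linear_op T"
  shows "cinner (T x) y = cinner x (cadjoint T y)"
  using someI_ex[OF cadjoint_exists[OF assms]] unfolding cadjoint_def by blast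

lemma inner_cadjoint:
  fixes T :: "'a::chilbert_space \<Rightarrow>\<^sub>L 'a"
  assumes "complex_linear_op T"
  shows "inner (T x) y = inner x (cadjoint T y)"
  by (simp add: inner_eq_Re_cinner cinner_cadjoint[OF assms])

lemma complex_linear_cadjoint:
  fixes T :: "'a::chilbert_space \<Rightarrow>\<^sub>L 'a"
  assumes "complex_linear_op T"
  shows "complex_linear_op (cadjoint T)"
  unfolding complex_linear_op_def
proof (intro allI)
  fix c x
  show "cadjoint T (c *\<^sub>C x) = c *\<^sub>C cadjoint T x"
  proof (rule inner_eqI)
    fix z
    have "inner z (cadjoint T (c *\<^sub>C x)) = inner (T (cnj c *\<^sub>C z)) x"
      using assms inner_scaleC_left[of "cnj c" "T z" x]
      by (simp add: inner_cadjoint[OF assms, symmetric] complex_linear_op_def)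
    also have "\<dots> = inner z (c *\<^sub>C cadjoint T x)"
      using inner_scaleC_left[of "cnj c" z "cadjoint T x"] by (simp add: inner_cadjoint[OF assms])
    finally show "inner z (cadjoint T (c *\<^sub>C x)) = inner z (c *\<^sub>C cadjoint T x)" .
  qed
qed

lemma complex_linear_scaleR:
  "complex_linear_op T \<Longrightarrow> complex_linear_op (r *\<^sub>R T)"
  by (simp add: complex_linear_op_def scaleR_blinfun.rep_eq scaleC_scaleR_commute)

lemma cadjoint_scaleR:
  fixes T :: "'a::chilbert_space \<Rightarrow>\<^sub>L 'a"
  assumes "complex_linear_op T"
  shows "cadjoint (r *\<^sub>R T) = r *\<^sub>R cadjoint T"
proof (rule blinfun_eqI, rule inner_eqI)
  fix x z
  show "inner z (cadjoint (r *\<^sub>R T) x) = inner z ((r *\<^sub>R cadjoint T) x)"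
    by (simp add: scaleR_blinfun.rep_eq inner_cadjoint[OF assms]
        flip: inner_cadjoint[OF complex_linear_scaleR[OF assms]])
qed

lemma normal_op_scaleR_iff:
  fixes T :: "'a::chilbert_space \<Rightarrow>\<^sub>L 'a"
  assumes "complex_linear_op T" "r \<noteq> 0"
  shows "normal_op (r *\<^sub>R T) \<longleftrightarrow> normal_op T"
  using assms(2)
  by (simp add: normal_op_def cadjoint_scaleR[OF assms(1)] bounded_bilinear.scaleR_left[OF bounded_bilinear_blinfun_compose] bounded_bilinear.scaleR_right[OF bounded_bilinear_blinfun_compose])

text \<open>
A relation between plain functions, so that it applies directly to the shifted operators
\<open>\<lambda>x. T x - a *\<^sub>C x\<close> in the Koszul complex.
\<close>

definition adjoint_pair :: "('a::real_inner \<Rightarrow> 'a) \<Rightarrow> ('a \<Rightarrow> 'a) \<Rightarrow> bool" where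
  "adjoint_pair F G \<longleftrightarrow> bounded_linear F \<and> bounded_linear G \<and> (\<forall>x y. inner (F x) y = inner x (G y))"

lemma normal_norm_eq:
  assumes "adjoint_pair F G" "\<And>x. F (G x) = G (F x)"
  shows "norm (F x) = norm (G x)"
proof -
  have "inner (F x) (F x) = inner (G x) (G x)"
    using assms by (metis adjoint_pair_def inner_commute)
  then show ?thesis by (simp add: norm_eq_sqrt_inner)
qed

lemma adjoint_pair_shift:
  fixes T :: "'a::chilbert_space \<Rightarrow>\<^sub>L 'a"
  assumes "complex_linear_op T"
  shows "adjoint_pair (\<lambda>x. T x - a *\<^sub>C x) (\<lambda>x. cadjoint T x - cnj a *\<^sub>C x)"
  unfolding adjoint_pair_def
  by (auto intro!: bounded_linear_sub blinfun.bounded_linear_right bounded_linear_scaleC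
      simp: inner_diff_left inner_diff_right inner_cadjoint[OF assms] inner_scaleC_left)

lemma normal_shift_norm_eq:
  fixes T :: "'a::chilbert_space \<Rightarrow>\<^sub>L 'a"
  assumes "complex_linear_op T" "normal_op T"
  shows "norm (cadjoint T x - cnj a *\<^sub>C x) = norm (T x - a *\<^sub>C x)"
proof (rule normal_norm_eq[OF adjoint_pair_shift[OF assms(1)], symmetric])
  fix x
  have "cadjoint T (T x) = T (cadjoint T x)"
    using assms(2) unfolding normal_op_def by (metis blinfun_apply_blinfun_compose)
  then show "T (cadjoint T x - cnj a *\<^sub>C x) - a *\<^sub>C (cadjoint T x - cnj a *\<^sub>C x) =
         cadjoint T (T x - a *\<^sub>C x) - cnj a *\<^sub>C (T x - a *\<^sub>C x)"
    using assms(1) complex_linear_cadjoint[OF assms(1)]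
    by (simp add: complex_linear_op_def blinfun.diff_right scaleC_diff_right scaleC_scaleC mult.commute)
qed

section \<open>Joint approximate eigenvalues\<close>

text \<open>
For \<open>m x = \<Sum>\<^sub>i \<parallel>T\<^sub>i x - w\<^sub>i x\<parallel>\<close> this says that \<open>w\<close> is a joint approximate eigenvalue of the \<open>T\<^sub>i\<close>.
Keeping \<open>m\<close> general allows eigenvalues to be found one operator at a time: the vectors with small
\<open>m\<close> play the part of the joint eigenspace found so far.
\<close>

definition almost_vanishing :: "('a::real_normed_vector \<Rightarrow> real) \<Rightarrow> bool" where
  "almost_vanishing m \<longleftrightarrow> (\<forall>\<epsilon>>0. \<exists>x. norm x = 1 \<and> m x \<le> \<epsilon>)"

definition cseminorm :: "('a::complex_inner \<Rightarrow> real) \<Rightarrow> bool" where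
  "cseminorm m \<longleftrightarrow> (\<forall>x y. m (x + y) \<le> m x + m y) \<and> (\<forall>c x. m (c *\<^sub>C x) = cmod c * m x)"

lemma cseminorm_scaleR: "cseminorm m \<Longrightarrow> m (r *\<^sub>R x) = \<bar>r\<bar> * m x"
  unfolding cseminorm_def by (metis norm_of_real scaleC_of_real)

lemma cseminorm_minus: "cseminorm m \<Longrightarrow> m (- x) = m x"
  using cseminorm_scaleR[of m "-1" x] by simp

lemma cseminorm_diff: "cseminorm m \<Longrightarrow> m (x - y) \<le> m x + m y"
  by (metis cseminorm_def cseminorm_minus diff_conv_add_uminus)

lemma cseminorm_nonneg: "cseminorm m \<Longrightarrow> 0 \<le> m x"
  using cseminorm_diff[of m x x] cseminorm_scaleR[of m 0 x] by simp

lemma cseminorm_add: "cseminorm m \<Longrightarrow> cseminorm n \<Longrightarrow> cseminorm (\<lambda>x. m x + n x)"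
  by (auto simp: cseminorm_def algebra_simps add_mono) (smt (verit))

lemma cseminorm_norm:
  assumes "\<And>x y. F (x + y) = F x + F y" "\<And>c x. F (c *\<^sub>C x) = c *\<^sub>C F x"
  shows "cseminorm (\<lambda>x. norm (F x))"
  by (auto simp: cseminorm_def assms norm_scaleC norm_triangle_ineq)

lemma almost_vanishing_mono:
  assumes "almost_vanishing m" "\<And>x. n x \<le> m x"
  shows "almost_vanishing n"
  using assms unfolding almost_vanishing_def by (meson order_trans)

text \<open>
The operator \<open>H\<close> respects the approximate kernel of \<open>m\<close>.  Let \<open>\<mu>\<close> be the top of its numerical range there.
The form \<open>\<langle>(\<mu> - H) x, x\<rangle>\<close> is then nearly positive on the approximate kernel, so by the Cauchy-Schwarz
argument \<open>(\<mu> - H) x\<close> is small whenever the form is small at \<open>x\<close>: otherwise moving from \<open>x\<close> a little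
in the direction of \<open>(H - \<mu>) x\<close> would make the form negative.
\<close>

lemma approximate_eigenvalue_symmetric:
  fixes H :: "'a::complex_inner \<Rightarrow> 'a"
  assumes m: "cseminorm m" "almost_vanishing m"
    and H: "bounded_linear H" "\<And>x y. inner (H x) y = inner x (H y)" "\<And>x. m (H x) \<le> C * m x"
  obtains \<mu> :: real where "almost_vanishing (\<lambda>x. m x + norm (H x - \<mu> *\<^sub>R x))"
    and "\<And>\<delta>. \<delta> > 0 \<Longrightarrow> \<exists>\<epsilon>>0. \<forall>x. norm x = 1 \<and> m x \<le> \<epsilon> \<longrightarrow> inner (H x) x \<le> \<mu> + \<delta>"
proof -
  interpret H: bounded_linear H by fact
  obtain K where K: "K > 0" "\<And>x. norm (H x) \<le> norm x * K" using H.pos_bounded by auto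
  define V where "V \<epsilon> = {inner (H x) x | x. norm x = 1 \<and> m x \<le> \<epsilon>}" for \<epsilon>
  define s where "s \<epsilon> = Sup (V \<epsilon>)" for \<epsilon>
  define \<mu> where "\<mu> = Inf (s ` {0<..})"
  have V_bound: "\<bar>v\<bar> \<le> K" if "v \<in> V \<epsilon>" for v \<epsilon>
  proof -
    obtain x where x: "v = inner (H x) x" "norm x = 1" using \<open>v \<in> V \<epsilon>\<close> by (auto simp: V_def)
    show ?thesis using Cauchy_Schwarz_ineq2[of "H x" x] K(2)[of x] x by simp
  qed
  have V_ne: "V \<epsilon> \<noteq> {}" if "\<epsilon> > 0" for \<epsilon>
    using m(2) that unfolding almost_vanishing_def V_def by blast
  have V_bdd: "bdd_above (V \<epsilon>)" for \<epsilon> by (rule bdd_aboveI[where M = K]) (use V_bound abs_le_D1 in blast)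
  have s_low: "- K \<le> s \<epsilon>" if "\<epsilon> > 0" for \<epsilon>
  proof -
    obtain v where v: "v \<in> V \<epsilon>" using V_ne[OF \<open>\<epsilon> > 0\<close>] by blast
    then show ?thesis using cSup_upper[OF v V_bdd] V_bound[OF v] by (simp add: s_def)
  qed
  have s_bdd: "bdd_below (s ` {0<..})" by (rule bdd_belowI[where m = "- K"]) (use s_low in auto)
  have \<mu>_le: "\<mu> \<le> s \<epsilon>" if "\<epsilon> > 0" for \<epsilon>
    unfolding \<mu>_def by (rule cInf_lower[OF _ s_bdd]) (use that in auto)
  have upper: "\<exists>\<epsilon>>0. \<forall>x. norm x = 1 \<and> m x \<le> \<epsilon> \<longrightarrow> inner (H x) x \<le> \<mu> + \<delta>" if "\<delta> > 0" for \<delta>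
  proof -
    have "\<exists>v\<in>s ` {0<..}. v < \<mu> + \<delta>"
      unfolding \<mu>_def using that by (intro cInf_lessD) (auto simp: \<mu>_def)
    then obtain \<epsilon> where \<epsilon>: "\<epsilon> > 0" "s \<epsilon> < \<mu> + \<delta>" by auto
    have "inner (H x) x \<le> s \<epsilon>" if "norm x = 1" "m x \<le> \<epsilon>" for x
      unfolding s_def by (rule cSup_upper[OF _ V_bdd]) (use that V_def in blast)
    then show ?thesis using \<epsilon> by fastforce
  qed
  have lower: "\<exists>x. norm x = 1 \<and> m x \<le> \<epsilon> \<and> \<mu> - \<delta> < inner (H x) x" if "\<epsilon> > 0" "\<delta> > 0" for \<epsilon> \<delta>
  proof -
    have "\<exists>v\<in>V \<epsilon>. \<mu> - \<delta> < v"
      using \<mu>_le[OF that(1)] that(2) by (intro less_cSupD V_ne that) (simp add: s_def[symmetric])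
    then show ?thesis by (auto simp: V_def)
  qed
  have "\<exists>x. norm x = 1 \<and> m x + norm (H x - \<mu> *\<^sub>R x) \<le> e" if e: "e > 0" for e
  proof -
    define M where "M = K + \<bar>\<mu>\<bar> + 1"
    have M: "M > 0" using K(1) by (simp add: M_def)
    \<comment> \<open>The estimate below is \<open>\<parallel>B x\<parallel>\<^sup>2 \<le> 4 M \<delta>\<close>, where \<open>M\<close> bounds the norm of \<open>B = \<mu> + \<delta> - H\<close> for all \<open>\<delta> \<le> 1\<close>.\<close>
    define \<delta> where "\<delta> = min 1 (min (e / 4) (e\<^sup>2 / (64 * M)))"
    have \<delta>: "\<delta> > 0" "\<delta> \<le> 1" "\<delta> \<le> e / 4" "\<delta> \<le> e\<^sup>2 / (64 * M)" using e M by (auto simp: \<delta>_def)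
    obtain \<epsilon> where \<epsilon>: "\<epsilon> > 0" "\<And>x. norm x = 1 \<Longrightarrow> m x \<le> \<epsilon> \<Longrightarrow> inner (H x) x \<le> \<mu> + \<delta>"
      using upper[OF \<delta>(1)] by blast
    define B where "B x = (\<mu> + \<delta>) *\<^sub>R x - H x" for x
    define t where "t = 1 / (2 * M)"
    \<comment> \<open>\<open>D\<close> bounds the factor by which \<open>m\<close> grows from \<open>x\<close> to \<open>z = x - t B x\<close>.\<close>
    define D where "D = 1 + t * (\<bar>\<mu> + \<delta>\<bar> + \<bar>C\<bar>)"
    have t: "t > 0" "t * M = 1/2" using M by (auto simp: t_def)
    have D: "D \<ge> 1" using t by (simp add: D_def)
    have B_norm: "norm (B x) \<le> M * norm x" for x
    proof -
      have "norm (B x) \<le> \<bar>\<mu> + \<delta>\<bar> * norm x + norm x * K"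
        unfolding B_def using norm_triangle_ineq4[of "(\<mu> + \<delta>) *\<^sub>R x" "H x"] K(2)[of x] by simp
      also have "\<dots> = (\<bar>\<mu> + \<delta>\<bar> + K) * norm x" by (simp add: algebra_simps)
      also have "\<dots> \<le> M * norm x" using \<delta> by (intro mult_right_mono) (auto simp: M_def)
      finally show ?thesis .
    qed
    have B_m: "m (B x) \<le> (\<bar>\<mu> + \<delta>\<bar> + \<bar>C\<bar>) * m x" for x
    proof -
      have "m (B x) \<le> \<bar>\<mu> + \<delta>\<bar> * m x + C * m x"
        unfolding B_def using cseminorm_diff[OF m(1), of "(\<mu> + \<delta>) *\<^sub>R x" "H x"] H(3)[of x]
        by (simp add: cseminorm_scaleR[OF m(1)])
      also have "\<dots> \<le> \<bar>\<mu> + \<delta>\<bar> * m x + \<bar>C\<bar> * m x"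
        using mult_right_mono[OF abs_ge_self cseminorm_nonneg[OF m(1)]] by simp
      finally show ?thesis by (simp add: algebra_simps)
    qed
    obtain x where x: "norm x = 1" "m x \<le> min (e / 2) (\<epsilon> / (2 * D))" "\<mu> - \<delta> < inner (H x) x"
      using lower[of "min (e / 2) (\<epsilon> / (2 * D))" \<delta>] e \<epsilon>(1) D \<delta>(1) by auto
    define y where "y = B x"
    define z where "z = x - t *\<^sub>R y"
    have "t * norm y \<le> t * M" using B_norm[of x] t x(1) by (intro mult_left_mono) (auto simp: y_def)
    then have "norm (t *\<^sub>R y) \<le> 1/2" using t by simp
    then have z_norm: "norm z \<ge> 1/2" using norm_triangle_ineq2[of x "t *\<^sub>R y"] x(1) by (simp add: z_def)
    have "m z \<le> m x + t * m y" using cseminorm_diff[OF m(1), of x "t *\<^sub>R y"] t(1)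
      by (simp add: z_def cseminorm_scaleR[OF m(1)])
    also have "\<dots> \<le> m x + t * ((\<bar>\<mu> + \<delta>\<bar> + \<bar>C\<bar>) * m x)"
      using B_m[of x] t(1) by (simp add: y_def)
    also have "\<dots> = D * m x" by (simp add: D_def algebra_simps)
    also have "\<dots> \<le> D * (\<epsilon> / (2 * D))" using x(2) D by (intro mult_left_mono) auto
    also have "\<dots> = \<epsilon> / 2" using D by simp
    finally have z_m: "m z \<le> \<epsilon> / 2" .
    have "0 \<le> inner (B z) z"
    proof -
      define w where "w = (1 / norm z) *\<^sub>R z"
      have z0: "norm z > 0" using z_norm by linarith
      have "m w \<le> \<epsilon>"
      proof -
        have "m w = m z / norm z" using z0 by (simp add: w_def cseminorm_scaleR[OF m(1)])
        also have "\<dots> \<le> (\<epsilon> / 2) / (1 / 2)" by (rule frac_le) (use z_m z_norm \<epsilon> in auto)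
        finally show ?thesis by simp
      qed
      moreover have "norm w = 1" using z0 by (simp add: w_def)
      ultimately have "inner (H w) w \<le> \<mu> + \<delta>" using \<epsilon>(2) by blast
      then have "(1 / norm z)\<^sup>2 * inner (H z) z \<le> \<mu> + \<delta>"
        by (simp add: w_def H.scaleR power2_eq_square)
      then have "inner (H z) z \<le> (\<mu> + \<delta>) * (norm z)\<^sup>2" using z0 by (simp add: field_simps power_divide)
      then show ?thesis by (simp add: B_def inner_diff_left power2_norm_eq_inner)
    qed
    also have "inner (B z) z = inner (B x) x - 2 * t * (norm y)\<^sup>2 + t\<^sup>2 * inner (B y) y"
    proof -
      have B_sym: "inner (B u) v = inner u (B v)" for u v
        by (simp add: B_def inner_diff_left inner_diff_right H(2))
      have "B z = B x - t *\<^sub>R B y"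
        by (simp add: z_def B_def H.diff H.scaleR algebra_simps)
      then have "inner (B z) z = inner (B x - t *\<^sub>R B y) (x - t *\<^sub>R y)" by (simp only: z_def[symmetric])
      then have "inner (B z) z = inner (B x) x - t * inner (B x) y - t * inner (B y) x + t\<^sup>2 * inner (B y) y"
        by (simp add: inner_diff_left inner_diff_right power2_eq_square algebra_simps)
      moreover have "inner (B x) y = (norm y)\<^sup>2" "inner (B y) x = (norm y)\<^sup>2"
        by (simp_all add: B_sym y_def power2_norm_eq_inner)
      ultimately show ?thesis by simp
    qed
    also have "inner (B x) x \<le> 2 * \<delta>"
      using x by (simp add: B_def inner_diff_left power2_norm_eq_inner[symmetric])
    also have "t\<^sup>2 * inner (B y) y \<le> t / 2 * (norm y)\<^sup>2"
    proof -
      have "inner (B y) y \<le> norm (B y) * norm y" by (rule norm_cauchy_schwarz)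
      also have "\<dots> \<le> M * norm y * norm y" using B_norm[of y] by (intro mult_right_mono) auto
      finally have "t\<^sup>2 * inner (B y) y \<le> t\<^sup>2 * (M * (norm y)\<^sup>2)"
        by (intro mult_left_mono) (auto simp: power2_eq_square)
      also have "\<dots> = t * (t * M) * (norm y)\<^sup>2" by (simp add: power2_eq_square)
      finally show ?thesis by (simp add: t)
    qed
    finally have "0 \<le> 2 * \<delta> - 2 * (t * (norm y)\<^sup>2) + t * (norm y)\<^sup>2 / 2" by simp
    moreover have "0 \<le> t * (norm y)\<^sup>2" using t by simp
    ultimately have "t * (norm y)\<^sup>2 \<le> 2 * \<delta>" by linarith
    then have "(norm y)\<^sup>2 \<le> 4 * M * \<delta>" using M by (simp add: t_def field_simps)
    also have "\<dots> \<le> (e / 4)\<^sup>2" using \<delta>(4) M by (simp add: field_simps power2_eq_square)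
    finally have "norm y \<le> e / 4" using e by (simp add: power2_le_iff_abs_le)
    moreover have "H x - \<mu> *\<^sub>R x = \<delta> *\<^sub>R x - y" by (simp add: y_def B_def algebra_simps)
    then have "norm (H x - \<mu> *\<^sub>R x) \<le> \<delta> + norm y"
      using norm_triangle_ineq4[of "\<delta> *\<^sub>R x" y] x(1) \<delta>(1) by simp
    ultimately show ?thesis using x \<delta>(3) by (intro exI[of _ x]) auto
  qed
  then show ?thesis using upper that[of \<mu>] unfolding almost_vanishing_def by blast
qed

text \<open>
Apply the symmetric case to the real part and then, on the approximate eigenvectors so obtained, to
the imaginary part, which commutes with it.
\<close>

lemma approximate_eigenvalue_normal:
  fixes N :: "'a::chilbert_space \<Rightarrow>\<^sub>L 'a"
  assumes N: "complex_linear_op N" "normal_op N"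
    and m: "cseminorm m" "almost_vanishing m"
    and inv: "\<And>x. m (N x) \<le> C * m x" "\<And>x. m (cadjoint N x) \<le> C' * m x"
  obtains z where "almost_vanishing (\<lambda>x. m x + norm (N x - z *\<^sub>C x))"
proof -
  define G where "G = cadjoint N"
  have cl: "N (c *\<^sub>C x) = c *\<^sub>C N x" "G (c *\<^sub>C x) = c *\<^sub>C G x" for c x
    using N(1) complex_linear_cadjoint[OF N(1)] by (auto simp: complex_linear_op_def G_def)
  have comm: "G (N x) = N (G x)" for x
    using N(2) unfolding normal_op_def G_def by (metis blinfun_apply_blinfun_compose)
  have adj: "inner (N x) y = inner x (G y)" for x y by (simp add: G_def inner_cadjoint N(1))
  have adj': "inner (G x) y = inner x (N y)" for x y using adj[of y x] by (simp add: inner_commute)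
  define H1 where "H1 x = (1/2) *\<^sub>C (N x + G x)" for x
  define H2 where "H2 x = (- \<i> / 2) *\<^sub>C (N x - G x)" for x
  have bl: "bounded_linear H1" "bounded_linear H2" unfolding H1_def H2_def
    by (intro bounded_linear_compose[OF bounded_linear_scaleC] bounded_linear_add bounded_linear_sub
        blinfun.bounded_linear_right)+
  have sym1: "inner (H1 x) y = inner x (H1 y)" for x y
    by (simp add: H1_def inner_scaleC_left inner_add_left inner_add_right adj adj' cl scaleC_add_right)
  have sym2: "inner (H2 x) y = inner x (H2 y)" for x y
  proof -
    have swap: "(- \<i> / 2) *\<^sub>C (u - v) = (\<i> / 2) *\<^sub>C (v - u)" for u v :: 'a
      by (metis minus_diff_eq minus_divide_left scaleC_minus_left scaleC_minus_right)
    have "inner (H2 x) y = inner (N x - G x) ((\<i> / 2) *\<^sub>C y)"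
      by (simp add: H2_def inner_scaleC_left)
    also have "\<dots> = inner x ((\<i> / 2) *\<^sub>C (G y - N y))"
      by (simp add: inner_diff_left inner_diff_right adj adj' cl scaleC_diff_right)
    finally show ?thesis by (simp only: H2_def swap)
  qed
  have H12: "H1 (H2 x) = H2 (H1 x)" for x
    by (simp add: H1_def H2_def cl blinfun.add_right blinfun.diff_right scaleC_scaleC comm
        scaleC_diff_right scaleC_add_right mult.commute)
  have H2_cl: "H2 (c *\<^sub>C x) = c *\<^sub>C H2 x" and H1_cl: "H1 (c *\<^sub>C x) = c *\<^sub>C H1 x" for c x
    by (simp_all add: H1_def H2_def cl scaleC_scaleC mult.commute
        flip: scaleC_diff_right scaleC_add_right)
  have split: "N x = H1 x + \<i> *\<^sub>C H2 x" for x
    by (simp add: H1_def H2_def scaleC_scaleC scaleC_add_right scaleC_diff_right flip: scaleC_add_left)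
  have mc: "m (c *\<^sub>C x) = cmod c * m x" for c x using m(1) by (simp add: cseminorm_def)
  have m1: "m (H1 x) \<le> (C + C') * m x" for x
  proof -
    have "m (H1 x) \<le> (1/2) * (m (N x) + m (G x))" using m(1) by (simp add: H1_def mc) (auto simp: cseminorm_def)
    also have "\<dots> \<le> m (N x) + m (G x)" using cseminorm_nonneg[OF m(1)] by simp
    finally show ?thesis using inv[of x] by (simp add: G_def algebra_simps)
  qed
  have m2: "m (H2 x) \<le> (C + C') * m x" for x
  proof -
    have "m (H2 x) \<le> (1/2) * (m (N x) + m (G x))" using cseminorm_diff[OF m(1)] by (simp add: H2_def mc norm_divide)
    also have "\<dots> \<le> m (N x) + m (G x)" using cseminorm_nonneg[OF m(1)] by simp
    finally show ?thesis using inv[of x] by (simp add: G_def algebra_simps)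
  qed
  obtain \<mu> where \<mu>: "almost_vanishing (\<lambda>x. m x + norm (H1 x - \<mu> *\<^sub>R x))"
    by (rule approximate_eigenvalue_symmetric[OF m bl(1) sym1 m1])
  define m' where "m' x = m x + norm (H1 x - \<mu> *\<^sub>R x)" for x
  have m': "cseminorm m'" unfolding m'_def
    using linear_add[OF bounded_linear.linear[OF bl(1)]]
    by (intro cseminorm_add m(1) cseminorm_norm)
      (auto simp: H1_cl scaleC_diff_right scaleC_scaleR_commute algebra_simps)
  obtain K where K: "\<And>x. norm (H2 x) \<le> norm x * K" using bounded_linear.bounded[OF bl(2)] by blast
  have m2': "m' (H2 x) \<le> (\<bar>C + C'\<bar> + \<bar>K\<bar>) * m' x" for x
  proof -
    have "H1 (H2 x) - \<mu> *\<^sub>R H2 x = H2 (H1 x - \<mu> *\<^sub>R x)"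
      using bl(2) by (simp add: H12 linear_diff linear_cmul bounded_linear.linear)
    then have "m' (H2 x) \<le> (C + C') * m x + norm (H1 x - \<mu> *\<^sub>R x) * K"
      using m2[of x] K[of "H1 x - \<mu> *\<^sub>R x"] by (simp add: m'_def)
    also have "\<dots> \<le> (\<bar>C + C'\<bar> + \<bar>K\<bar>) * m x + (\<bar>C + C'\<bar> + \<bar>K\<bar>) * norm (H1 x - \<mu> *\<^sub>R x)"
      using cseminorm_nonneg[OF m(1), of x]
      by (intro add_mono) (auto simp: mult.commute intro!: mult_left_mono mult_right_mono)
    finally show ?thesis by (simp add: m'_def algebra_simps)
  qed
  obtain \<nu> where \<nu>: "almost_vanishing (\<lambda>x. m' x + norm (H2 x - \<nu> *\<^sub>R x))"
    by (rule approximate_eigenvalue_symmetric[OF m' _ bl(2) sym2 m2']) (use \<mu> in \<open>auto simp: m'_def\<close>)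
  have "m x + norm (N x - Complex \<mu> \<nu> *\<^sub>C x) \<le> m' x + norm (H2 x - \<nu> *\<^sub>R x)" for x
  proof -
    have "N x - Complex \<mu> \<nu> *\<^sub>C x = (H1 x - \<mu> *\<^sub>R x) + \<i> *\<^sub>C (H2 x - \<nu> *\<^sub>R x)"
      by (simp add: split Complex_eq scaleC_add_left scaleC_diff_right scaleC_of_real flip: scaleC_scaleC)
    then have "norm (N x - Complex \<mu> \<nu> *\<^sub>C x) \<le> norm (H1 x - \<mu> *\<^sub>R x) + norm (H2 x - \<nu> *\<^sub>R x)"
      using norm_triangle_ineq[of "H1 x - \<mu> *\<^sub>R x" "\<i> *\<^sub>C (H2 x - \<nu> *\<^sub>R x)"] by (simp add: norm_scaleC)
    then show ?thesis by (simp add: m'_def)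
  qed
  then show ?thesis by (intro that[OF almost_vanishing_mono[OF \<nu>]])
qed

text \<open>
With \<open>m x = \<parallel>A x - a x\<parallel> = \<parallel>A\<^sup>* x - cnj a x\<parallel>\<close>, the first expression is respected by \<open>X\<close>, which commutes with \<open>A\<close>,
and the second by \<open>X\<^sup>*\<close>, which commutes with \<open>A\<^sup>*\<close>.
\<close>

lemma joint_approximate_eigenvalue:
  fixes A X :: "'a::chilbert_space \<Rightarrow>\<^sub>L 'a"
  assumes A: "complex_linear_op A" "normal_op A" and X: "complex_linear_op X" "normal_op X"
    and AX: "commuting_ops A X"
    and a: "almost_vanishing (\<lambda>x. norm (A x - a *\<^sub>C x))"
  obtains z where "almost_vanishing (\<lambda>x. norm (A x - a *\<^sub>C x) + norm (X x - z *\<^sub>C x))"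
proof (rule approximate_eigenvalue_normal[OF X _ a])
  let ?G = "cadjoint A" and ?Y = "cadjoint X"
  have cl: "A (c *\<^sub>C x) = c *\<^sub>C A x" "X (c *\<^sub>C x) = c *\<^sub>C X x" "?Y (c *\<^sub>C x) = c *\<^sub>C ?Y x" for c x
    using A X complex_linear_cadjoint[OF X(1)] by (auto simp: complex_linear_op_def)
  have comm: "A (X x) = X (A x)" for x
    using AX unfolding commuting_ops_def by (metis blinfun_apply_blinfun_compose)
  have comm': "?G (?Y x) = ?Y (?G x)" for x
    by (rule inner_eqI) (metis comm inner_cadjoint A(1) X(1))
  show "cseminorm (\<lambda>x. norm (A x - a *\<^sub>C x))"
    by (rule cseminorm_norm)
      (simp_all add: blinfun.add_right cl scaleC_add_right scaleC_diff_right scaleC_scaleC mult.commute)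
  show "norm (A (X x) - a *\<^sub>C X x) \<le> norm X * norm (A x - a *\<^sub>C x)" for x
    using norm_blinfun[of X "A x - a *\<^sub>C x"] by (simp add: comm cl blinfun.diff_right)
  show "norm (A (?Y x) - a *\<^sub>C ?Y x) \<le> norm ?Y * norm (A x - a *\<^sub>C x)" for x
  proof -
    have "norm (A (?Y x) - a *\<^sub>C ?Y x) = norm (?Y (?G x - cnj a *\<^sub>C x))"
      by (simp add: comm' cl blinfun.diff_right flip: normal_shift_norm_eq[OF A])
    then show ?thesis using norm_blinfun[of ?Y "?G x - cnj a *\<^sub>C x"]
      by (simp add: normal_shift_norm_eq[OF A])
  qed
qed

text \<open>
Let \<open>\<mu>\<close> be the top of the numerical range of \<open>\<sigma> N\<^sup>* N\<close>.  It is an approximate eigenvalue, and some \<open>a\<close> makes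
\<open>(\<mu>, a)\<close> a joint approximate eigenvalue of \<open>(\<sigma> N\<^sup>* N, N)\<close>; comparing the two gives
\<open>\<mu> = \<sigma> \<bar>a\<bar>\<^sup>2 = \<sigma>\<close>, hence \<open>\<sigma> \<parallel>N x\<parallel>\<^sup>2 \<le> \<sigma>\<close> for unit vectors.  The cases \<open>\<sigma> = 1\<close> and \<open>\<sigma> = -1\<close> together
make \<open>N\<close> an isometry.
\<close>

lemma unitary_if_approximate_eigenvalues:
  fixes N :: "'a::chilbert_space \<Rightarrow>\<^sub>L 'a"
  assumes N: "complex_linear_op N" "normal_op N"
    and unimod: "\<And>a. almost_vanishing (\<lambda>x. norm (N x - a *\<^sub>C x)) \<Longrightarrow> cmod a = 1"
  shows "unitary_op N"
proof -
  define G where "G = cadjoint N"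
  have cl: "N (c *\<^sub>C x) = c *\<^sub>C N x" "G (c *\<^sub>C x) = c *\<^sub>C G x" for c x
    using N(1) complex_linear_cadjoint[OF N(1)] by (auto simp: complex_linear_op_def G_def)
  have comm: "G (N x) = N (G x)" for x
    using N(2) unfolding normal_op_def G_def by (metis blinfun_apply_blinfun_compose)
  have adj: "inner (N x) y = inner x (G y)" for x y by (simp add: G_def inner_cadjoint N(1))
  have adj': "inner (G x) y = inner x (N y)" for x y using adj[of y x] by (simp add: inner_commute)
  have key: "\<sigma> * (norm (N x))\<^sup>2 \<le> \<sigma>" if x: "norm x = 1" for x and \<sigma> :: real
  proof -
    define H where "H x = \<sigma> *\<^sub>R G (N x)" for x
    have bl: "bounded_linear H" unfolding H_def
      by (intro bounded_linear_intros blinfun.bounded_linear_right[THEN bounded_linear_compose])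
    have sym: "inner (H x) y = inner x (H y)" for x y by (simp add: H_def adj adj')
    have H_add: "H (x + y) = H x + H y" for x y
      by (simp add: H_def blinfun.add_right algebra_simps)
    have zero: "cseminorm (\<lambda>_. 0)" "almost_vanishing (\<lambda>_::'a. 0)"
      using x by (auto simp: cseminorm_def almost_vanishing_def)
    obtain \<mu> where \<mu>: "almost_vanishing (\<lambda>x. 0 + norm (H x - \<mu> *\<^sub>R x))"
      "\<And>\<delta>. \<delta> > 0 \<Longrightarrow> \<exists>\<epsilon>>0::real. \<forall>x. norm x = 1 \<and> 0 \<le> \<epsilon> \<longrightarrow> inner (H x) x \<le> \<mu> + \<delta>"
    proof (rule approximate_eigenvalue_symmetric[OF zero bl sym, where C = 0])
      fix \<mu> assume ev: "almost_vanishing (\<lambda>x. 0 + norm (H x - \<mu> *\<^sub>R x))"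
        "\<And>\<delta>. \<delta> > 0 \<Longrightarrow> \<exists>\<epsilon>>0::real. \<forall>x. norm x = 1 \<and> 0 \<le> \<epsilon> \<longrightarrow> inner (H x) x \<le> \<mu> + \<delta>"
      show thesis by (rule that[OF ev(1)]) (rule ev(2))
    qed simp
    have H_upper: "inner (H x) x \<le> \<mu>"
    proof (rule field_le_epsilon)
      fix e :: real assume "e > 0"
      from \<mu>(2)[OF this] obtain \<epsilon> :: real
        where "\<epsilon> > 0" "\<forall>x. norm x = 1 \<and> 0 \<le> \<epsilon> \<longrightarrow> inner (H x) x \<le> \<mu> + e" by blast
      then show "inner (H x) x \<le> \<mu> + e" using x by simp
    qed
    define m where "m x = norm (H x - \<mu> *\<^sub>R x)" for x
    have m: "cseminorm m" unfolding m_def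
    proof (rule cseminorm_norm)
      show "H (x + y) - \<mu> *\<^sub>R (x + y) = H x - \<mu> *\<^sub>R x + (H y - \<mu> *\<^sub>R y)" for x y
        by (simp add: H_add algebra_simps)
      show "H (c *\<^sub>C x) - \<mu> *\<^sub>R c *\<^sub>C x = c *\<^sub>C (H x - \<mu> *\<^sub>R x)" for c x
        by (simp add: H_def cl scaleC_diff_right scaleC_scaleR_commute)
    qed
    have NH: "H (N x) - \<mu> *\<^sub>R N x = N (H x - \<mu> *\<^sub>R x)"
      and GH: "H (G x) - \<mu> *\<^sub>R G x = G (H x - \<mu> *\<^sub>R x)" for x
      by (simp_all add: H_def comm blinfun.diff_right blinfun.scaleR_right)
    obtain a where a: "almost_vanishing (\<lambda>x. m x + norm (N x - a *\<^sub>C x))"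
    proof (rule approximate_eigenvalue_normal[OF N m])
      show "almost_vanishing m" using \<mu>(1) by (simp add: m_def[abs_def])
      show "m (N x) \<le> norm N * m x" for x unfolding m_def NH by (rule norm_blinfun)
      show "m (cadjoint N x) \<le> norm G * m x" for x unfolding m_def G_def[symmetric] GH by (rule norm_blinfun)
    qed
    have "almost_vanishing (\<lambda>x. norm (N x - a *\<^sub>C x))"
      by (rule almost_vanishing_mono[OF a]) (simp add: m_def)
    then have a1: "cmod a = 1" by (rule unimod)
    have "\<mu> \<le> \<sigma> + \<epsilon>" if \<epsilon>: "\<epsilon> > 0" for \<epsilon>
    proof -
      define \<eta> where "\<eta> = min 1 (\<epsilon> / (1 + 3 * \<bar>\<sigma>\<bar>))"
      have \<eta>: "\<eta> > 0" "\<eta> \<le> 1" "\<eta> * (1 + 3 * \<bar>\<sigma>\<bar>) \<le> \<epsilon>"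
      proof -
        have D: "0 < 1 + 3 * \<bar>\<sigma>\<bar>" by simp
        show "\<eta> > 0" "\<eta> \<le> 1" using \<epsilon> D by (auto simp: \<eta>_def)
        have "\<eta> \<le> \<epsilon> / (1 + 3 * \<bar>\<sigma>\<bar>)" by (simp add: \<eta>_def)
        then show "\<eta> * (1 + 3 * \<bar>\<sigma>\<bar>) \<le> \<epsilon>" using pos_le_divide_eq[OF D] by blast
      qed
      obtain u where u: "norm u = 1" "m u + norm (N u - a *\<^sub>C u) \<le> \<eta>"
        using a \<eta>(1) unfolding almost_vanishing_def by blast
      have n1: "norm (H u - \<mu> *\<^sub>R u) \<le> \<eta>" and n2: "norm (N u - a *\<^sub>C u) \<le> \<eta>"
        using u(2) norm_ge_zero[of "N u - a *\<^sub>C u"] norm_ge_zero[of "H u - \<mu> *\<^sub>R u"]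
        unfolding m_def by linarith+
      have "\<bar>inner (H u - \<mu> *\<^sub>R u) u\<bar> \<le> \<eta>"
        using Cauchy_Schwarz_ineq2[of "H u - \<mu> *\<^sub>R u" u] n1 u(1) by simp
      moreover have "inner (H u - \<mu> *\<^sub>R u) u = \<sigma> * (norm (N u))\<^sup>2 - \<mu>"
      proof -
        have "inner u u = 1" using u(1) by (simp add: norm_eq_1)
        then show ?thesis by (simp add: inner_diff_left H_def adj' power2_norm_eq_inner)
      qed
      moreover have "\<bar>(norm (N u))\<^sup>2 - 1\<bar> \<le> 3 * \<eta>"
      proof -
        have n: "\<bar>norm (N u) - 1\<bar> \<le> \<eta>"
          using norm_triangle_ineq3[of "N u" "a *\<^sub>C u"] n2 u(1) a1 by (simp add: norm_scaleC)
        have "\<bar>(norm (N u))\<^sup>2 - 1\<bar> = \<bar>norm (N u) - 1\<bar> * \<bar>norm (N u) + 1\<bar>"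
        proof -
          have "(norm (N u))\<^sup>2 - 1 = (norm (N u) - 1) * (norm (N u) + 1)"
            by (simp add: power2_eq_square algebra_simps)
          then show ?thesis by (simp only: abs_mult)
        qed
        also have "\<dots> \<le> \<eta> * 3" using n \<eta> by (intro mult_mono) auto
        finally show ?thesis by simp
      qed
      then have "\<bar>\<sigma> * ((norm (N u))\<^sup>2 - 1)\<bar> \<le> \<bar>\<sigma>\<bar> * (3 * \<eta>)"
        by (simp add: abs_mult mult_left_mono)
      ultimately have "\<mu> \<le> \<sigma> + (\<eta> + \<bar>\<sigma>\<bar> * (3 * \<eta>))"
        unfolding right_diff_distrib abs_le_iff by linarith
      then show ?thesis using \<eta>(3) by (simp add: algebra_simps)
    qed
    then have "\<mu> \<le> \<sigma>" by (rule field_le_epsilon)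
    then show ?thesis using H_upper by (simp add: H_def adj' power2_norm_eq_inner)
  qed
  have isometry: "norm (N x) = norm x" for x
  proof (cases "x = 0")
    case False
    define u where "u = (1 / norm x) *\<^sub>R x"
    have "norm u = 1" using False by (simp add: u_def)
    then have "(norm (N u))\<^sup>2 = 1" using key[of u 1] key[of u "-1"] by simp
    then have "norm (N u) = 1"
      using norm_ge_zero[of "N u"] by (auto simp: power2_eq_1_iff)
    then show ?thesis using False by (simp add: u_def blinfun.scaleR_right)
  qed simp
  have "G (N x) = x" for x
  proof (rule inner_eqI)
    fix y
    have "inner (N y) (N x) = inner y x"
      unfolding dot_norm by (simp add: isometry flip: blinfun.add_right)
    then show "inner y (G (N x)) = inner y x" by (simp add: adj)
  qed
  then show ?thesis unfolding unitary_op_def G_def[symmetric]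
    by (intro conjI blinfun_eqI) (simp_all flip: comm)
qed

section \<open>Taylor spectra of commuting operators\<close>

text \<open>
The Banach-Steinhaus theorem for the functionals \<open>inner _ x\<close>, from the Baire category theorem.
\<close>

lemma uniform_boundedness_inner:
  fixes X :: "'a::{real_inner,banach} set"
  assumes "\<And>h. \<exists>M. \<forall>x\<in>X. \<bar>inner h x\<bar> \<le> M"
  shows "\<exists>M. \<forall>x\<in>X. norm x \<le> M"
proof -
  define F where "F k = {h. \<forall>x\<in>X. \<bar>inner h x\<bar> \<le> real k}" for k :: nat
  have closed: "closed (F k)" for k
  proof -
    have "F k = (\<Inter>x\<in>X. {h. \<bar>inner h x\<bar> \<le> real k})" by (auto simp: F_def)
    then show ?thesis by (auto intro!: closed_INT closed_Collect_le continuous_intros)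
  qed
  have cover: "(\<Union>k. F k) = UNIV"
  proof -
    have "\<exists>k. h \<in> F k" for h
    proof -
      obtain M where M: "\<forall>x\<in>X. \<bar>inner h x\<bar> \<le> M" using assms by blast
      obtain k :: nat where k: "M \<le> real k" using real_arch_simple[of M] ..
      have "\<bar>inner h x\<bar> \<le> real k" if "x \<in> X" for x using M k that by force
      then show ?thesis unfolding F_def by blast
    qed
    then show ?thesis by blast
  qed
  have "\<exists>k. interior (F k) \<noteq> {}"
  proof (rule ccontr)
    assume "\<not> ?thesis"
    then have "euclidean interior_of \<Union>(range F) = {}"
    proof (intro Baire_category_alt disjI1 completely_metrizable_space_euclidean)
      show "countable (range F)" by simp
      show "closedin euclidean T \<and> euclidean interior_of T = {}" if "T \<in> range F" for T
        using that closed \<open>\<not> (\<exists>k. interior (F k) \<noteq> {})\<close> by auto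
    qed
    then show False using cover by simp
  qed
  then obtain k h0 where "h0 \<in> interior (F k)" by blast
  then obtain r where r: "r > 0" "cball h0 r \<subseteq> F k" by (meson mem_interior_cball)
  have "norm x \<le> 2 * k / r" if "x \<in> X" for x
  proof (cases "x = 0")
    case False
    define h where "h = h0 + (r / norm x) *\<^sub>R x"
    have "dist h0 h = r" using r(1) False by (simp add: h_def dist_norm)
    then have "h \<in> F k" "h0 \<in> F k" using r by auto
    then have "\<bar>inner h x\<bar> \<le> k" "\<bar>inner h0 x\<bar> \<le> k" using \<open>x \<in> X\<close> by (auto simp: F_def)
    moreover have "inner h x = inner h0 x + r * norm x"
    proof -
      have "inner x x = norm x * norm x" by (simp add: power2_norm_eq_inner flip: power2_eq_square)
      then show ?thesis using False by (simp add: h_def inner_add_left)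
    qed
    ultimately have "norm x * r \<le> 2 * k" by (simp add: abs_le_iff mult.commute)
    then show ?thesis using pos_le_divide_eq[OF r(1)] by blast
  qed (use r in simp)
  then show ?thesis by blast
qed

text \<open>
Exactness in the top degree says that every vector is a sum \<open>\<Sum>\<^sub>j T\<^sub>j (y\<^sub>j)\<close>.  Pairing with \<open>x\<close> shows
that the set of \<open>x\<close> with \<open>\<Sum>\<^sub>j \<parallel>G\<^sub>j x\<parallel> \<le> 1\<close> is weakly bounded, hence bounded.
\<close>

lemma koszul_exact_imp_bounded_below:
  fixes T :: "'n::{finite,linorder} \<Rightarrow> 'a::chilbert_space \<Rightarrow> 'a"
  assumes "commuting_maps T" "koszul_exact T" and adj: "\<And>j. adjoint_pair (T j) (G j)"
  shows "\<exists>c. \<forall>x. norm x \<le> c * (\<Sum>j\<in>UNIV. norm (G j x))"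
proof -
  interpret commuting_maps T by fact
  have onto: "\<exists>y. h = (\<Sum>j\<in>UNIV. T j (y j))" for h
  proof -
    define f where "f = (\<lambda>J::'n set. if J = UNIV then h else 0)"
    have "koszul_diff T f = (\<lambda>J. 0)"
    proof -
      have "f (J - {j}) = 0" if "j \<in> J" for J j using that by (auto simp: f_def)
      then show ?thesis by (simp add: koszul_diff_def linear_0[OF lin])
    qed
    then obtain g where "koszul_diff T g = f" using assms(2) koszul_exact_iff by blast
    then have "h = koszul_diff T g UNIV" by (simp add: f_def)
    also have "\<dots> = (\<Sum>j\<in>UNIV. T j (koszul_sign j UNIV *\<^sub>R g (UNIV - {j})))"
      by (simp add: koszul_diff_sign linear_cmul[OF lin])
    finally show ?thesis by (intro exI[of _ "\<lambda>j. koszul_sign j UNIV *\<^sub>R g (UNIV - {j})"])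
  qed
  define m where "m x = (\<Sum>j\<in>UNIV. norm (G j x))" for x
  have G_scale: "G j (r *\<^sub>R x) = r *\<^sub>R G j x" for j r x
    using adj[of j] by (simp add: adjoint_pair_def linear_cmul bounded_linear.linear)
  have m_scale: "m (r *\<^sub>R x) = \<bar>r\<bar> * m x" for r x
    by (simp add: m_def G_scale sum_distrib_left)
  have "\<exists>M. \<forall>x\<in>{x. m x \<le> 1}. norm x \<le> M"
  proof (rule uniform_boundedness_inner)
    fix h
    obtain y where y: "h = (\<Sum>j\<in>UNIV. T j (y j))" using onto by blast
    have "\<bar>inner h x\<bar> \<le> (\<Sum>j\<in>UNIV. norm (y j))" if "m x \<le> 1" for x
    proof -
      have "inner h x = (\<Sum>j\<in>UNIV. inner (y j) (G j x))"
        using adj by (simp add: y inner_sum_left adjoint_pair_def)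
      also have "\<bar>\<dots>\<bar> \<le> (\<Sum>j\<in>UNIV. norm (y j) * norm (G j x))"
        by (rule order_trans[OF sum_abs]) (intro sum_mono Cauchy_Schwarz_ineq2)
      also have "\<dots> \<le> (\<Sum>j\<in>UNIV. norm (y j) * 1)"
      proof (intro sum_mono mult_left_mono norm_ge_zero)
        fix j :: 'n
        have "norm (G j x) \<le> m x" unfolding m_def by (rule member_le_sum) auto
        then show "norm (G j x) \<le> 1" using that by simp
      qed
      finally show ?thesis by simp
    qed
    then show "\<exists>M. \<forall>x\<in>{x. m x \<le> 1}. \<bar>inner h x\<bar> \<le> M" by blast
  qed
  then obtain M where M: "\<And>x. m x \<le> 1 \<Longrightarrow> norm x \<le> M" by blast
  have m_nonneg: "m x \<ge> 0" for x by (simp add: m_def sum_nonneg)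
  have "norm x \<le> M * m x" for x
  proof (cases "m x = 0")
    case False
    then have "m x > 0" using m_nonneg[of x] by simp
    then have "norm ((1 / m x) *\<^sub>R x) \<le> M" by (intro M) (simp add: m_scale)
    then show ?thesis using \<open>m x > 0\<close> by (simp add: field_simps)
  next
    case True
    have "x = 0"
    proof (rule ccontr)
      assume "x \<noteq> 0"
      have "M \<ge> 0" using M[of 0] m_scale[of 0 0] by simp
      have "norm (((M + 1) / norm x) *\<^sub>R x) \<le> M" by (intro M) (simp add: m_scale True)
      then show False using \<open>x \<noteq> 0\<close> \<open>M \<ge> 0\<close> by simp
    qed
    then show ?thesis using True by simp
  qed
  then show ?thesis unfolding m_def by blast
qed

text \<open>
The equation \<open>N x - a x = y\<close> is a fixed point equation for a contraction: \<open>x = N\<^sup>* (a x + y)\<close> if \<open>\<bar>a\<bar> < 1\<close>,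
and \<open>x = (N x - y) / a\<close> if \<open>\<bar>a\<bar> > 1\<close>.
\<close>

lemma unitary_shift_bij:
  fixes N :: "'a::chilbert_space \<Rightarrow>\<^sub>L 'a"
  assumes N: "complex_linear_op N" "unitary_op N" and a: "cmod a \<noteq> 1"
  shows "bij (\<lambda>x. N x - a *\<^sub>C x)"
proof -
  define G where "G = cadjoint N"
  have GN: "G (N x) = x" and NG: "N (G x) = x" for x
    using N(2) unfolding unitary_op_def G_def by (metis blinfun_apply_blinfun_compose id_blinfun.rep_eq id_apply)+
  have N_iso: "norm (N x) = norm x" for x
  proof -
    have "inner (N x) (N x) = inner x x" by (simp add: inner_cadjoint N(1) flip: G_def) (simp add: GN)
    then show ?thesis by (simp add: norm_eq_sqrt_inner)
  qed
  have G_iso: "norm (G x) = norm x" for x using N_iso[of "G x"] by (simp add: NG)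
  have G_cl: "G (c *\<^sub>C x) = c *\<^sub>C G x" for c x
    using complex_linear_cadjoint[OF N(1)] by (simp add: complex_linear_op_def G_def)
  have "\<exists>!x. N x - a *\<^sub>C x = y" for y
  proof (cases "cmod a < 1")
    case True
    have "\<exists>!x. a *\<^sub>C G x + G y = x"
    proof (rule banach_fix_type[OF _ True])
      have "dist (a *\<^sub>C G u + G y) (a *\<^sub>C G v + G y) = cmod a * dist u v" for u v
        by (simp add: dist_norm norm_scaleC G_iso flip: scaleC_diff_right blinfun.diff_right)
      then show "\<forall>u v. dist (a *\<^sub>C G u + G y) (a *\<^sub>C G v + G y) \<le> cmod a * dist u v" by simp
    qed simp
    moreover have "a *\<^sub>C G x + G y = x \<longleftrightarrow> N x - a *\<^sub>C x = y" for x
    proof -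
      have "a *\<^sub>C G x + G y = x \<longleftrightarrow> G (a *\<^sub>C x + y) = G (N x)" by (simp add: blinfun.add_right G_cl GN)
      also have "\<dots> \<longleftrightarrow> a *\<^sub>C x + y = N x" by (metis NG)
      finally show ?thesis by (auto simp: algebra_simps)
    qed
    ultimately show ?thesis by simp
  next
    case False
    then have a1: "cmod a > 1" using a by simp
    have "\<exists>!x. inverse a *\<^sub>C (N x - y) = x"
    proof (rule banach_fix_type[of "inverse (cmod a)"])
      have "dist (inverse a *\<^sub>C (N u - y)) (inverse a *\<^sub>C (N v - y)) = inverse (cmod a) * dist u v" for u v
        by (simp add: dist_norm norm_scaleC N_iso norm_inverse flip: scaleC_diff_right blinfun.diff_right)
      then show "\<forall>u v. dist (inverse a *\<^sub>C (N u - y)) (inverse a *\<^sub>C (N v - y)) \<le> inverse (cmod a) * dist u v" by simp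
    qed (use a1 in \<open>auto simp: inverse_less_1_iff\<close>)
    moreover have "inverse a *\<^sub>C (N x - y) = x \<longleftrightarrow> N x - a *\<^sub>C x = y" for x
    proof -
      have "a \<noteq> 0" using a1 by auto
      then have "inverse a *\<^sub>C (N x - y) = x \<longleftrightarrow> N x - y = a *\<^sub>C x"
        by (metis right_inverse left_inverse scaleC_one scaleC_scaleC)
      then show ?thesis by (auto simp: algebra_simps)
    qed
    ultimately show ?thesis by simp
  qed
  then show ?thesis unfolding bij_iff by blast
qed

section \<open>A criterion for the distinguished boundary\<close>

definition analytic_disc :: "(complex \<Rightarrow> complex ^ 'n) \<Rightarrow> bool" where
  "analytic_disc g \<longleftrightarrow> continuous_on (cball 0 1) g \<and> (\<forall>i. (\<lambda>z. g z $ i) holomorphic_on ball 0 1)"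

lemma analytic_in_compose_disc:
  assumes f: "analytic_in f \<Omega>" and g: "analytic_disc g" "g ` ball 0 1 \<subseteq> \<Omega>"
  shows "(\<lambda>z. f (g z)) holomorphic_on ball 0 1"
  unfolding holomorphic_on_open[OF open_ball]
proof
  fix z :: complex assume z: "z \<in> ball 0 1"
  have "\<exists>d. ((\<lambda>z. g z $ i) has_field_derivative d) (at z)" for i
    using g(1) z unfolding analytic_disc_def holomorphic_on_open[OF open_ball] by blast
  then obtain d where d: "\<And>i. ((\<lambda>z. g z $ i) has_field_derivative d i) (at z)" by metis
  have bl: "bounded_linear (\<lambda>h. \<chi> i. h * d i)"
    unfolding linear_conv_bounded_linear[symmetric]
    by (rule linearI) (auto simp: vec_eq_iff algebra_simps)
  have dg: "(g has_derivative (\<lambda>h. \<chi> i. h * d i)) (at z)"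
    unfolding has_derivative_at_within has_derivative_def
  proof (intro conjI bl vec_tendstoI)
    fix i
    have "((\<lambda>z. g z $ i) has_derivative (\<lambda>h. h * d i)) (at z)"
    proof -
      have "(\<lambda>h. h * d i) = (*) (d i)" by (auto simp: mult.commute)
      then show ?thesis using d[of i] by (simp add: has_field_derivative_def)
    qed
    then show "((\<lambda>y. ((g y - g (Lim (at z) (\<lambda>x. x)) - (\<chi> i. (y - Lim (at z) (\<lambda>x. x)) * d i)) /\<^sub>R
              norm (y - Lim (at z) (\<lambda>x. x))) $ i) \<longlongrightarrow> 0 $ i) (at z)"
      by (simp add: has_derivative_def)
  qed
  obtain D where D: "(f has_derivative D) (at (g z))" "\<And>c v. D (c *s v) = c * D v"
    using f g(2) z unfolding analytic_in_def by blast
  have "((\<lambda>z. f (g z)) has_derivative (\<lambda>h. D (\<chi> i. h * d i))) (at z)"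
    using has_derivative_compose[OF dg D(1)] .
  moreover have "D (\<chi> i. h * d i) = D (\<chi> i. d i) * h" for h
    using D(2)[of h "\<chi> i. d i"] by (simp add: vector_scalar_mult_def mult.commute)
  ultimately show "\<exists>f'. ((\<lambda>z. f (g z)) has_field_derivative f') (at z)"
    unfolding has_field_derivative_def by auto
qed

text \<open>
The discs make \<open>K\<close> a set on which maxima are attained, by the maximum principle in one variable.  For
the minimality of \<open>K\<close>, the weighted inner product with \<open>k \<in> K\<close>, plus the constant \<open>R\<close>, is an affine
function whose modulus on the ellipsoid \<open>\<Sum>\<^sub>i c\<^sub>i \<bar>z\<^sub>i\<bar>\<^sup>2 \<le> R\<close> is at most \<open>2 R\<close>, with equality only at \<open>k\<close>.
\<close>

theorem distinguished_boundary_eqI: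
  fixes \<Omega> K :: "(complex ^ 'n) set" and c :: "'n \<Rightarrow> real"
  assumes K: "closed K" "K \<noteq> {}" "K \<subseteq> closure \<Omega>"
    and c: "\<And>i. c i > 0" and R: "R > 0"
    and le: "\<And>z. z \<in> \<Omega> \<Longrightarrow> (\<Sum>i\<in>UNIV. c i * (cmod (z $ i))\<^sup>2) \<le> R"
    and eq: "\<And>z. z \<in> K \<Longrightarrow> (\<Sum>i\<in>UNIV. c i * (cmod (z $ i))\<^sup>2) = R"
    and disc: "\<And>w. w \<in> \<Omega> \<Longrightarrow> \<exists>g. analytic_disc g \<and> g ` ball 0 1 \<subseteq> \<Omega> \<and> g ` sphere 0 1 \<subseteq> K \<and> g 0 = w"
  shows "distinguished_boundary \<Omega> = K"
proof -
  let ?q = "\<lambda>z. \<Sum>i\<in>UNIV. c i * (cmod (z $ i))\<^sup>2"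
  have closure_le: "?q z \<le> R" if "z \<in> closure \<Omega>" for z
  proof -
    have "closed {z. ?q z \<le> R}" by (intro closed_Collect_le continuous_intros)
    moreover have "\<Omega> \<subseteq> {z. ?q z \<le> R}" using le by blast
    ultimately show ?thesis using that closure_minimal by blast
  qed
  have "bounded K" unfolding bounded_iff
  proof (intro exI ballI)
    fix z assume z: "z \<in> K"
    have "cmod (z $ i) \<le> sqrt (R / c i)" for i
    proof -
      have "c i * (cmod (z $ i))\<^sup>2 \<le> R"
        unfolding eq[OF z, symmetric] by (rule member_le_sum) (auto intro: mult_nonneg_nonneg less_imp_le[OF c])
      then show ?thesis using c[of i] by (intro real_le_rsqrt) (simp add: field_simps)
    qed
    then have "(\<Sum>i\<in>UNIV. norm (z $ i)) \<le> (\<Sum>i\<in>UNIV. sqrt (R / c i))" by (intro sum_mono)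
    moreover have "norm z \<le> (\<Sum>i\<in>UNIV. norm (z $ i))"
      unfolding norm_vec_def by (rule L2_set_le_sum) simp
    ultimately show "norm z \<le> (\<Sum>i\<in>UNIV. sqrt (R / c i))" by linarith
  qed
  then have "compact K" using K(1) by (simp add: compact_eq_bounded_closed)
  have "max_modulus_set \<Omega> K" unfolding max_modulus_set_def
  proof (intro conjI allI impI K)
    fix f assume f: "continuous_on (closure \<Omega>) f \<and> analytic_in f \<Omega>"
    have "continuous_on K (\<lambda>z. cmod (f z))"
      by (intro continuous_on_norm continuous_on_subset[OF conjunct1[OF f] K(3)])
    then obtain k where k: "k \<in> K" "\<And>z. z \<in> K \<Longrightarrow> cmod (f z) \<le> cmod (f k)"
      using continuous_attains_sup[OF \<open>compact K\<close> K(2)] by blast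
    have "cmod (f w) \<le> cmod (f k)" if w: "w \<in> \<Omega>" for w
    proof -
      obtain g where g: "analytic_disc g" "g ` ball 0 1 \<subseteq> \<Omega>" "g ` sphere 0 1 \<subseteq> K" "g 0 = w"
        using disc[OF w] by blast
      have sub: "g ` cball 0 1 \<subseteq> closure \<Omega>"
      proof -
        have "g ` cball 0 1 = g ` (ball 0 1 \<union> sphere 0 1)"
          by (intro arg_cong[where f = "image g"]) auto
        then show ?thesis using g(2,3) K(3) closure_subset[of \<Omega>] by auto
      qed
      have "cmod (f (g 0)) \<le> cmod (f k)"
      proof (rule maximum_modulus_frontier[where f = "\<lambda>z. f (g z)" and S = "ball 0 1"])
        show "(\<lambda>z. f (g z)) holomorphic_on interior (ball 0 1)"
          using analytic_in_compose_disc[OF conjunct2[OF f] g(1,2)] by (simp add: interior_open)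
        show "continuous_on (closure (ball 0 1)) (\<lambda>z. f (g z))"
          using continuous_on_compose2[OF conjunct1[OF f] _ sub] g(1) by (simp add: analytic_disc_def)
        show "cmod (f (g z)) \<le> cmod (f k)" if "z \<in> frontier (ball 0 1)" for z
          using that g(3) by (intro k(2)) (simp add: image_subset_iff)
      qed auto
      then show ?thesis using g(4) by simp
    qed
    then show "\<exists>z\<in>K. \<forall>w\<in>closure \<Omega>. cmod (f w) \<le> cmod (f z)"
      using continuous_on_closure_norm_le[OF conjunct1[OF f]] by (intro bexI[OF _ k(1)]) auto
  qed
  moreover have "K \<subseteq> B" if B: "max_modulus_set \<Omega> B" for B
  proof
    fix k assume k: "k \<in> K"
    let ?S = "\<lambda>z. \<Sum>i\<in>UNIV. of_real (c i) * cnj (k $ i) * z $ i"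
    let ?f = "\<lambda>z. of_real R + ?S z"
    have "cnj x * x = of_real ((cmod x)\<^sup>2)" for x by (metis complex_norm_square mult.commute)
    then have Sk: "?S k = of_real R"
      unfolding eq[OF k, symmetric] of_real_sum by (intro sum.cong refl) (simp only: mult.assoc of_real_mult)
    have "analytic_in ?f \<Omega>" unfolding analytic_in_def
    proof
      fix z
      have "(?f has_derivative ?S) (at z)"
        by (auto intro!: derivative_eq_intros bounded_linear_imp_has_derivative bounded_linear_vec_nth)
      moreover have "?S (a *s v) = a * ?S v" for a v
        unfolding sum_distrib_left by (intro sum.cong refl) (simp add: mult.left_commute)
      ultimately show "\<exists>D. (?f has_derivative D) (at z) \<and> (\<forall>a v. D (a *s v) = a * D v)" by blast
    qed
    moreover have "continuous_on (closure \<Omega>) ?f" by (intro continuous_intros)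
    ultimately have "\<exists>z\<in>B. \<forall>w\<in>closure \<Omega>. cmod (?f w) \<le> cmod (?f z)"
      using B[unfolded max_modulus_set_def, THEN conjunct2, THEN conjunct2, rule_format, of ?f] by blast
    then obtain z where z: "z \<in> B" "\<And>w. w \<in> closure \<Omega> \<Longrightarrow> cmod (?f w) \<le> cmod (?f z)" by blast
    have z_le: "?q z \<le> R" using z(1) B closure_le unfolding max_modulus_set_def by blast
    have "2 * R \<le> cmod (?f z)"
      using z(2)[of k] k K(3) R unfolding Sk by (auto simp flip: of_real_add)
    have "cmod (?S z) \<le> (\<Sum>i\<in>UNIV. c i * ((cmod (k $ i))\<^sup>2 + (cmod (z $ i))\<^sup>2) / 2)"
    proof (intro sum_norm_le)
      fix i
      have "cmod (k $ i) * cmod (z $ i) \<le> ((cmod (k $ i))\<^sup>2 + (cmod (z $ i))\<^sup>2) / 2"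
        using sum_squares_bound[of "cmod (k $ i)" "cmod (z $ i)"] by simp
      then show "cmod (of_real (c i) * cnj (k $ i) * z $ i) \<le> c i * ((cmod (k $ i))\<^sup>2 + (cmod (z $ i))\<^sup>2) / 2"
        using c[of i] by (simp add: norm_mult)
    qed
    also have "\<dots> = (?q k + ?q z) / 2"
      by (simp add: sum_divide_distrib[symmetric] sum.distrib distrib_left)
    also have "\<dots> \<le> R" using eq[OF k] z_le by simp
    finally have S_le: "cmod (?S z) \<le> R" .
    have "R \<le> Re (?S z)"
    proof -
      have "(2 * R)\<^sup>2 \<le> (cmod (?f z))\<^sup>2" using \<open>2 * R \<le> cmod (?f z)\<close> R by (intro power_mono) auto
      also have "\<dots> = R\<^sup>2 + 2 * R * Re (?S z) + (cmod (?S z))\<^sup>2"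
        by (simp add: cmod_power2 power2_sum)
      also have "(cmod (?S z))\<^sup>2 \<le> R\<^sup>2" using S_le by (intro power_mono) auto
      finally have "R * R \<le> R * Re (?S z)" by (simp add: power2_eq_square)
      then show ?thesis using R by simp
    qed
    have "(\<Sum>i\<in>UNIV. c i * (cmod (z $ i - k $ i))\<^sup>2) = ?q z + ?q k - 2 * Re (?S z)"
    proof -
      have "c i * (cmod (z $ i - k $ i))\<^sup>2 = c i * (cmod (z $ i))\<^sup>2 + c i * (cmod (k $ i))\<^sup>2
          - 2 * Re (of_real (c i) * cnj (k $ i) * z $ i)" for i
        by (simp add: cmod_power2 power2_diff algebra_simps)
      then show ?thesis by (simp add: sum.distrib sum_subtractf sum_distrib_left)
    qed
    also have "\<dots> \<le> 0" using z_le eq[OF k] \<open>R \<le> Re (?S z)\<close> by linarith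
    finally have "(\<Sum>i\<in>UNIV. c i * (cmod (z $ i - k $ i))\<^sup>2) \<le> 0" .
    moreover have "0 \<le> c i * (cmod (z $ i - k $ i))\<^sup>2" for i using less_imp_le[OF c] by simp
    ultimately have "\<forall>i\<in>UNIV. c i * (cmod (z $ i - k $ i))\<^sup>2 = 0"
      by (intro sum_nonneg_eq_0_iff[THEN iffD1]) (auto intro!: antisym sum_nonneg)
    then have "z $ i = k $ i" for i using less_imp_neq[OF c[of i]] by (auto dest: bspec[of _ _ i])
    then have "z = k" by (simp add: vec_eq_iff)
    then show "k \<in> B" using z(1) by simp
  qed
  ultimately show ?thesis unfolding distinguished_boundary_def by (intro Least_equality) auto
qed

section \<open>Affine coordinates on the hexablock\<close>

definition tetra_cond :: "complex \<Rightarrow> complex \<Rightarrow> complex \<Rightarrow> bool" where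
  "tetra_cond x1 x2 x3 \<longleftrightarrow>
     (\<forall>z1 z2. cmod z1 \<le> 1 \<and> cmod z2 \<le> 1 \<longrightarrow> 1 - x1 * z1 - x2 * z2 + x3 * z1 * z2 \<noteq> 0)"

lemma tetrablock_vector: "vector [x1, x2, x3] \<in> tetrablock \<longleftrightarrow> tetra_cond x1 x2 x3"
  by (simp add: tetrablock_def tetra_cond_def)

lemma tetra_cond_swap: "tetra_cond x1 x2 x3 \<Longrightarrow> tetra_cond x2 x1 x3"
  unfolding tetra_cond_def
proof (intro allI impI)
  fix z1 z2
  assume "\<forall>z1 z2. cmod z1 \<le> 1 \<and> cmod z2 \<le> 1 \<longrightarrow> 1 - x1 * z1 - x2 * z2 + x3 * z1 * z2 \<noteq> 0"
    and "cmod z1 \<le> 1 \<and> cmod z2 \<le> 1"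
  then have "1 - x1 * z2 - x2 * z1 + x3 * z2 * z1 \<noteq> 0" by blast
  then show "1 - x2 * z1 - x1 * z2 + x3 * z1 * z2 \<noteq> 0" by (simp add: algebra_simps)
qed

lemma numerator_gap:
  "(cmod (1 - x2 * z))\<^sup>2 - (cmod (x1 - x3 * z))\<^sup>2
    = (1 - (cmod x1)\<^sup>2) + ((cmod x2)\<^sup>2 - (cmod x3)\<^sup>2) * (cmod z)\<^sup>2 - 2 * Re (z * (x2 - cnj x1 * x3))"
  unfolding cmod_power2 by (simp add: power2_eq_square algebra_simps)

text \<open>
For fixed \<open>z2\<close> the denominator \<open>(1 - x2 z2) - z1 (x1 - x3 z2)\<close> has no zero \<open>z1\<close> in the closed disc, so
\<open>\<bar>x1 - x3 z2\<bar> < \<bar>1 - x2 z2\<bar>\<close>.  Choosing the argument of the unimodular \<open>z2\<close> optimally gives the bound.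
\<close>

lemma tetra_cond_bound:
  assumes "tetra_cond x1 x2 x3"
  shows "2 * cmod (x2 - cnj x1 * x3) < 1 + (cmod x2)\<^sup>2 - (cmod x1)\<^sup>2 - (cmod x3)\<^sup>2"
proof -
  define \<kappa> where "\<kappa> = x2 - cnj x1 * x3"
  define z where "z = (if \<kappa> = 0 then 1 else cnj \<kappa> / of_real (cmod \<kappa>))"
  have z: "cmod z = 1" by (simp add: z_def norm_divide)
  have z\<kappa>: "z * \<kappa> = of_real (cmod \<kappa>)"
  proof (cases "\<kappa> = 0")
    case False
    then have "z * \<kappa> = of_real ((cmod \<kappa>)\<^sup>2) / of_real (cmod \<kappa>)"
      by (simp add: z_def mult.commute flip: complex_norm_square del: of_real_power)
    then show ?thesis using False by (simp add: power2_eq_square)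
  qed simp
  have "cmod (x1 - x3 * z) < cmod (1 - x2 * z)"
  proof (rule ccontr)
    assume c: "\<not> ?thesis"
    show False
    proof (cases "x1 - x3 * z = 0")
      case True
      then have "1 - x2 * z = 0" using c by simp
      then show False using assms[unfolded tetra_cond_def, rule_format, of 0 z] z by simp
    next
      case False
      define w where "w = (1 - x2 * z) / (x1 - x3 * z)"
      have "cmod w \<le> 1" using c False by (simp add: w_def norm_divide divide_le_eq)
      moreover have "w * (x1 - x3 * z) = 1 - x2 * z" using False by (simp add: w_def)
      then have "1 - x1 * w - x2 * z + x3 * w * z = 0" by (simp add: algebra_simps)
      ultimately show False using assms[unfolded tetra_cond_def, rule_format, of w z] z by simp
    qed
  qed
  then have "(cmod (x1 - x3 * z))\<^sup>2 < (cmod (1 - x2 * z))\<^sup>2" by (intro power_strict_mono) auto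
  moreover have "Re (z * \<kappa>) = cmod \<kappa>" by (simp only: z\<kappa> Re_complex_of_real)
  ultimately show ?thesis
    using numerator_gap[of x2 z x1 x3, folded \<kappa>_def] unfolding \<kappa>_def[symmetric] z by simp
qed

text \<open>
The cross term and the norm condition say that \<open>\<bar>u + v x\<bar>\<^sup>2 + \<bar>b1 + cnj b2 x\<bar>\<^sup>2 = 1\<close> for \<open>\<bar>x\<bar> = 1\<close>; the
condition \<open>\<bar>v\<bar> < u\<close> selects the solution for which \<open>u + v x\<close> has no zero in the closed disc.
\<close>

definition hexa_param :: "complex \<Rightarrow> complex \<Rightarrow> real \<Rightarrow> complex \<Rightarrow> bool" where
  "hexa_param b1 b2 u v \<longleftrightarrow> 0 < u \<and> cmod v < u \<and> of_real u * cnj v = - (b1 * b2) \<and>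
     u\<^sup>2 + (cmod v)\<^sup>2 = 1 - (cmod b1)\<^sup>2 - (cmod b2)\<^sup>2"

text \<open>
For fixed \<open>b1\<close> and \<open>b2\<close> the last three coordinates describe a disc in the tetrablock that is affine in
\<open>x3\<close>; the first coordinate is the fraction \<open>y\<close> of its largest possible value.
\<close>

definition hexa_point :: "complex \<Rightarrow> complex \<Rightarrow> real \<Rightarrow> complex \<Rightarrow> complex \<Rightarrow> complex \<Rightarrow> complex ^ 4" where
  "hexa_point b1 b2 u v y x3 = vector [y * (of_real u + v * x3), b1 + cnj b2 * x3, b2 + cnj b1 * x3, x3]"

lemma vector_4 [simp]:
  "(vector [a, b, c, d] :: 'a::zero ^ 4) $ 1 = a" "(vector [a, b, c, d] :: 'a::zero ^ 4) $ 2 = b"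
  "(vector [a, b, c, d] :: 'a::zero ^ 4) $ 3 = c" "(vector [a, b, c, d] :: 'a::zero ^ 4) $ 4 = d"
  unfolding vector_def by simp_all

lemma hexa_point_nth [simp]:
  "hexa_point b1 b2 u v y x3 $ 1 = y * (of_real u + v * x3)"
  "hexa_point b1 b2 u v y x3 $ 2 = b1 + cnj b2 * x3"
  "hexa_point b1 b2 u v y x3 $ 3 = b2 + cnj b1 * x3"
  "hexa_point b1 b2 u v y x3 $ 4 = x3"
  by (simp_all add: hexa_point_def)

text \<open>
With \<open>t = u\<^sup>2\<close> the conditions become \<open>t + \<bar>b1 b2\<bar>\<^sup>2 / t = m\<close> for \<open>m = 1 - \<bar>b1\<bar>\<^sup>2 - \<bar>b2\<bar>\<^sup>2\<close>, whose discriminant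
factors as \<open>(1 - (\<bar>b1\<bar> + \<bar>b2\<bar>)\<^sup>2) (1 - (\<bar>b1\<bar> - \<bar>b2\<bar>)\<^sup>2) > 0\<close>; the larger root gives \<open>\<bar>v\<bar> < u\<close>.
\<close>

lemma hexa_param_exists:
  assumes "cmod b1 + cmod b2 < 1"
  obtains u v where "hexa_param b1 b2 u v"
proof -
  define p q where "p = cmod b1" and "q = cmod b2"
  have pq: "p \<ge> 0" "q \<ge> 0" "p + q < 1" using assms by (auto simp: p_def q_def)
  define m where "m = 1 - p\<^sup>2 - q\<^sup>2"
  define D where "D = m\<^sup>2 - 4 * (p * q)\<^sup>2"
  have "(p + q)\<^sup>2 < 1" using pq by (simp add: abs_square_less_1)
  moreover have "(p - q)\<^sup>2 \<le> (p + q)\<^sup>2" using pq by (simp add: power2_eq_square algebra_simps)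
  ultimately have D: "D > 0" and m: "m > 2 * (p * q)"
  proof -
    have "D = (1 - (p + q)\<^sup>2) * (1 - (p - q)\<^sup>2)"
      by (simp add: D_def m_def power2_eq_square algebra_simps)
    then show "D > 0" using \<open>(p + q)\<^sup>2 < 1\<close> \<open>(p - q)\<^sup>2 \<le> (p + q)\<^sup>2\<close> by simp
    show "m > 2 * (p * q)" using \<open>(p + q)\<^sup>2 < 1\<close> by (simp add: m_def power2_eq_square algebra_simps)
  qed
  define t where "t = (m + sqrt D) / 2"
  have m0: "m > 0" using m pq by (smt (verit) mult_nonneg_nonneg)
  have "2 * t = m + sqrt D" by (simp add: t_def)
  then have t: "t > p * q" using m real_sqrt_gt_zero[OF D] by linarith
  then have t0: "t > 0" using pq by (smt (verit) mult_nonneg_nonneg)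
  have quad: "t * t + (p * q)\<^sup>2 = m * t"
  proof -
    have "4 * (t * t) = m\<^sup>2 + D + 2 * m * sqrt D"
      using D by (simp add: t_def power2_eq_square algebra_simps)
    also have "\<dots> = 4 * (m * t) - 4 * (p * q)\<^sup>2"
      by (simp add: D_def t_def power2_eq_square algebra_simps)
    finally show ?thesis by simp
  qed
  define u where "u = sqrt t"
  define v where "v = - cnj (b1 * b2) / of_real u"
  have u: "u > 0" "u * u = t" using t0 by (auto simp: u_def)
  have cv: "cmod v = p * q / u" using u by (simp add: v_def norm_divide norm_mult p_def q_def)
  have "cmod v < u" unfolding cv using t u by (simp add: pos_divide_less_eq)
  moreover have "of_real u * cnj v = - (b1 * b2)" using u(1) by (simp add: v_def)
  moreover have "u\<^sup>2 + (cmod v)\<^sup>2 = 1 - (cmod b1)\<^sup>2 - (cmod b2)\<^sup>2"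
  proof -
    have "u\<^sup>2 = t" using u by (simp add: power2_eq_square)
    then have "u\<^sup>2 + (cmod v)\<^sup>2 = t + (p * q)\<^sup>2 / t" unfolding cv by (simp add: power_divide)
    also have "\<dots> = (t * t + (p * q)\<^sup>2) / t" using t0 by (simp add: add_divide_distrib)
    also have "\<dots> = m" unfolding quad using t0 by simp
    finally show ?thesis by (simp add: m_def p_def q_def)
  qed
  ultimately show ?thesis using that u(1) unfolding hexa_param_def by blast
qed

context
  fixes b1 b2 v :: complex and u :: real
  assumes par: "hexa_param b1 b2 u v"
begin

lemma hexa_param_pos: "0 < u" "cmod v < u" using par by (auto simp: hexa_param_def)

lemma hexa_param_cross: "of_real u * cnj v = - (b1 * b2)" "of_real u * v = - (cnj b1 * cnj b2)"
proof -
  show *: "of_real u * cnj v = - (b1 * b2)" using par by (simp add: hexa_param_def)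
  show "of_real u * v = - (cnj b1 * cnj b2)" using arg_cong[OF *, of cnj] by simp
qed

lemma hexa_param_norm: "u\<^sup>2 + (cmod v)\<^sup>2 + (cmod b1)\<^sup>2 + (cmod b2)\<^sup>2 = 1"
  using par by (simp add: hexa_param_def)

lemma hexa_param_norm_complex:
  "of_real u * of_real u + v * cnj v + b1 * cnj b1 + b2 * cnj b2 = 1"
proof -
  have "complex_of_real (u\<^sup>2 + (cmod v)\<^sup>2 + (cmod b1)\<^sup>2 + (cmod b2)\<^sup>2) = 1"
    by (simp only: hexa_param_norm of_real_1)
  then show ?thesis unfolding of_real_add complex_norm_square power2_eq_square[of u] of_real_mult .
qed

lemma hexa_param_prod: "((cmod b1)\<^sup>2 + u\<^sup>2) * ((cmod b2)\<^sup>2 + u\<^sup>2) = u\<^sup>2"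
  "((cmod b2)\<^sup>2 + (cmod v)\<^sup>2) * ((cmod b2)\<^sup>2 + u\<^sup>2) = (cmod b2)\<^sup>2"
proof -
  have "u * cmod v = cmod b1 * cmod b2"
    using arg_cong[OF hexa_param_cross(1), of cmod] hexa_param_pos by (simp add: norm_mult)
  then have e: "u\<^sup>2 * (cmod v)\<^sup>2 = (cmod b1)\<^sup>2 * (cmod b2)\<^sup>2" by (metis power_mult_distrib)
  define U V P Q where "U = u\<^sup>2" and "V = (cmod v)\<^sup>2" and "P = (cmod b1)\<^sup>2" and "Q = (cmod b2)\<^sup>2"
  have n: "P = 1 - U - V - Q" using hexa_param_norm by (simp add: U_def V_def P_def Q_def)
  have e': "U * V = P * Q" using e by (simp add: U_def V_def P_def Q_def)
  have "(P + U) * (Q + U) = U * (P + Q + U + V)" using e' by (simp add: algebra_simps)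
  also have "\<dots> = U" by (simp add: n)
  finally show "((cmod b1)\<^sup>2 + u\<^sup>2) * ((cmod b2)\<^sup>2 + u\<^sup>2) = u\<^sup>2" by (simp add: U_def P_def Q_def)
  have "(Q + V) * (Q + U) = Q * (P + Q + U + V)" using e' by (simp add: algebra_simps)
  also have "\<dots> = Q" by (simp add: n)
  finally show "((cmod b2)\<^sup>2 + (cmod v)\<^sup>2) * ((cmod b2)\<^sup>2 + u\<^sup>2) = (cmod b2)\<^sup>2"
    by (simp add: U_def V_def Q_def)
qed

text \<open>
The three coefficients in \<open>numerator_gap\<close>, expressed in the coordinates.
\<close>

lemma hexa_identity:
  fixes x3 :: complex
  defines "a0 \<equiv> of_real u + v * x3" and "x1 \<equiv> b1 + cnj b2 * x3" and "x2 \<equiv> b2 + cnj b1 * x3"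
  shows "1 - (cmod x1)\<^sup>2 = (cmod a0)\<^sup>2 + (1 - (cmod x3)\<^sup>2) * ((cmod b2)\<^sup>2 + (cmod v)\<^sup>2)" (is ?A)
    and "(cmod x2)\<^sup>2 - (cmod x3)\<^sup>2 = - (cmod a0)\<^sup>2 + (1 - (cmod x3)\<^sup>2) * ((cmod b2)\<^sup>2 + u\<^sup>2)" (is ?B)
    and "x2 - cnj x1 * x3 = of_real (1 - (cmod x3)\<^sup>2) * b2" (is ?C)
proof -
  let ?U = "complex_of_real u"
  have "complex_of_real (1 - (cmod x1)\<^sup>2) = complex_of_real ((cmod a0)\<^sup>2 + (1 - (cmod x3)\<^sup>2) * ((cmod b2)\<^sup>2 + (cmod v)\<^sup>2))"
    using hexa_param_cross hexa_param_norm_complex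
    unfolding a0_def x1_def of_real_add of_real_mult of_real_diff of_real_1 complex_norm_square
      complex_cnj_add complex_cnj_mult complex_cnj_cnj complex_cnj_complex_of_real
    by algebra
  then show ?A unfolding of_real_eq_iff .
  have "complex_of_real ((cmod x2)\<^sup>2 - (cmod x3)\<^sup>2) = complex_of_real (- (cmod a0)\<^sup>2 + (1 - (cmod x3)\<^sup>2) * ((cmod b2)\<^sup>2 + u\<^sup>2))"
    using hexa_param_cross hexa_param_norm_complex
    unfolding a0_def x2_def of_real_add of_real_mult of_real_diff of_real_1 of_real_minus complex_norm_square
      power2_eq_square[of u] complex_cnj_add complex_cnj_mult complex_cnj_cnj complex_cnj_complex_of_real
    by algebra
  then show ?B unfolding of_real_eq_iff .
  show ?C unfolding x1_def x2_def of_real_diff complex_norm_square by (simp add: algebra_simps)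
qed

end

lemma aczel_inequality:
  fixes p q t :: real
  shows "(p\<^sup>2 - q\<^sup>2) * (1 - t\<^sup>2) \<le> (p - t * q)\<^sup>2"
proof -
  have "0 \<le> (t * p - q)\<^sup>2" by simp
  then show ?thesis by (simp add: power2_eq_square algebra_simps)
qed

text \<open>
With \<open>a0 = u + v x3\<close> the gap is \<open>\<bar>a0\<bar>\<^sup>2 (1 - r\<^sup>2) + (1 - \<bar>x3\<bar>\<^sup>2) (g + h r\<^sup>2 - 2 Re (z b2))\<close> with \<open>r = \<bar>z\<bar>\<close> and
\<open>g h = \<bar>b2\<bar>\<^sup>2\<close>.  The last factor is at least \<open>(\<surd>g - \<surd>h r)\<^sup>2\<close>, and it is positive for \<open>r = 1\<close>, as
\<open>g < h\<close>.
\<close>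

lemma hexa_gap:
  fixes b1 b2 v x3 z :: complex and u :: real
  assumes par: "hexa_param b1 b2 u v" and x3: "cmod x3 < 1" and z: "cmod z \<le> 1"
  defines "a0 \<equiv> of_real u + v * x3" and "x1 \<equiv> b1 + cnj b2 * x3" and "x2 \<equiv> b2 + cnj b1 * x3"
  shows "(cmod a0)\<^sup>2 * (1 - (cmod z)\<^sup>2) \<le> (cmod (1 - x2 * z))\<^sup>2 - (cmod (x1 - x3 * z))\<^sup>2"
    and "cmod (x1 - x3 * z) < cmod (1 - x2 * z)"
    and "0 < cmod a0"
proof -
  define g h r where "g = (cmod b2)\<^sup>2 + (cmod v)\<^sup>2" and "h = (cmod b2)\<^sup>2 + u\<^sup>2" and "r = cmod z"
  define E where "E = 1 - (cmod x3)\<^sup>2"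
  have E: "E > 0" using x3 by (simp add: E_def abs_square_less_1)
  have r: "0 \<le> r" "r \<le> 1" using z by (auto simp: r_def)
  have u: "0 < u" "cmod v < u" using hexa_param_pos[OF par] .
  have "(cmod v)\<^sup>2 < u\<^sup>2" using u by (intro power_strict_mono) auto
  then have gh: "g < h" "0 \<le> g" by (auto simp: g_def h_def)
  have gh_prod: "g * h = (cmod b2)\<^sup>2" unfolding g_def h_def by (rule hexa_param_prod(2)[OF par])
  show a0: "0 < cmod a0"
  proof -
    have "cmod (v * x3) \<le> cmod v" using x3 by (simp add: norm_mult mult_left_le)
    also have "\<dots> < cmod (of_real u)" using u by simp
    finally have "of_real u + v * x3 \<noteq> 0" by (metis add_eq_0_iff2 less_irrefl norm_minus_cancel)
    then show ?thesis by (simp add: a0_def)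
  qed
  have gap: "(cmod (1 - x2 * z))\<^sup>2 - (cmod (x1 - x3 * z))\<^sup>2
      = (cmod a0)\<^sup>2 * (1 - r\<^sup>2) + E * (g + h * r\<^sup>2 - 2 * Re (z * b2))"
  proof -
    have "Re (z * (x2 - cnj x1 * x3)) = E * Re (z * b2)"
      unfolding x1_def x2_def hexa_identity(3)[OF par] E_def[symmetric] by (simp add: algebra_simps)
    moreover have "1 - (cmod x1)\<^sup>2 = (cmod a0)\<^sup>2 + E * g"
      and "(cmod x2)\<^sup>2 - (cmod x3)\<^sup>2 = - (cmod a0)\<^sup>2 + E * h"
      unfolding a0_def x1_def x2_def g_def h_def E_def by (rule hexa_identity[OF par])+
    ultimately show ?thesis unfolding numerator_gap r_def by algebra
  qed
  have Re_le: "Re (z * b2) \<le> r * cmod b2"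
    using complex_Re_le_cmod[of "z * b2"] by (simp add: norm_mult r_def)
  have sq: "(2 * (r * cmod b2))\<^sup>2 = 4 * g * h * r\<^sup>2"
    by (simp add: power_mult_distrib gh_prod[symmetric])
  have amgm: "2 * (r * cmod b2) \<le> g + h * r\<^sup>2"
  proof (rule power2_le_imp_le)
    have "0 \<le> (g - h * r\<^sup>2)\<^sup>2" by simp
    then show "(2 * (r * cmod b2))\<^sup>2 \<le> (g + h * r\<^sup>2)\<^sup>2"
      unfolding sq by (simp add: power2_eq_square algebra_simps)
    show "0 \<le> g + h * r\<^sup>2" using gh by simp
  qed
  have nonneg: "0 \<le> E * (g + h * r\<^sup>2 - 2 * Re (z * b2))"
    using E Re_le amgm by (intro mult_nonneg_nonneg) auto
  show le: "(cmod a0)\<^sup>2 * (1 - (cmod z)\<^sup>2) \<le> (cmod (1 - x2 * z))\<^sup>2 - (cmod (x1 - x3 * z))\<^sup>2"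
    using nonneg unfolding gap r_def by simp
  have "0 < (cmod (1 - x2 * z))\<^sup>2 - (cmod (x1 - x3 * z))\<^sup>2"
  proof (cases "r = 1")
    case True
    have "2 * (r * cmod b2) < g + h * r\<^sup>2"
    proof (rule power2_less_imp_less)
      have "0 < (g - h)\<^sup>2" using gh by simp
      then show "(2 * (r * cmod b2))\<^sup>2 < (g + h * r\<^sup>2)\<^sup>2"
        unfolding sq by (simp add: True power2_eq_square algebra_simps)
      show "0 \<le> g + h * r\<^sup>2" using gh by simp
    qed
    then have "0 < E * (g + h * r\<^sup>2 - 2 * Re (z * b2))"
      using E Re_le by (intro mult_pos_pos) auto
    then show ?thesis unfolding gap True by simp
  next
    case False
    then have "r\<^sup>2 < 1" using r by (simp add: abs_square_less_1)
    then have "0 < (cmod a0)\<^sup>2 * (1 - r\<^sup>2)" using a0 by simp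
    then show ?thesis using le by (simp add: r_def)
  qed
  then show "cmod (x1 - x3 * z) < cmod (1 - x2 * z)"
    by (simp add: power2_less_imp_less)
qed

lemma hexablock_iff:
  fixes w :: "complex ^ 4"
  shows
  "w \<in> hexablock \<longleftrightarrow> tetra_cond (w $ 2) (w $ 3) (w $ 4) \<and>
     (SUP (z1, z2) \<in> {z. cmod z < 1} \<times> {z. cmod z < 1}.
        ereal (cmod (w $ 1 * complex_of_real (sqrt ((1 - (cmod z1)\<^sup>2) * (1 - (cmod z2)\<^sup>2))) /
          (1 - w $ 2 * z1 - w $ 3 * z2 + w $ 4 * z1 * z2)))) < 1" (is "_ \<longleftrightarrow> ?R w")
proof
  assume "w \<in> hexablock"
  then obtain a x1 x2 x3 where "w = vector [a, x1, x2, x3]" "?R (vector [a, x1, x2, x3])"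
    unfolding hexablock_def tetrablock_vector by auto
  then show "?R w" by simp
next
  assume R: "?R w"
  have "w = vector [w $ 1, w $ 2, w $ 3, w $ 4]" by (simp add: vec_eq_iff forall_4)
  then show "w \<in> hexablock" unfolding hexablock_def tetrablock_vector using R by blast
qed

text \<open>
Put \<open>p = \<bar>1 - x2 z2\<bar>\<close>, \<open>q = \<bar>x1 - x3 z2\<bar>\<close> and \<open>t = \<bar>z1\<bar>\<close>.  The denominator has modulus at least \<open>p - t q\<close>,
and \<open>(p - t q)\<^sup>2 \<ge> (p\<^sup>2 - q\<^sup>2) (1 - t\<^sup>2) \<ge> \<bar>a0\<bar>\<^sup>2 (1 - \<bar>z2\<bar>\<^sup>2) (1 - t\<^sup>2)\<close> by the preceding estimates.
\<close>

lemma hexa_point_in_hexablock: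
  assumes par: "hexa_param b1 b2 u v" and y: "cmod y < 1" and x3: "cmod x3 < 1"
  shows "hexa_point b1 b2 u v y x3 \<in> hexablock"
proof -
  define a0 x1 x2 where "a0 = of_real u + v * x3" and "x1 = b1 + cnj b2 * x3" and "x2 = b2 + cnj b1 * x3"
  note gap = hexa_gap[OF par x3, folded a0_def x1_def x2_def]
  have denom: "1 - x1 * z1 - x2 * z2 + x3 * z1 * z2 = (1 - x2 * z2) - z1 * (x1 - x3 * z2)" for z1 z2
    by (simp add: algebra_simps)
  have denom_ge: "cmod (1 - x2 * z2) - cmod z1 * cmod (x1 - x3 * z2) \<le> cmod (1 - x1 * z1 - x2 * z2 + x3 * z1 * z2)"
    for z1 z2
    unfolding denom using norm_triangle_ineq2[of "1 - x2 * z2" "z1 * (x1 - x3 * z2)"] by (simp add: norm_mult)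
  have pos: "0 < cmod (1 - x2 * z2) - cmod z1 * cmod (x1 - x3 * z2)" if "cmod z1 \<le> 1" "cmod z2 \<le> 1" for z1 z2
    using gap(2)[OF that(2)] mult_right_mono[OF that(1) norm_ge_zero[of "x1 - x3 * z2"]] by simp
  have tetra: "tetra_cond x1 x2 x3" unfolding tetra_cond_def
  proof (intro allI impI)
    fix z1 z2 assume "cmod z1 \<le> 1 \<and> cmod z2 \<le> 1"
    then have "0 < cmod (1 - x1 * z1 - x2 * z2 + x3 * z1 * z2)"
      using pos denom_ge less_le_trans by blast
    then show "1 - x1 * z1 - x2 * z2 + x3 * z1 * z2 \<noteq> 0" by simp
  qed
  have bound: "cmod (y * a0 * complex_of_real (sqrt ((1 - (cmod z1)\<^sup>2) * (1 - (cmod z2)\<^sup>2))) /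
          (1 - x1 * z1 - x2 * z2 + x3 * z1 * z2)) \<le> cmod y"
    if z: "cmod z1 < 1" "cmod z2 < 1" for z1 z2
  proof -
    let ?D = "1 - x1 * z1 - x2 * z2 + x3 * z1 * z2"
    define p q t where "p = cmod (1 - x2 * z2)" and "q = cmod (x1 - x3 * z2)" and "t = cmod z1"
    have t: "0 \<le> 1 - t\<^sup>2" using z by (simp add: t_def abs_square_le_1)
    have z2: "0 \<le> 1 - (cmod z2)\<^sup>2" using z by (simp add: abs_square_le_1)
    have D: "0 < p - t * q" "p - t * q \<le> cmod ?D"
      using pos[of z1 z2] denom_ge[of z2 z1] z unfolding p_def q_def t_def by auto
    have "(cmod a0)\<^sup>2 * ((1 - t\<^sup>2) * (1 - (cmod z2)\<^sup>2)) = (cmod a0)\<^sup>2 * (1 - (cmod z2)\<^sup>2) * (1 - t\<^sup>2)" by simp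
    also have "\<dots> \<le> (p\<^sup>2 - q\<^sup>2) * (1 - t\<^sup>2)"
      using gap(1)[of z2] z t unfolding p_def q_def by (intro mult_right_mono) auto
    also have "\<dots> \<le> (p - t * q)\<^sup>2" by (rule aczel_inequality)
    also have "\<dots> \<le> (cmod ?D)\<^sup>2" using D by (intro power_mono) auto
    finally have "(cmod a0 * sqrt ((1 - t\<^sup>2) * (1 - (cmod z2)\<^sup>2)))\<^sup>2 \<le> (cmod ?D)\<^sup>2"
      using t z2 by (simp add: power_mult_distrib)
    then have "cmod a0 * sqrt ((1 - t\<^sup>2) * (1 - (cmod z2)\<^sup>2)) \<le> cmod ?D" by (rule power2_le_imp_le) simp
    then have "cmod y * (cmod a0 * sqrt ((1 - t\<^sup>2) * (1 - (cmod z2)\<^sup>2))) \<le> cmod y * cmod ?D"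
      by (intro mult_left_mono) auto
    moreover have "0 < cmod ?D" using D by linarith
    moreover have "0 \<le> sqrt ((1 - t\<^sup>2) * (1 - (cmod z2)\<^sup>2))" using t z2 by simp
    ultimately show ?thesis
      by (simp add: norm_divide norm_mult pos_divide_le_eq t_def mult.assoc del: zero_less_norm_iff)
  qed
  show ?thesis unfolding hexablock_iff hexa_point_nth
    unfolding a0_def[symmetric] x1_def[symmetric] x2_def[symmetric]
  proof (intro conjI tetra)
    have "(SUP (z1, z2) \<in> {z. cmod z < 1} \<times> {z. cmod z < 1}.
        ereal (cmod (y * a0 * complex_of_real (sqrt ((1 - (cmod z1)\<^sup>2) * (1 - (cmod z2)\<^sup>2))) /
          (1 - x1 * z1 - x2 * z2 + x3 * z1 * z2)))) \<le> ereal (cmod y)"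
      using bound by (intro SUP_least) auto
    also have "\<dots> < 1" using y by (simp add: one_ereal_def)
    finally show "(SUP (z1, z2) \<in> {z. cmod z < 1} \<times> {z. cmod z < 1}.
        ereal (cmod (y * a0 * complex_of_real (sqrt ((1 - (cmod z1)\<^sup>2) * (1 - (cmod z2)\<^sup>2))) /
          (1 - x1 * z1 - x2 * z2 + x3 * z1 * z2)))) < 1" .
  qed
qed

text \<open>
The pair \<open>(z1, z2)\<close> at which the inequality of \<open>hexa_point_in_hexablock\<close> is attained.  The
computation rests on \<open>h1 h2 = u\<^sup>2\<close> for \<open>h1 = \<bar>b1\<bar>\<^sup>2 + u\<^sup>2\<close> and \<open>h2 = \<bar>b2\<bar>\<^sup>2 + u\<^sup>2\<close>.
\<close>

lemma hexa_extremal: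
  fixes b1 b2 v x3 :: complex and u :: real
  assumes par: "hexa_param b1 b2 u v"
  defines "z1 \<equiv> cnj b1 / of_real ((cmod b1)\<^sup>2 + u\<^sup>2)" and "z2 \<equiv> cnj b2 / of_real ((cmod b2)\<^sup>2 + u\<^sup>2)"
  shows "cmod z1 < 1" "cmod z2 < 1"
    and "1 - (b1 + cnj b2 * x3) * z1 - (b2 + cnj b1 * x3) * z2 + x3 * z1 * z2
      = (of_real u + v * x3) * of_real (sqrt ((1 - (cmod z1)\<^sup>2) * (1 - (cmod z2)\<^sup>2)))"
proof -
  define h1 h2 where "h1 = (cmod b1)\<^sup>2 + u\<^sup>2" and "h2 = (cmod b2)\<^sup>2 + u\<^sup>2"
  define H where "H = h1 + h2 - 1"
  have u: "0 < u" "cmod v < u" using hexa_param_pos[OF par] .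
  have "(cmod v)\<^sup>2 < u\<^sup>2" using u by (intro power_strict_mono) auto
  then have H: "H > 0" using hexa_param_norm[OF par] by (simp add: H_def h1_def h2_def)
  have h: "h1 > 0" "h2 > 0" using u by (auto simp: h1_def h2_def add_nonneg_pos)
  have prod: "h1 * h2 = u\<^sup>2" unfolding h1_def h2_def by (rule hexa_param_prod(1)[OF par])
  have b1_sq: "(cmod b1)\<^sup>2 = h1 * (1 - h2)" using prod by (simp add: h1_def algebra_simps)
  have b2_sq: "(cmod b2)\<^sup>2 = h2 * (1 - h1)" using prod by (simp add: h2_def algebra_simps)
  have z1_sq: "1 - (cmod z1)\<^sup>2 = H / h1" and z2_sq: "1 - (cmod z2)\<^sup>2 = H / h2"
  proof -
    have "(cmod z1)\<^sup>2 = (cmod b1)\<^sup>2 / h1\<^sup>2" "(cmod z2)\<^sup>2 = (cmod b2)\<^sup>2 / h2\<^sup>2"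
      using h unfolding z1_def z2_def h1_def[symmetric] h2_def[symmetric]
      by (simp_all add: norm_divide power_divide)
    then have "(cmod z1)\<^sup>2 = (1 - h2) / h1" "(cmod z2)\<^sup>2 = (1 - h1) / h2"
      using h unfolding b1_sq b2_sq by (simp_all add: power2_eq_square)
    then show "1 - (cmod z1)\<^sup>2 = H / h1" "1 - (cmod z2)\<^sup>2 = H / h2"
      using h unfolding H_def by (simp_all add: field_simps)
  qed
  have "(cmod z1)\<^sup>2 < 1" "(cmod z2)\<^sup>2 < 1"
    using z1_sq z2_sq H h by (smt (verit) divide_pos_pos)+
  then show "cmod z1 < 1" "cmod z2 < 1" by (auto simp: abs_square_less_1)
  have root: "sqrt ((1 - (cmod z1)\<^sup>2) * (1 - (cmod z2)\<^sup>2)) = H / u"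
  proof -
    have "(1 - (cmod z1)\<^sup>2) * (1 - (cmod z2)\<^sup>2) = (H / u)\<^sup>2"
      unfolding z1_sq z2_sq by (simp add: prod power_divide power2_eq_square[of H])
    then show ?thesis using H u by simp
  qed
  define U P Q where "U = complex_of_real u" and "P = complex_of_real h1" and "Q = complex_of_real h2"
  have nz: "U \<noteq> 0" "P \<noteq> 0" "Q \<noteq> 0" using u h by (auto simp: U_def P_def Q_def)
  have PQ: "P * Q = U * U" unfolding P_def Q_def U_def by (metis prod of_real_mult power2_eq_square)
  have c1: "b1 * cnj b1 = P * (1 - Q)" and c2: "b2 * cnj b2 = Q * (1 - P)"
    using arg_cong[OF b1_sq, of complex_of_real] arg_cong[OF b2_sq, of complex_of_real]
    unfolding complex_norm_square P_def Q_def by simp_all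
  have cv: "cnj b1 * cnj b2 = - (U * v)" using hexa_param_cross(2)[OF par] by (simp add: U_def)
  have z: "z1 = cnj b1 / P" "z2 = cnj b2 / Q" by (simp_all add: z1_def z2_def P_def Q_def h1_def h2_def)
  have t1: "b1 * z1 = 1 - Q" "b2 * z2 = 1 - P" using nz by (simp_all add: z c1 c2)
  have t2: "cnj b2 * z1 = - (U * v) / P" "cnj b1 * z2 = - (U * v) / Q" "z1 * z2 = - v / U"
    using nz cv PQ by (simp_all add: z mult.commute)
  have "1 - (b1 + cnj b2 * x3) * z1 - (b2 + cnj b1 * x3) * z2 + x3 * z1 * z2
      = 1 - b1 * z1 - b2 * z2 - x3 * (cnj b2 * z1 + cnj b1 * z2 - z1 * z2)"
    by (simp add: algebra_simps)
  also have "\<dots> = (P + Q - 1) + x3 * v * (U / P + U / Q - 1 / U)"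
    unfolding t1 t2 by (simp add: algebra_simps)
  also have "U / P + U / Q - 1 / U = (P + Q - 1) / U"
  proof -
    have "U / P = Q / U" "U / Q = P / U" using nz PQ by (simp_all add: frac_eq_eq mult.commute)
    then show ?thesis by (simp add: diff_divide_distrib add_divide_distrib)
  qed
  also have "(P + Q - 1) + x3 * v * ((P + Q - 1) / U) = (U + v * x3) * ((P + Q - 1) / U)"
    using nz by (simp add: field_simps)
  finally show "1 - (b1 + cnj b2 * x3) * z1 - (b2 + cnj b1 * x3) * z2 + x3 * z1 * z2
      = (of_real u + v * x3) * of_real (sqrt ((1 - (cmod z1)\<^sup>2) * (1 - (cmod z2)\<^sup>2)))"
    unfolding root by (simp add: U_def P_def Q_def H_def)
qed

lemma tetra_coordinates:
  fixes x1 x2 x3 :: complex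
  assumes "cmod x3 < 1"
  defines "b1 \<equiv> (x1 - cnj x2 * x3) / of_real (1 - (cmod x3)\<^sup>2)"
    and "b2 \<equiv> (x2 - cnj x1 * x3) / of_real (1 - (cmod x3)\<^sup>2)"
  shows "x1 = b1 + cnj b2 * x3" "x2 = b2 + cnj b1 * x3"
proof -
  define E where "E = complex_of_real (1 - (cmod x3)\<^sup>2)"
  have E: "E \<noteq> 0" "cnj E = E" "E = 1 - x3 * cnj x3"
    using assms(1) unfolding E_def of_real_eq_0_iff by (simp add: abs_square_eq_1) (simp_all add: complex_norm_square del: of_real_power)
  show "x1 = b1 + cnj b2 * x3" "x2 = b2 + cnj b1 * x3"
    unfolding b1_def b2_def E_def[symmetric] using E(1)
    by (simp_all add: E(2) divide_simps) (simp_all add: E(3) algebra_simps)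
qed

text \<open>
The extremal pair lies on the diagonal when \<open>b1 = b2\<close>.  The defining inequality of the pentablock,
which tests only the diagonal, is therefore strong enough as a hypothesis in that case.
\<close>

lemma hexa_coordinate:
  fixes a b1 b2 x3 :: complex
  assumes par: "hexa_param b1 b2 u v" and x3: "cmod x3 < 1"
    and le: "\<And>z1 z2. \<lbrakk>cmod z1 < 1; cmod z2 < 1; b1 = b2 \<Longrightarrow> z1 = z2\<rbrakk> \<Longrightarrow>
      cmod (a * complex_of_real (sqrt ((1 - (cmod z1)\<^sup>2) * (1 - (cmod z2)\<^sup>2))) /
          (1 - (b1 + cnj b2 * x3) * z1 - (b2 + cnj b1 * x3) * z2 + x3 * z1 * z2)) < 1"
  obtains y where "cmod y < 1" "a = y * (of_real u + v * x3)"
proof -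
  define z1 z2 where "z1 = cnj b1 / of_real ((cmod b1)\<^sup>2 + u\<^sup>2)" and "z2 = cnj b2 / of_real ((cmod b2)\<^sup>2 + u\<^sup>2)"
  define a0 where "a0 = of_real u + v * x3"
  note ex = hexa_extremal[OF par, folded z1_def z2_def]
  define S where "S = sqrt ((1 - (cmod z1)\<^sup>2) * (1 - (cmod z2)\<^sup>2))"
  have "S > 0" using ex(1,2) by (simp add: S_def abs_square_less_1)
  have "0 < cmod a0" unfolding a0_def by (rule hexa_gap(3)[OF par x3, of 0]) simp
  have "cmod (a * of_real S / (a0 * of_real S)) < 1"
    using le[OF ex(1,2)] unfolding ex(3) S_def[symmetric] a0_def[symmetric] by (simp add: z1_def z2_def)
  then have "cmod (a / a0) < 1" using \<open>S > 0\<close> by simp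
  moreover have "a = a / a0 * a0" using \<open>0 < cmod a0\<close> by simp
  ultimately show ?thesis using that unfolding a0_def by blast
qed

text \<open>
Adding \<open>tetra_cond_bound\<close> to its version with \<open>x1\<close> and \<open>x2\<close> exchanged gives \<open>\<bar>b1\<bar> + \<bar>b2\<bar> < 1\<close> for the
solution of \<open>x1 = b1 + cnj b2 x3\<close>, \<open>x2 = b2 + cnj b1 x3\<close>.  The bound on the first coordinate comes from
the extremal pair.
\<close>

lemma hexablock_obtain_point:
  fixes w :: "complex ^ 4"
  assumes "w \<in> hexablock"
  obtains b1 b2 u v y where "hexa_param b1 b2 u v" "cmod y < 1" "cmod (w $ 4) < 1"
    "w = hexa_point b1 b2 u v y (w $ 4)" "w $ 2 = w $ 3 \<longrightarrow> b1 = b2"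
proof -
  define a x1 x2 x3 where "a = w $ 1" and "x1 = w $ 2" and "x2 = w $ 3" and "x3 = w $ 4"
  define f where "f = (\<lambda>(z1, z2). ereal (cmod (a * complex_of_real (sqrt ((1 - (cmod z1)\<^sup>2) * (1 - (cmod z2)\<^sup>2))) /
          (1 - x1 * z1 - x2 * z2 + x3 * z1 * z2))))"
  have w: "tetra_cond x1 x2 x3" "(SUP z \<in> {z. cmod z < 1} \<times> {z. cmod z < 1}. f z) < 1"
    using assms unfolding hexablock_iff a_def x1_def x2_def x3_def f_def by auto
  have lt: "f z < 1" if "z \<in> {z. cmod z < 1} \<times> {z. cmod z < 1}" for z
    using SUP_upper[OF that, of f] w(2) by (rule le_less_trans)
  have bound: "2 * cmod (x2 - cnj x1 * x3) < 1 + (cmod x2)\<^sup>2 - (cmod x1)\<^sup>2 - (cmod x3)\<^sup>2"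
    "2 * cmod (x1 - cnj x2 * x3) < 1 + (cmod x1)\<^sup>2 - (cmod x2)\<^sup>2 - (cmod x3)\<^sup>2"
    using tetra_cond_bound[OF w(1)] tetra_cond_bound[OF tetra_cond_swap[OF w(1)]] by auto
  then have sum: "cmod (x1 - cnj x2 * x3) + cmod (x2 - cnj x1 * x3) < 1 - (cmod x3)\<^sup>2" by simp
  then have E: "0 < 1 - (cmod x3)\<^sup>2" by (smt (verit) norm_ge_zero)
  then have x3: "cmod x3 < 1" by (simp add: abs_square_less_1)
  define b1 b2 where "b1 = (x1 - cnj x2 * x3) / of_real (1 - (cmod x3)\<^sup>2)"
    and "b2 = (x2 - cnj x1 * x3) / of_real (1 - (cmod x3)\<^sup>2)"
  note coords = tetra_coordinates[OF x3, where ?x1.0 = x1 and ?x2.0 = x2, folded b1_def b2_def]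
  have "cmod b1 + cmod b2 < 1"
  proof -
    have "cmod (of_real (1 - (cmod x3)\<^sup>2)) = 1 - (cmod x3)\<^sup>2" using E by (simp only: norm_of_real abs_of_pos)
    then have "cmod b1 + cmod b2 = (cmod (x1 - cnj x2 * x3) + cmod (x2 - cnj x1 * x3)) / (1 - (cmod x3)\<^sup>2)"
      unfolding b1_def b2_def norm_divide by (simp add: add_divide_distrib)
    also have "\<dots> < 1" using sum E by (simp add: pos_divide_less_eq)
    finally show ?thesis .
  qed
  then obtain u v where par: "hexa_param b1 b2 u v" using hexa_param_exists by blast
  obtain y where y: "cmod y < 1" "a = y * (of_real u + v * x3)"
  proof (rule hexa_coordinate[OF par x3])
    fix z1 z2 :: complex assume "cmod z1 < 1" "cmod z2 < 1"
    then show "cmod (a * complex_of_real (sqrt ((1 - (cmod z1)\<^sup>2) * (1 - (cmod z2)\<^sup>2))) /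
          (1 - (b1 + cnj b2 * x3) * z1 - (b2 + cnj b1 * x3) * z2 + x3 * z1 * z2)) < 1"
      using lt[of "(z1, z2)"] coords[symmetric] by (simp add: f_def one_ereal_def)
  qed
  have "w = hexa_point b1 b2 u v y x3"
    using y(2) coords by (simp add: vec_eq_iff forall_4 a_def x1_def x2_def x3_def)
  moreover have "w $ 2 = w $ 3 \<longrightarrow> b1 = b2" by (simp add: b1_def b2_def x1_def x2_def)
  ultimately show ?thesis using that par y(1) x3 by (simp add: x3_def)
qed

section \<open>The distinguished boundary of the hexablock\<close>

definition hexa_boundary :: "(complex ^ 4) set" where
  "hexa_boundary = {w. cmod (w $ 4) = 1 \<and> w $ 2 = cnj (w $ 3) * w $ 4 \<and> (cmod (w $ 1))\<^sup>2 + (cmod (w $ 2))\<^sup>2 = 1}"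

definition penta_boundary :: "(complex ^ 3) set" where
  "penta_boundary = {w. cmod (w $ 3) = 1 \<and> w $ 2 = cnj (w $ 2) * w $ 3 \<and> (cmod (w $ 1))\<^sup>2 + (cmod (w $ 2))\<^sup>2 / 4 = 1}"

lemma continuous_on_vec_nthI:
  fixes F :: "'b::topological_space \<Rightarrow> 'a::topological_space ^ 'n"
  assumes "\<And>i. continuous_on S (\<lambda>x. F x $ i)"
  shows "continuous_on S F"
  using continuous_on_vec_lambda[of S "\<lambda>i x. F x $ i"] assms by (simp add: vec_nth_inverse)

lemma closure_radial_limit:
  fixes F :: "real \<Rightarrow> 'a::topological_space"
  assumes "continuous_on {0..1} F" "\<And>r. 0 \<le> r \<Longrightarrow> r < 1 \<Longrightarrow> F r \<in> closure S"
  shows "F 1 \<in> closure S"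
proof -
  have "F ` closure {0..<1} \<subseteq> closure S"
    by (rule image_closure_subset) (use assms in auto)
  then show ?thesis by auto
qed

lemma moebius_disc:
  assumes "cmod c < 1"
  shows "continuous_on (cball 0 1) (Moebius_function 0 (- c))"
    and "Moebius_function 0 (- c) holomorphic_on ball 0 1"
    and "cmod z < 1 \<Longrightarrow> cmod (Moebius_function 0 (- c) z) < 1"
    and "cmod z = 1 \<Longrightarrow> cmod (Moebius_function 0 (- c) z) = 1"
    and "Moebius_function 0 (- c) 0 = c"
proof -
  have nz: "1 + cnj c * z \<noteq> 0" if "cmod z \<le> 1" for z
  proof -
    have "cmod (cnj c * z) \<le> cmod c" using that by (simp add: norm_mult mult_left_le)
    then have "cmod (cnj c * z) < cmod (1::complex)" using assms by simp
    then show ?thesis by (metis add_eq_0_iff2 less_irrefl norm_minus_cancel)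
  qed
  have m: "Moebius_function 0 (- c) z = (z + c) / (1 + cnj c * z)" for z
    by (simp add: Moebius_function_simple)
  show "continuous_on (cball 0 1) (Moebius_function 0 (- c))"
    unfolding m[abs_def] by (intro continuous_intros) (use nz in auto)
  show "Moebius_function 0 (- c) holomorphic_on ball 0 1"
    using assms by (simp add: Moebius_function_holomorphic)
  show "cmod z < 1 \<Longrightarrow> cmod (Moebius_function 0 (- c) z) < 1"
    using assms by (simp add: Moebius_function_norm_lt_1)
  show "cmod (Moebius_function 0 (- c) z) = 1" if z: "cmod z = 1"
  proof -
    have "cnj z * (z + c) = cnj (1 + cnj c * z)"
      using complex_norm_square[of z] z by (simp add: algebra_simps)
    then have "cmod (z + c) = cmod (1 + cnj c * z)"
      using z by (metis complex_mod_cnj mult_1 norm_mult)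
    then show ?thesis using nz[of z] z by (simp add: m norm_divide)
  qed
  show "Moebius_function 0 (- c) 0 = c" by (simp add: m)
qed

lemma hexa_point_in_boundary:
  assumes par: "hexa_param b1 b2 u v" and "cmod y = 1" "cmod x3 = 1"
  shows "hexa_point b1 b2 u v y x3 \<in> hexa_boundary"
proof -
  have "x3 * cnj x3 = 1" using complex_norm_square[of x3] assms(3) by simp
  then have "b1 + cnj b2 * x3 = cnj (b2 + cnj b1 * x3) * x3" by (simp add: algebra_simps)
  then show ?thesis
    using hexa_identity(1)[OF par, of x3] assms(2,3) by (simp add: hexa_boundary_def norm_mult)
qed

text \<open>
Composing both disc coordinates with automorphisms moves the centre of the disc to a prescribed point
and preserves the unit circle.
\<close>

definition hexa_disc :: "complex \<Rightarrow> complex \<Rightarrow> real \<Rightarrow> complex \<Rightarrow> complex \<Rightarrow> complex \<Rightarrow> complex \<Rightarrow> complex ^ 4" where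
  "hexa_disc b1 b2 u v y x3 z =
     hexa_point b1 b2 u v (Moebius_function 0 (- y) z) (Moebius_function 0 (- x3) z)"

lemma hexa_disc:
  assumes par: "hexa_param b1 b2 u v" and "cmod y < 1" "cmod x3 < 1"
  shows "analytic_disc (hexa_disc b1 b2 u v y x3)"
    and "hexa_disc b1 b2 u v y x3 ` ball 0 1 \<subseteq> hexablock"
    and "hexa_disc b1 b2 u v y x3 ` sphere 0 1 \<subseteq> hexa_boundary"
    and "hexa_disc b1 b2 u v y x3 0 = hexa_point b1 b2 u v y x3"
proof -
  let ?g = "hexa_disc b1 b2 u v y x3"
  note g_def = hexa_disc_def
  note My = moebius_disc[OF assms(2)] and Mx = moebius_disc[OF assms(3)]
  show "analytic_disc ?g" unfolding analytic_disc_def forall_4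
  proof (intro conjI continuous_on_vec_nthI)
    fix i :: 4
    have "i = 1 \<or> i = 2 \<or> i = 3 \<or> i = 4" by (rule exhaust_4)
    then show "continuous_on (cball 0 1) (\<lambda>z. ?g z $ i)"
      using My(1) Mx(1) by (elim disjE) (auto simp: g_def intro!: continuous_intros)
  qed (use My(2) Mx(2) in \<open>auto simp: g_def intro!: holomorphic_intros\<close>)
  show "?g ` ball 0 1 \<subseteq> hexablock"
    using My(3) Mx(3) by (auto simp: g_def intro!: hexa_point_in_hexablock par)
  show "?g ` sphere 0 1 \<subseteq> hexa_boundary"
    using My(4) Mx(4) by (auto simp: g_def intro!: hexa_point_in_boundary par)
  show "?g 0 = hexa_point b1 b2 u v y x3" by (simp add: g_def My(5) Mx(5))
qed

text \<open>
A boundary point with \<open>\<bar>x1\<bar> < 1\<close> has coordinates \<open>b1 = x1 / 2\<close>, \<open>b2 = x2 / 2\<close> and unimodular \<open>y\<close>, \<open>x3\<close>, so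
it is a radial limit of points of the hexablock.  The points with \<open>\<bar>x1\<bar> = 1\<close> are limits of such
boundary points.
\<close>

lemma hexa_boundary_subset_closure: "hexa_boundary \<subseteq> closure hexablock"
proof
  have generic: "w \<in> closure hexablock" if w: "w \<in> hexa_boundary" "cmod (w $ 2) < 1" for w :: "complex ^ 4"
  proof -
    define b1 b2 where "b1 = w $ 2 / 2" and "b2 = w $ 3 / 2"
    have w': "cmod (w $ 4) = 1" "w $ 2 = cnj (w $ 3) * w $ 4" "(cmod (w $ 1))\<^sup>2 + (cmod (w $ 2))\<^sup>2 = 1"
      using w by (auto simp: hexa_boundary_def)
    have "w $ 4 * cnj (w $ 4) = 1" using complex_norm_square[of "w $ 4"] w'(1) by simp
    then have w3: "w $ 3 = cnj (w $ 2) * w $ 4" by (simp add: w'(2) mult.assoc) (simp add: mult.commute)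
    have "cmod (w $ 3) = cmod (w $ 2)" by (simp add: w'(1,2) norm_mult)
    then have "cmod b1 + cmod b2 < 1" using w(2) by (simp add: b1_def b2_def norm_divide)
    then obtain u v where par: "hexa_param b1 b2 u v" using hexa_param_exists by blast
    have x: "b1 + cnj b2 * w $ 4 = w $ 2" "b2 + cnj b1 * w $ 4 = w $ 3"
      by (simp_all add: b1_def b2_def w'(2)[symmetric] w3[symmetric])
    define a0 where "a0 = of_real u + v * w $ 4"
    have "a0 \<noteq> 0"
    proof -
      have "cmod (v * w $ 4) < cmod (of_real u)" using hexa_param_pos[OF par] w'(1) by (simp add: norm_mult)
      then show ?thesis unfolding a0_def by (metis add_eq_0_iff2 less_irrefl norm_minus_cancel)
    qed
    have "1 - (cmod (w $ 2))\<^sup>2 = (cmod a0)\<^sup>2"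
      using hexa_identity(1)[OF par, of "w $ 4"] w'(1) unfolding x a0_def by simp
    then have "(cmod a0)\<^sup>2 = (cmod (w $ 1))\<^sup>2" using w'(3) by linarith
    then have a0: "cmod a0 = cmod (w $ 1)" by simp
    define y where "y = w $ 1 / a0"
    have y: "cmod y = 1" "w $ 1 = y * a0" using a0 \<open>a0 \<noteq> 0\<close> by (auto simp: y_def norm_divide)
    define F where "F r = hexa_point b1 b2 u v (of_real r * y) (of_real r * w $ 4)" for r
    have "F 1 \<in> closure hexablock"
    proof (rule closure_radial_limit)
      show "continuous_on {0..1} F"
      proof (rule continuous_on_vec_nthI)
        fix i :: 4
        have "i = 1 \<or> i = 2 \<or> i = 3 \<or> i = 4" by (rule exhaust_4)
        then show "continuous_on {0..1} (\<lambda>r. F r $ i)"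
          by (elim disjE) (auto simp: F_def intro!: continuous_intros)
      qed
      show "F r \<in> closure hexablock" if "0 \<le> r" "r < 1" for r
      proof -
        have "F r \<in> hexablock" unfolding F_def
          by (rule hexa_point_in_hexablock[OF par]) (use that y(1) w'(1) in \<open>simp_all add: norm_mult\<close>)
        then show ?thesis using closure_subset by blast
      qed
    qed
    moreover have "F 1 = w" by (simp add: vec_eq_iff forall_4 F_def x y(2) a0_def)
    ultimately show ?thesis by simp
  qed
  fix w :: "complex ^ 4" assume w: "w \<in> hexa_boundary"
  show "w \<in> closure hexablock"
  proof (cases "cmod (w $ 2) < 1")
    case True
    then show ?thesis using generic w by blast
  next
    case False
    have w': "cmod (w $ 4) = 1" "w $ 2 = cnj (w $ 3) * w $ 4" "(cmod (w $ 1))\<^sup>2 + (cmod (w $ 2))\<^sup>2 = 1"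
      using w by (auto simp: hexa_boundary_def)
    have "1 \<le> (cmod (w $ 2))\<^sup>2" using False by simp
    then have w2: "cmod (w $ 2) = 1" "w $ 1 = 0"
      using w'(3) by (smt (verit) zero_le_power2 power2_eq_1_iff norm_ge_zero norm_eq_zero zero_eq_power2)+
    define F :: "real \<Rightarrow> complex ^ 4"
      where "F r = vector [of_real (sqrt (1 - r\<^sup>2)), of_real r * w $ 2, of_real r * w $ 3, w $ 4]" for r
    have "F 1 \<in> closure hexablock"
    proof (rule closure_radial_limit)
      show "continuous_on {0..1} F"
      proof (rule continuous_on_vec_nthI)
        fix i :: 4
        have "i = 1 \<or> i = 2 \<or> i = 3 \<or> i = 4" by (rule exhaust_4)
        then show "continuous_on {0..1} (\<lambda>r. F r $ i)"
          by (elim disjE) (auto simp: F_def intro!: continuous_intros)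
      qed
      show "F r \<in> closure hexablock" if r: "0 \<le> r" "r < 1" for r
      proof (rule generic)
        have "r\<^sup>2 \<le> 1" using r by (simp add: abs_square_le_1)
        then show "F r \<in> hexa_boundary"
          using r w' w2 by (simp add: hexa_boundary_def F_def norm_mult power_mult_distrib)
        show "cmod (F r $ 2) < 1" using r w2 by (simp add: F_def norm_mult)
      qed
    qed
    moreover have "F 1 = w" by (simp add: vec_eq_iff forall_4 F_def w2)
    ultimately show ?thesis by simp
  qed
qed

text \<open>
By \<open>hexa_identity\<close> both \<open>\<bar>a\<bar>\<^sup>2 + \<bar>x1\<bar>\<^sup>2\<close> and \<open>\<bar>a\<bar>\<^sup>2 + \<bar>x2\<bar>\<^sup>2\<close> are at most one.
\<close>

lemma hexablock_weighted_bound: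
  fixes w :: "complex ^ 4"
  assumes "w \<in> hexablock"
  shows "2 * (cmod (w $ 1))\<^sup>2 + (cmod (w $ 2))\<^sup>2 + (cmod (w $ 3))\<^sup>2 + (cmod (w $ 4))\<^sup>2 \<le> 3"
proof -
  obtain b1 b2 u v y where par: "hexa_param b1 b2 u v" and y: "cmod y < 1" and x3: "cmod (w $ 4) < 1"
    and w: "w = hexa_point b1 b2 u v y (w $ 4)" and "w $ 2 = w $ 3 \<longrightarrow> b1 = b2"
    by (rule hexablock_obtain_point[OF assms])
  define a0 where "a0 = of_real u + v * w $ 4"
  define E where "E = 1 - (cmod (w $ 4))\<^sup>2"
  have E: "0 \<le> E" using x3 by (simp add: E_def abs_square_le_1)
  have w1: "w $ 1 = y * a0" and w2: "w $ 2 = b1 + cnj b2 * w $ 4" and w3: "w $ 3 = b2 + cnj b1 * w $ 4"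
    using arg_cong[OF w, of "\<lambda>w :: complex ^ 4. w $ 1"] arg_cong[OF w, of "\<lambda>w :: complex ^ 4. w $ 2"] arg_cong[OF w, of "\<lambda>w :: complex ^ 4. w $ 3"]
    by (simp_all add: a0_def)
  have "cmod (w $ 1) \<le> cmod a0" using y by (simp add: w1 norm_mult mult_left_le_one_le)
  then have 1: "(cmod (w $ 1))\<^sup>2 \<le> (cmod a0)\<^sup>2" by (intro power_mono) auto
  have 2: "(cmod (w $ 2))\<^sup>2 = 1 - (cmod a0)\<^sup>2 - E * ((cmod b2)\<^sup>2 + (cmod v)\<^sup>2)"
    using hexa_identity(1)[OF par, of "w $ 4"] by (simp add: w2 a0_def E_def)
  have 3: "(cmod (w $ 3))\<^sup>2 = 1 - (cmod a0)\<^sup>2 - E * (1 - (cmod b2)\<^sup>2 - u\<^sup>2)"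
    using hexa_identity(2)[OF par, of "w $ 4"] by (simp add: w3 a0_def E_def algebra_simps)
  have "(cmod b2)\<^sup>2 + u\<^sup>2 \<le> 1"
    using hexa_param_norm[OF par] by (smt (verit) zero_le_power2)
  then have "0 \<le> E * (1 - (cmod b2)\<^sup>2 - u\<^sup>2)" "0 \<le> E * ((cmod b2)\<^sup>2 + (cmod v)\<^sup>2)"
    using E by (auto intro!: mult_nonneg_nonneg)
  moreover have "(cmod (w $ 4))\<^sup>2 \<le> 1" using E by (simp add: E_def)
  ultimately show ?thesis using 1 2 3 by linarith
qed

lemma cnj_mult_self_if_norm_1: "cmod x = 1 \<Longrightarrow> cmod (cnj y * x) = cmod y"
  by (simp add: norm_mult)

theorem distinguished_boundary_hexablock: "distinguished_boundary hexablock = hexa_boundary"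
proof (rule distinguished_boundary_eqI[where c = "\<lambda>i. if i = 1 then 2 else 1" and R = 3])
  show "closed hexa_boundary" unfolding hexa_boundary_def
    by (intro closed_Collect_conj closed_Collect_eq continuous_intros)
  have "vector [1, 0, 0, 1] \<in> hexa_boundary" by (simp add: hexa_boundary_def)
  then show "hexa_boundary \<noteq> {}" by blast
  show "hexa_boundary \<subseteq> closure hexablock" by (rule hexa_boundary_subset_closure)
  show "(\<Sum>i\<in>UNIV. (if i = 1 then 2 else 1) * (cmod (w $ i))\<^sup>2) \<le> 3" if "w \<in> hexablock" for w :: "complex ^ 4"
    using hexablock_weighted_bound[OF that] by (simp add: sum_4)
  show "(\<Sum>i\<in>UNIV. (if i = 1 then 2 else 1) * (cmod (w $ i))\<^sup>2) = 3" if "w \<in> hexa_boundary" for w :: "complex ^ 4"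
  proof -
    have "cmod (w $ 4) = 1" "cmod (w $ 2) = cmod (w $ 3)" "(cmod (w $ 1))\<^sup>2 + (cmod (w $ 2))\<^sup>2 = 1"
      using that by (auto simp: hexa_boundary_def cnj_mult_self_if_norm_1)
    then show ?thesis by (simp add: sum_4)
  qed
  show "\<exists>g. analytic_disc g \<and> g ` ball 0 1 \<subseteq> hexablock \<and> g ` sphere 0 1 \<subseteq> hexa_boundary \<and> g 0 = w"
    if w: "w \<in> hexablock" for w
  proof -
    obtain b1 b2 u v y where par: "hexa_param b1 b2 u v" "cmod y < 1" "cmod (w $ 4) < 1"
      and "w = hexa_point b1 b2 u v y (w $ 4)" "w $ 2 = w $ 3 \<longrightarrow> b1 = b2"
      by (rule hexablock_obtain_point[OF w])
    then show ?thesis using hexa_disc[OF par] by metis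
  qed
qed auto

section \<open>The pentablock as the symmetric slice of the hexablock\<close>

lemma pentablock_iff:
  fixes w :: "complex ^ 3"
  shows "w \<in> pentablock \<longleftrightarrow> vector [w $ 2, w $ 3] \<in> symmetrized_bidisc \<and>
     (SUP z \<in> {z. cmod z < 1}.
        ereal (cmod (w $ 1 * complex_of_real (1 - (cmod z)\<^sup>2) / (1 - w $ 2 * z + w $ 3 * z\<^sup>2)))) < 1"
    (is "_ \<longleftrightarrow> ?R w")
proof
  assume "w \<in> pentablock"
  then obtain a s p where "w = vector [a, s, p]" "?R (vector [a, s, p])"
    unfolding pentablock_def by auto
  then show "?R w" by simp
next
  assume R: "?R w"
  have "w = vector [w $ 1, w $ 2, w $ 3]" by (simp add: vec_eq_iff forall_3)
  then show "w \<in> pentablock" unfolding pentablock_def using R by blast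
qed

lemma symmetrized_bidisc_iff:
  "vector [s, p] \<in> symmetrized_bidisc \<longleftrightarrow> (\<exists>z1 z2. s = z1 + z2 \<and> p = z1 * z2 \<and> cmod z1 < 1 \<and> cmod z2 < 1)"
proof -
  have "(vector [s, p] :: complex ^ 2) = vector [z1 + z2, z1 * z2] \<longleftrightarrow> s = z1 + z2 \<and> p = z1 * z2" for z1 z2
    by (simp add: vec_eq_iff forall_2)
  then show ?thesis by (auto simp: symmetrized_bidisc_def)
qed

lemma tetra_cond_imp_symmetrized:
  assumes "tetra_cond x1 x2 x3"
  shows "vector [x1 + x2, x3] \<in> symmetrized_bidisc"
proof -
  define d where "d = csqrt ((x1 + x2)\<^sup>2 - 4 * x3)"
  define z1 z2 where "z1 = (x1 + x2 + d) / 2" and "z2 = (x1 + x2 - d) / 2"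
  have "d * d = (x1 + x2) * (x1 + x2) - 4 * x3"
    using power2_csqrt[of "(x1 + x2)\<^sup>2 - 4 * x3"] by (simp add: d_def power2_eq_square)
  then have z: "x1 + x2 = z1 + z2" "x3 = z1 * z2"
    by (simp_all add: z1_def z2_def field_simps)
  have root: "cmod y < 1" if y: "y + y' = x1 + x2" "y * y' = x3" for y y'
  proof (rule ccontr)
    assume "\<not> cmod y < 1"
    then have "y \<noteq> 0" "cmod (1 / y) \<le> 1" by (auto simp: norm_divide divide_le_eq not_less)
    moreover have "1 - x1 * (1 / y) - x2 * (1 / y) + x3 * (1 / y) * (1 / y) = 0"
    proof -
      have "1 - x1 * (1 / y) - x2 * (1 / y) + x3 * (1 / y) * (1 / y)
          = 1 - (x1 + x2) * (1 / y) + x3 * (1 / y) * (1 / y)"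
        by (simp add: add_divide_distrib)
      also have "\<dots> = 0" unfolding y[symmetric] using \<open>y \<noteq> 0\<close> by (simp add: field_simps)
      finally show ?thesis .
    qed
    ultimately show False using assms[unfolded tetra_cond_def, rule_format, of "1 / y" "1 / y"] by blast
  qed
  show ?thesis unfolding symmetrized_bidisc_iff
    using z root[of z1 z2] root[of z2 z1] by (metis add.commute mult.commute)
qed

definition fold_hexa :: "complex ^ 4 \<Rightarrow> complex ^ 3" where
  "fold_hexa w = vector [w $ 1, w $ 2 + w $ 3, w $ 4]"

definition unfold_penta :: "complex ^ 3 \<Rightarrow> complex ^ 4" where
  "unfold_penta w = vector [w $ 1, w $ 2 / 2, w $ 2 / 2, w $ 3]"

lemma fold_hexa_nth [simp]:
  "fold_hexa w $ 1 = w $ 1" "fold_hexa w $ 2 = w $ 2 + w $ 3" "fold_hexa w $ 3 = w $ 4"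
  by (simp_all add: fold_hexa_def)

lemma unfold_penta_nth [simp]:
  "unfold_penta w $ 1 = w $ 1" "unfold_penta w $ 2 = w $ 2 / 2"
  "unfold_penta w $ 3 = w $ 2 / 2" "unfold_penta w $ 4 = w $ 3"
  by (simp_all add: unfold_penta_def)

lemma fold_unfold: "fold_hexa (unfold_penta w) = w"
  by (simp add: vec_eq_iff forall_3)

text \<open>
The expressions for the pentablock are those for the hexablock on the diagonal \<open>z1 = z2\<close>.
\<close>

lemma fold_hexa_in_pentablock:
  assumes "w \<in> hexablock"
  shows "fold_hexa w \<in> pentablock"
  unfolding pentablock_iff fold_hexa_nth
proof
  define f where "f = (\<lambda>(z1, z2). ereal (cmod (w $ 1 * complex_of_real (sqrt ((1 - (cmod z1)\<^sup>2) * (1 - (cmod z2)\<^sup>2))) /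
          (1 - w $ 2 * z1 - w $ 3 * z2 + w $ 4 * z1 * z2))))"
  have w: "tetra_cond (w $ 2) (w $ 3) (w $ 4)" "(SUP z \<in> {z. cmod z < 1} \<times> {z. cmod z < 1}. f z) < 1"
    using assms unfolding hexablock_iff f_def by auto
  show "vector [w $ 2 + w $ 3, w $ 4] \<in> symmetrized_bidisc"
    by (rule tetra_cond_imp_symmetrized[OF w(1)])
  have "(SUP z \<in> {z. cmod z < 1}. ereal (cmod (w $ 1 * complex_of_real (1 - (cmod z)\<^sup>2) /
      (1 - (w $ 2 + w $ 3) * z + w $ 4 * z\<^sup>2)))) \<le> (SUP z \<in> {z. cmod z < 1} \<times> {z. cmod z < 1}. f z)"
  proof (rule SUP_least)
    fix z :: complex assume z: "z \<in> {z. cmod z < 1}"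
    then have "0 \<le> 1 - (cmod z)\<^sup>2" by (simp add: abs_square_le_1)
    then have "sqrt ((1 - (cmod z)\<^sup>2) * (1 - (cmod z)\<^sup>2)) = 1 - (cmod z)\<^sup>2" by simp
    moreover have "1 - (w $ 2 + w $ 3) * z + w $ 4 * z\<^sup>2 = 1 - w $ 2 * z - w $ 3 * z + w $ 4 * z * z"
      by (simp add: power2_eq_square algebra_simps)
    ultimately have "ereal (cmod (w $ 1 * complex_of_real (1 - (cmod z)\<^sup>2) /
      (1 - (w $ 2 + w $ 3) * z + w $ 4 * z\<^sup>2))) = f (z, z)" by (simp only: f_def case_prod_conv)
    also have "\<dots> \<le> (SUP z \<in> {z. cmod z < 1} \<times> {z. cmod z < 1}. f z)"
      by (rule SUP_upper) (use z in simp)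
    finally show "ereal (cmod (w $ 1 * complex_of_real (1 - (cmod z)\<^sup>2) /
      (1 - (w $ 2 + w $ 3) * z + w $ 4 * z\<^sup>2))) \<le> (SUP z \<in> {z. cmod z < 1} \<times> {z. cmod z < 1}. f z)" .
  qed
  then show "(SUP z \<in> {z. cmod z < 1}. ereal (cmod (w $ 1 * complex_of_real (1 - (cmod z)\<^sup>2) /
      (1 - (w $ 2 + w $ 3) * z + w $ 4 * z\<^sup>2)))) < 1"
    using w(2) by (rule le_less_trans)
qed

text \<open>
For \<open>s = \<zeta>1 + \<zeta>2\<close> and \<open>p = \<zeta>1 \<zeta>2\<close> one has
\<open>s - cnj s p = \<zeta>1 (1 - \<bar>\<zeta>2\<bar>\<^sup>2) + \<zeta>2 (1 - \<bar>\<zeta>1\<bar>\<^sup>2)\<close>, which is less than \<open>1 - \<bar>p\<bar>\<^sup>2\<close> in modulus; so the point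
\<open>(s/2, s/2, p)\<close> has coordinates \<open>b1 = b2\<close> of modulus less than one half.  The bound on \<open>a\<close> then only needs
the diagonal.
\<close>

lemma unfold_penta_in_hexablock:
  assumes "w \<in> pentablock"
  shows "unfold_penta w \<in> hexablock"
proof -
  define a s p where "a = w $ 1" and "s = w $ 2" and "p = w $ 3"
  define f where "f = (\<lambda>z. ereal (cmod (a * complex_of_real (1 - (cmod z)\<^sup>2) / (1 - s * z + p * z\<^sup>2))))"
  have w: "vector [s, p] \<in> symmetrized_bidisc" "(SUP z \<in> {z. cmod z < 1}. f z) < 1"
    using assms unfolding pentablock_iff a_def s_def p_def f_def by auto
  have lt: "f z < 1" if "cmod z < 1" for z
    using SUP_upper[of z "{z. cmod z < 1}" f] w(2) that by (auto intro: le_less_trans)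
  obtain \<zeta>1 \<zeta>2 where sp: "s = \<zeta>1 + \<zeta>2" "p = \<zeta>1 * \<zeta>2" and z: "cmod \<zeta>1 < 1" "cmod \<zeta>2 < 1"
    using w(1) unfolding symmetrized_bidisc_iff by blast
  define k l where "k = cmod \<zeta>1" and "l = cmod \<zeta>2"
  have kl: "0 \<le> k" "0 \<le> l" "k < 1" "l < 1" using z by (auto simp: k_def l_def)
  have p_norm: "cmod p = k * l" by (simp add: sp norm_mult k_def l_def)
  have p1: "cmod p < 1" unfolding p_norm using kl by (smt (verit) mult_left_le mult_nonneg_nonneg)
  have E: "0 < 1 - (cmod p)\<^sup>2" using p1 by (simp add: abs_square_less_1)
  have num: "cmod (s - cnj s * p) < 1 - (cmod p)\<^sup>2"
  proof -
    have "s - cnj s * p = \<zeta>1 * of_real (1 - l\<^sup>2) + \<zeta>2 * of_real (1 - k\<^sup>2)"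
      unfolding sp l_def k_def of_real_diff complex_norm_square by (simp add: algebra_simps)
    also have "cmod \<dots> \<le> k * (1 - l\<^sup>2) + l * (1 - k\<^sup>2)"
    proof (rule order_trans[OF norm_triangle_ineq])
      have "0 \<le> 1 - l\<^sup>2" "0 \<le> 1 - k\<^sup>2" using kl by (auto simp: abs_square_le_1)
      then show "cmod (\<zeta>1 * of_real (1 - l\<^sup>2)) + cmod (\<zeta>2 * of_real (1 - k\<^sup>2)) \<le> k * (1 - l\<^sup>2) + l * (1 - k\<^sup>2)"
        unfolding norm_mult norm_of_real k_def[symmetric] l_def[symmetric] by simp
    qed
    also have "\<dots> < 1 - (k * l)\<^sup>2"
    proof -
      have "0 < (1 - k) * (1 - l)" using kl by simp
      then have "0 < ((1 - k) * (1 - l)) * (1 - k * l)" using p1 unfolding p_norm by simp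
      then show ?thesis by (simp add: power2_eq_square algebra_simps)
    qed
    finally show ?thesis by (simp add: p_norm)
  qed
  define b where "b = (s / 2 - cnj (s / 2) * p) / of_real (1 - (cmod p)\<^sup>2)"
  have coords: "s / 2 = b + cnj b * p" unfolding b_def by (rule tetra_coordinates(1)[OF p1])
  have "cmod b < 1 / 2"
  proof -
    have eq: "s / 2 - cnj (s / 2) * p = (s - cnj s * p) / 2" by (simp add: diff_divide_distrib)
    have "cmod b = cmod (s - cnj s * p) / 2 / cmod (of_real (1 - (cmod p)\<^sup>2))"
      unfolding b_def eq norm_divide norm_numeral ..
    also have "cmod (of_real (1 - (cmod p)\<^sup>2)) = 1 - (cmod p)\<^sup>2" using E by (simp only: norm_of_real abs_of_pos)
    also have "cmod (s - cnj s * p) / 2 / (1 - (cmod p)\<^sup>2) < 1 / 2"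
      using num E by (simp add: pos_divide_less_eq)
    finally show ?thesis .
  qed
  then obtain u v where par: "hexa_param b b u v" using hexa_param_exists[of b b] by auto
  obtain y where y: "cmod y < 1" "a = y * (of_real u + v * p)"
  proof (rule hexa_coordinate[OF par p1])
    fix z1 z2 :: complex assume z: "cmod z1 < 1" "b = b \<Longrightarrow> z1 = z2"
    then have "z2 = z1" by simp
    have "0 \<le> 1 - (cmod z1)\<^sup>2" using z by (simp add: abs_square_le_1)
    then have r: "sqrt ((1 - (cmod z1)\<^sup>2) * (1 - (cmod z1)\<^sup>2)) = 1 - (cmod z1)\<^sup>2" by simp
    have d: "1 - s / 2 * z1 - s / 2 * z1 + p * z1 * z1 = 1 - s * z1 + p * z1\<^sup>2"
      by (simp add: power2_eq_square)
    show "cmod (a * complex_of_real (sqrt ((1 - (cmod z1)\<^sup>2) * (1 - (cmod z2)\<^sup>2))) /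
          (1 - (b + cnj b * p) * z1 - (b + cnj b * p) * z2 + p * z1 * z2)) < 1"
      unfolding \<open>z2 = z1\<close> r coords[symmetric] d using lt[OF z(1)] by (simp add: f_def one_ereal_def)
  qed
  have "unfold_penta w = hexa_point b b u v y p"
    using y(2) coords by (simp add: vec_eq_iff forall_4 a_def s_def p_def)
  then show ?thesis using hexa_point_in_hexablock[OF par y(1) p1] by simp
qed

lemma unfold_penta_boundary_iff: "unfold_penta w \<in> hexa_boundary \<longleftrightarrow> w \<in> penta_boundary"
  by (simp add: hexa_boundary_def penta_boundary_def norm_divide power_divide)

text \<open>
Discs, approximating points and the ellipsoid are those of the hexablock, transported by the linear
maps \<open>fold_hexa\<close> and \<open>unfold_penta\<close>.  A disc through a symmetric point is symmetric, since \<open>b1 = b2\<close>.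
\<close>

theorem distinguished_boundary_pentablock: "distinguished_boundary pentablock = penta_boundary"
proof (rule distinguished_boundary_eqI[where c = "\<lambda>i. if i = 1 then 2 else if i = 2 then 1 / 2 else 1" and R = 3])
  show "closed penta_boundary" unfolding penta_boundary_def
    by (intro closed_Collect_conj closed_Collect_eq continuous_intros) auto
  have "vector [1, 0, 1] \<in> penta_boundary" by (simp add: penta_boundary_def)
  then show "penta_boundary \<noteq> {}" by blast
  have cont: "continuous_on S fold_hexa" for S
  proof (rule continuous_on_vec_nthI)
    fix i :: 3
    have "i = 1 \<or> i = 2 \<or> i = 3" by (rule exhaust_3)
    then show "continuous_on S (\<lambda>w. fold_hexa w $ i)" by (elim disjE) (auto intro!: continuous_intros)
  qed
  show "penta_boundary \<subseteq> closure pentablock"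
  proof
    fix w assume "w \<in> penta_boundary"
    then have "unfold_penta w \<in> closure hexablock"
      using hexa_boundary_subset_closure unfold_penta_boundary_iff by blast
    moreover have "fold_hexa ` closure hexablock \<subseteq> closure pentablock"
      by (rule image_closure_subset[OF cont closed_closure]) (use fold_hexa_in_pentablock closure_subset in blast)
    ultimately show "w \<in> closure pentablock" by (metis fold_unfold image_subset_iff)
  qed
  show "(\<Sum>i\<in>UNIV. (if i = 1 then 2 else if i = 2 then 1 / 2 else 1) * (cmod (w $ i))\<^sup>2) \<le> 3"
    if "w \<in> pentablock" for w :: "complex ^ 3"
    using hexablock_weighted_bound[OF unfold_penta_in_hexablock[OF that]]
    by (simp add: sum_3 norm_divide power_divide)
  show "(\<Sum>i\<in>UNIV. (if i = 1 then 2 else if i = 2 then 1 / 2 else 1) * (cmod (w $ i))\<^sup>2) = 3"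
    if "w \<in> penta_boundary" for w :: "complex ^ 3"
    using that by (auto simp: penta_boundary_def sum_3)
  show "\<exists>g. analytic_disc g \<and> g ` ball 0 1 \<subseteq> pentablock \<and> g ` sphere 0 1 \<subseteq> penta_boundary \<and> g 0 = w"
    if w: "w \<in> pentablock" for w
  proof -
    obtain b1 b2 u v y where par: "hexa_param b1 b2 u v" "cmod y < 1" "cmod (unfold_penta w $ 4) < 1"
      and uw: "unfold_penta w = hexa_point b1 b2 u v y (unfold_penta w $ 4)"
      and "unfold_penta w $ 2 = unfold_penta w $ 3 \<longrightarrow> b1 = b2"
      by (rule hexablock_obtain_point[OF unfold_penta_in_hexablock[OF w]])
    then have b: "b1 = b2" by simp
    define g where "g = hexa_disc b1 b2 u v y (unfold_penta w $ 4)"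
    note disc = hexa_disc[OF par, folded g_def, folded uw]
    have unfold: "unfold_penta (fold_hexa (g z)) = g z" for z
      by (simp add: vec_eq_iff forall_4 g_def hexa_disc_def b)
    show ?thesis
    proof (intro exI[of _ "\<lambda>z. fold_hexa (g z)"] conjI)
      show "analytic_disc (\<lambda>z. fold_hexa (g z))"
        using disc(1) continuous_on_compose2[OF cont[of UNIV], of "cball 0 1" g]
        unfolding analytic_disc_def forall_3 forall_4 fold_hexa_nth
        by (auto intro!: holomorphic_intros)
      show "(\<lambda>z. fold_hexa (g z)) ` ball 0 1 \<subseteq> pentablock"
        using disc(2) fold_hexa_in_pentablock by blast
      show "(\<lambda>z. fold_hexa (g z)) ` sphere 0 1 \<subseteq> penta_boundary"
        using disc(3) unfold by (auto simp flip: unfold_penta_boundary_iff)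
      show "fold_hexa (g 0) = w" using disc(4) by (simp add: fold_unfold)
    qed
  qed
qed auto

section \<open>Unitary tuples\<close>

lemma shifted_tuple_commuting_maps:
  fixes T :: "('a::complex_inner \<Rightarrow>\<^sub>L 'a) ^ 'n::{finite,linorder}"
  assumes "\<And>i. complex_linear_op (T $ i)" "\<And>i j. commuting_ops (T $ i) (T $ j)"
  shows "commuting_maps (\<lambda>i x. (T $ i) x - (w $ i) *\<^sub>C x)"
proof (rule commuting_maps.intro)
  have cl: "(T $ i) (c *\<^sub>C x) = c *\<^sub>C (T $ i) x" for i c x
    using assms(1)[of i] by (simp add: complex_linear_op_def)
  have comm: "(T $ i) ((T $ j) x) = (T $ j) ((T $ i) x)" for i j x
    using assms(2)[of i j] unfolding commuting_ops_def by (metis blinfun_apply_blinfun_compose)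
  show "linear (\<lambda>x. (T $ i) x - (w $ i) *\<^sub>C x)" for i
    by (intro bounded_linear.linear bounded_linear_sub blinfun.bounded_linear_right bounded_linear_scaleC)
  show "(T $ i) ((T $ j) x - (w $ j) *\<^sub>C x) - (w $ i) *\<^sub>C ((T $ j) x - (w $ j) *\<^sub>C x) =
      (T $ j) ((T $ i) x - (w $ i) *\<^sub>C x) - (w $ j) *\<^sub>C ((T $ i) x - (w $ i) *\<^sub>C x)" for i j x
    by (simp add: blinfun.diff_right cl comm[of i j] scaleC_diff_right scaleC_scaleC mult.commute algebra_simps)
qed

text \<open>
Otherwise the adjoints of the shifted operators would be jointly bounded below, and by normality they
have the same norms as the shifted operators themselves.
\<close>

lemma joint_approximate_eigenvalue_in_spectrum:
  fixes T :: "('a::chilbert_space \<Rightarrow>\<^sub>L 'a) ^ 'n::{finite,linorder}"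
  assumes T: "\<And>i. complex_linear_op (T $ i)" "\<And>i. normal_op (T $ i)" "\<And>i j. commuting_ops (T $ i) (T $ j)"
    and w: "almost_vanishing (\<lambda>x. \<Sum>i\<in>UNIV. norm ((T $ i) x - (w $ i) *\<^sub>C x))"
  shows "w \<in> taylor_spectrum T"
  unfolding taylor_spectrum_def
proof (intro CollectI notI)
  assume "koszul_exact (\<lambda>i x. (T $ i) x - (w $ i) *\<^sub>C x)"
  then obtain c where c: "\<And>x. norm x \<le> c * (\<Sum>i\<in>UNIV. norm (cadjoint (T $ i) x - cnj (w $ i) *\<^sub>C x))"
    using koszul_exact_imp_bounded_below[OF shifted_tuple_commuting_maps[OF T(1,3)] _ adjoint_pair_shift[OF T(1)]]
    by meson
  have pos: "0 < 1 / (2 * (\<bar>c\<bar> + 1))" by simp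
  obtain x where x: "norm x = 1"
    "(\<Sum>i\<in>UNIV. norm ((T $ i) x - (w $ i) *\<^sub>C x)) \<le> 1 / (2 * (\<bar>c\<bar> + 1))"
    using w[unfolded almost_vanishing_def, rule_format, OF pos] by blast
  let ?s = "\<Sum>i\<in>UNIV. norm ((T $ i) x - (w $ i) *\<^sub>C x)"
  have "1 \<le> c * ?s" using c[of x] x(1) by (simp add: normal_shift_norm_eq[OF T(1,2)])
  also have "\<dots> \<le> (\<bar>c\<bar> + 1) * ?s" by (intro mult_right_mono sum_nonneg) auto
  also have "\<dots> \<le> (\<bar>c\<bar> + 1) * (1 / (2 * (\<bar>c\<bar> + 1)))" using x(2) by (intro mult_left_mono) auto
  also have "\<dots> = 1 / 2" by (simp add: field_simps)
  finally show False by simp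
qed

text \<open>
As \<open>3 = 0\<close> in type \<open>3\<close> and \<open>4 = 0\<close> in type \<open>4\<close>, the last entries of the tuples come first in the order,
and this map is increasing; the index that it omits, \<open>3 :: 4\<close>, is the largest one.
\<close>

definition three_into_four :: "3 \<Rightarrow> 4" where
  "three_into_four i = (if i = 1 then 1 else if i = 2 then 2 else 4)"

lemma three_order: "(3::3) < 1" "(1::3) < 2" "(3::3) < 2"
  by (simp_all add: less_bit1_def bit1.Rep_numeral bit1.Rep_1 bit1.Rep_0)

lemma four_order: "(4::4) < 1" "(1::4) < 2" "(2::4) < 3" "(4::4) < 2" "(1::4) < 3" "(4::4) < 3"
  by (simp_all add: less_bit0_def bit0.Rep_numeral bit0.Rep_1 bit0.Rep_0)

lemma strict_mono_three_into_four: "strict_mono three_into_four"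
proof (rule strict_monoI)
  have "\<forall>i j :: 3. i < j \<longrightarrow> three_into_four i < three_into_four j"
    unfolding forall_3 three_into_four_def
    using three_order by (simp add: four_order not_less_iff_gr_or_eq[THEN iffD2])
  then show "three_into_four i < three_into_four j" if "i < j" for i j using that by blast
qed

lemma commuting_ops_refl: "commuting_ops U U" by (simp add: commuting_ops_def)

lemma commuting_ops_sym: "commuting_ops U V \<longleftrightarrow> commuting_ops V U"
  unfolding commuting_ops_def by (rule eq_commute)

lemma commuting_ops_scaleR:
  assumes "r \<noteq> 0"
  shows "commuting_ops (r *\<^sub>R U) V \<longleftrightarrow> commuting_ops U V" "commuting_ops U (r *\<^sub>R V) \<longleftrightarrow> commuting_ops U V"
  using assms unfolding commuting_ops_def
      bounded_bilinear.scaleR_left[OF bounded_bilinear_blinfun_compose]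
      bounded_bilinear.scaleR_right[OF bounded_bilinear_blinfun_compose] by simp_all

lemma commuting_triple_iff:
  "(\<forall>i j. commuting_ops ((vector [A, S, P] :: _ ^ 3) $ i) ((vector [A, S, P] :: _ ^ 3) $ j)) \<longleftrightarrow>
    commuting_ops A S \<and> commuting_ops A P \<and> commuting_ops S P"
  unfolding forall_3 vector_3
  by (intro iffI conjI; elim conjE;
      (assumption | rule commuting_ops_refl | rule commuting_ops_sym[THEN iffD1], assumption))

lemma commuting_duplicate_iff:
  assumes "r \<noteq> 0"
  shows "(\<forall>i j. commuting_ops ((vector [A, r *\<^sub>R S, r *\<^sub>R S, P] :: _ ^ 4) $ i)
      ((vector [A, r *\<^sub>R S, r *\<^sub>R S, P] :: _ ^ 4) $ j)) \<longleftrightarrow>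
    commuting_ops A S \<and> commuting_ops A P \<and> commuting_ops S P"
  unfolding forall_4 vector_4 commuting_ops_scaleR[OF assms]
  by (intro iffI conjI; elim conjE;
      (assumption | rule commuting_ops_refl | rule commuting_ops_sym[THEN iffD1], assumption))

text \<open>
Off the hyperplane \<open>w2 = w3\<close> the difference of the two middle shifted operators is a nonzero scalar.
On it the two operators coincide, so one of them can be dropped, and the other rescaled.
\<close>

lemma taylor_spectrum_duplicate:
  fixes A S P :: "'a::complex_inner \<Rightarrow>\<^sub>L 'a"
  assumes cl: "complex_linear_op A" "complex_linear_op S" "complex_linear_op P"
    and comm: "commuting_ops A S" "commuting_ops A P" "commuting_ops S P"
  shows "taylor_spectrum (vector [A, (1/2) *\<^sub>R S, (1/2) *\<^sub>R S, P] :: _ ^ 4)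
    = unfold_penta ` taylor_spectrum (vector [A, S, P] :: _ ^ 3)"
proof -
  define T3 T4 where "T3 = (vector [A, S, P] :: ('a \<Rightarrow>\<^sub>L 'a) ^ 3)"
    and "T4 = (vector [A, (1/2) *\<^sub>R S, (1/2) *\<^sub>R S, P] :: ('a \<Rightarrow>\<^sub>L 'a) ^ 4)"
  define F3 F4 where "F3 w = (\<lambda>i x. (T3 $ i) x - (w $ i) *\<^sub>C x)"
    and "F4 w' = (\<lambda>i x. (T4 $ i) x - (w' $ i) *\<^sub>C x)" for w :: "complex ^ 3" and w' :: "complex ^ 4"
  have c3: "commuting_maps (F3 w)" for w unfolding F3_def
  proof (rule shifted_tuple_commuting_maps[where T = T3 and w = w])
    have "\<forall>i. complex_linear_op (T3 $ i)"
      unfolding T3_def forall_3 vector_3 by (intro conjI cl)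
    then show "complex_linear_op (T3 $ i)" for i by (elim allE)
    have "\<forall>i j. commuting_ops (T3 $ i) (T3 $ j)"
      unfolding T3_def commuting_triple_iff using comm by (intro conjI)
    then show "commuting_ops (T3 $ i) (T3 $ j)" for i j by (elim allE)
  qed
  have "\<forall>i. complex_linear_op (T4 $ i)"
    unfolding T4_def forall_4 vector_4 by (intro conjI cl complex_linear_scaleR)
  then have cl4: "complex_linear_op (T4 $ i)" for i by (elim allE)
  have c4: "commuting_maps (F4 w)" for w unfolding F4_def
  proof (rule shifted_tuple_commuting_maps[where T = T4 and w = w])
    show "complex_linear_op (T4 $ i)" for i by (rule cl4)
    have half: "(1/2 :: real) \<noteq> 0" by simp
    have "\<forall>i j. commuting_ops (T4 $ i) (T4 $ j)"
      unfolding T4_def commuting_duplicate_iff[OF half] using comm by (intro conjI)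
    then show "commuting_ops (T4 $ i) (T4 $ j)" for i j by (elim allE)
  qed
  have off_diagonal: "koszul_exact (F4 w)" if "w $ 2 \<noteq> w $ 3" for w :: "complex ^ 4"
  proof (rule commuting_maps.koszul_exact_if_diff_bij[OF c4, where p = 2 and q = 3])
    let ?R = "\<lambda>x::'a. inverse (w $ 3 - w $ 2) *\<^sub>C x"
    show "linear ?R" by (rule bounded_linear.linear[OF bounded_linear_scaleC])
    show "F4 w i (?R x) = ?R (F4 w i x)" for i x
    proof -
      show ?thesis
        using cl4[of i] by (simp add: F4_def complex_linear_op_def scaleC_diff_right scaleC_scaleC mult.commute)
    qed
    have "F4 w 2 x - F4 w 3 x = (w $ 3 - w $ 2) *\<^sub>C x" for x
      by (simp add: F4_def T4_def scaleC_diff_left)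
    then show "?R (F4 w 2 x - F4 w 3 x) = x" for x using that by (simp add: scaleC_scaleC)
  qed
  have diagonal: "koszul_exact (F4 (unfold_penta w)) \<longleftrightarrow> koszul_exact (F3 w)" for w
  proof -
    define r where "r = (\<lambda>i::3. if i = 2 then 1 / 2 else 1 :: real)"
    have "koszul_exact (F4 (unfold_penta w)) \<longleftrightarrow> koszul_exact (\<lambda>i. F4 (unfold_penta w) (three_into_four i))"
    proof (rule koszul_exact_adjoin_duplicate[OF c4 strict_mono_three_into_four, where t = 3 and q = 2])
      show "three_into_four i < 3" for i by (simp add: three_into_four_def four_order)
      have "range three_into_four = {1, 2, 4}" unfolding UNIV_3 by (auto simp: three_into_four_def)
      then show "UNIV = insert 3 (range three_into_four)" unfolding UNIV_4 by auto
      show "F4 (unfold_penta w) 3 = F4 (unfold_penta w) (three_into_four 2)"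
        by (simp add: F4_def T4_def three_into_four_def)
    qed
    also have "(\<lambda>i. F4 (unfold_penta w) (three_into_four i)) = (\<lambda>i x. r i *\<^sub>R F3 w i x)"
    proof (intro ext)
      fix i and x :: 'a
      have half: "(w $ 2 / 2) *\<^sub>C x = (1 / 2) *\<^sub>R (w $ 2) *\<^sub>C x"
        unfolding scaleC_of_real[symmetric] scaleC_scaleC by simp
      show "F4 (unfold_penta w) (three_into_four i) x = r i *\<^sub>R F3 w i x"
        using exhaust_3[of i]
        by (auto simp: F4_def F3_def T4_def T3_def three_into_four_def r_def half scaleR_blinfun.rep_eq scaleR_right_diff_distrib)
    qed
    also have "koszul_exact (\<lambda>i x. r i *\<^sub>R F3 w i x) \<longleftrightarrow> koszul_exact (F3 w)"
    proof
      have r: "r i \<noteq> 0" for i by (simp add: r_def)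
      show "koszul_exact (\<lambda>i x. r i *\<^sub>R F3 w i x)" if "koszul_exact (F3 w)"
        using koszul_exact_scaleR[OF c3 r that] .
      assume ex: "koszul_exact (\<lambda>i x. r i *\<^sub>R F3 w i x)"
      have lin: "linear (F3 w i)" for i by (rule commuting_maps.lin[OF c3])
      have "commuting_maps (\<lambda>i x. r i *\<^sub>R F3 w i x)"
        by (rule commuting_maps.intro)
          (simp_all add: linear_compose_scale_right lin linear_cmul[OF lin] commuting_maps.commute[OF c3] mult.commute)
      from koszul_exact_scaleR[OF this _ ex, of "\<lambda>i. inverse (r i)"] r
      show "koszul_exact (F3 w)" by simp
    qed
    finally show ?thesis .
  qed
  have "w \<in> taylor_spectrum T4 \<longleftrightarrow> w \<in> unfold_penta ` taylor_spectrum T3" for w :: "complex ^ 4"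
  proof (cases "w $ 2 = w $ 3")
    case True
    then have w: "w = unfold_penta (fold_hexa w)" by (simp add: vec_eq_iff forall_4)
    have "w \<in> taylor_spectrum T4 \<longleftrightarrow> fold_hexa w \<in> taylor_spectrum T3"
      using diagonal[of "fold_hexa w"] unfolding w[symmetric] taylor_spectrum_def F3_def F4_def by simp
    moreover have "w \<in> unfold_penta ` taylor_spectrum T3 \<longleftrightarrow> fold_hexa w \<in> taylor_spectrum T3"
    proof
      assume "w \<in> unfold_penta ` taylor_spectrum T3"
      then show "fold_hexa w \<in> taylor_spectrum T3" by (auto simp: fold_unfold)
    next
      assume "fold_hexa w \<in> taylor_spectrum T3"
      then show "w \<in> unfold_penta ` taylor_spectrum T3" by (subst w) (rule imageI)
    qed
    ultimately show ?thesis by blast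
  next
    case False
    then have "w \<notin> taylor_spectrum T4" using off_diagonal unfolding taylor_spectrum_def F4_def by simp
    moreover have "w \<notin> unfold_penta ` taylor_spectrum T3" using False by auto
    ultimately show ?thesis by simp
  qed
  then show ?thesis unfolding T3_def T4_def by blast
qed

lemma penta_unitary_iff_hexa_unitary:
  fixes A S P :: "'a::chilbert_space \<Rightarrow>\<^sub>L 'a"
  assumes cl: "complex_linear_op A" "complex_linear_op S" "complex_linear_op P"
  shows "domain_unitary pentablock (vector [A, S, P]) \<longleftrightarrow>
    domain_unitary hexablock (vector [A, (1/2) *\<^sub>R S, (1/2) *\<^sub>R S, P])"
proof -
  let ?S = "(1/2) *\<^sub>R S"
  have normal: "(\<forall>i. normal_op ((vector [A, ?S, ?S, P] :: _ ^ 4) $ i)) \<longleftrightarrow> (\<forall>i. normal_op ((vector [A, S, P] :: _ ^ 3) $ i))"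
    unfolding forall_3 forall_4 vector_3 vector_4 by (simp add: normal_op_scaleR_iff[OF cl(2)])
  have spectrum: "taylor_spectrum (vector [A, ?S, ?S, P] :: _ ^ 4) \<subseteq> hexa_boundary \<longleftrightarrow>
      taylor_spectrum (vector [A, S, P] :: _ ^ 3) \<subseteq> penta_boundary"
    if "commuting_ops A S \<and> commuting_ops A P \<and> commuting_ops S P"
    using that taylor_spectrum_duplicate[OF cl] by (auto simp: unfold_penta_boundary_iff)
  show ?thesis
    unfolding domain_unitary_def commuting_triple_iff commuting_duplicate_iff[of "1/2", simplified] normal
      distinguished_boundary_hexablock distinguished_boundary_pentablock
    using spectrum by blast
qed

lemma spectrum_of_commuting_unitaries:
  fixes A X :: "'a::chilbert_space \<Rightarrow>\<^sub>L 'a"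
  assumes cl: "complex_linear_op A" "complex_linear_op X" and u: "unitary_op A" "unitary_op X"
    and comm: "commuting_ops A X"
  shows "taylor_spectrum (vector [A, 0, 0, X] :: _ ^ 4) \<subseteq> hexa_boundary"
proof
  define T where "T = (vector [A, 0, 0, X] :: ('a \<Rightarrow>\<^sub>L 'a) ^ 4)"
  fix w assume w: "w \<in> taylor_spectrum (vector [A, 0, 0, X] :: ('a \<Rightarrow>\<^sub>L 'a) ^ 4)"
  have cm: "commuting_maps (\<lambda>i x. (T $ i) x - (w $ i) *\<^sub>C x)"
  proof (rule shifted_tuple_commuting_maps)
    show "complex_linear_op (T $ i)" for i
      using exhaust_4[of i] cl by (auto simp: T_def complex_linear_op_def)
    show "commuting_ops (T $ i) (T $ j)" for i j
      using exhaust_4[of i] exhaust_4[of j] comm by (auto simp: T_def commuting_ops_def)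
  qed
  have not_bij: "\<not> bij (\<lambda>x. (T $ i) x - (w $ i) *\<^sub>C x)" for i
    using commuting_maps.koszul_exact_if_bij[OF cm] w by (auto simp: taylor_spectrum_def T_def)
  have "c = 0" if "\<not> bij (\<lambda>x::'a. 0 - c *\<^sub>C x)" for c
  proof (rule ccontr)
    assume "c \<noteq> 0"
    then have "bij (\<lambda>x::'a. 0 - c *\<^sub>C x)"
      by (intro bij_betw_byWitness[where f' = "\<lambda>x. - (inverse c *\<^sub>C x)"])
        (auto simp: scaleC_minus_right scaleC_scaleC)
    then show False using that by simp
  qed
  then have "w $ 2 = 0" "w $ 3 = 0" using not_bij[of 2] not_bij[of 3] by (auto simp: T_def)
  moreover have "cmod (w $ 1) = 1" "cmod (w $ 4) = 1"
    using not_bij[of 1] not_bij[of 4] unitary_shift_bij[OF cl(1) u(1)] unitary_shift_bij[OF cl(2) u(2)]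
    by (auto simp: T_def)
  ultimately show "w \<in> hexa_boundary" by (simp add: hexa_boundary_def)
qed

lemma unitary_pair_iff_hexa_unitary:
  fixes A X :: "'a::chilbert_space \<Rightarrow>\<^sub>L 'a"
  assumes cl: "complex_linear_op A" "complex_linear_op X"
  shows "commuting_ops A X \<and> unitary_op A \<and> unitary_op X \<longleftrightarrow>
    domain_unitary hexablock (vector [A, 0, 0, X])"
proof
  assume u: "commuting_ops A X \<and> unitary_op A \<and> unitary_op X"
  have "normal_op (0 :: 'a \<Rightarrow>\<^sub>L 'a)" "normal_op A" "normal_op X"
    using u by (auto simp: normal_op_def unitary_op_def)
  moreover have "commuting_ops 0 U" "commuting_ops U 0" "commuting_ops U U" for U :: "'a \<Rightarrow>\<^sub>L 'a"
    by (auto simp: commuting_ops_def)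
  moreover have "commuting_ops X A" using u by (simp add: commuting_ops_def)
  ultimately show "domain_unitary hexablock (vector [A, 0, 0, X])"
    using u spectrum_of_commuting_unitaries[OF cl]
    unfolding domain_unitary_def forall_4 vector_4 distinguished_boundary_hexablock by simp
next
  assume d: "domain_unitary hexablock (vector [A, 0, 0, X])"
  define T where "T = (vector [A, 0, 0, X] :: ('a \<Rightarrow>\<^sub>L 'a) ^ 4)"
  have T: "commuting_ops (T $ i) (T $ j)" "normal_op (T $ i)" for i j
    using d by (auto simp: domain_unitary_def T_def)
  have Tcl: "complex_linear_op (T $ i)" for i
    using exhaust_4[of i] cl by (auto simp: T_def complex_linear_op_def)
  have A: "normal_op A" and X: "normal_op X" and AX: "commuting_ops A X" and XA: "commuting_ops X A"
    using T(2)[of 1] T(2)[of 4] T(1)[of 1 4] T(1)[of 4 1] by (simp_all add: T_def)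
  have joint: "cmod a = 1 \<and> cmod z = 1"
    if "almost_vanishing (\<lambda>x. norm (A x - a *\<^sub>C x) + norm (X x - z *\<^sub>C x))" for a z
  proof -
    define w where "w = (vector [a, 0, 0, z] :: complex ^ 4)"
    have zero: "0 *\<^sub>C x = (0::'a)" for x using scaleC_of_real[of 0 x] by simp
    have "w \<in> taylor_spectrum T"
    proof (rule joint_approximate_eigenvalue_in_spectrum[OF Tcl T(2,1)])
      show "almost_vanishing (\<lambda>x. \<Sum>i\<in>UNIV. norm ((T $ i) x - (w $ i) *\<^sub>C x))"
        using that by (simp add: sum_4 T_def w_def zero)
    qed
    then have "w \<in> hexa_boundary"
      using d unfolding domain_unitary_def distinguished_boundary_hexablock T_def by blast
    then have "cmod z = 1" "(cmod a)\<^sup>2 = 1" by (simp_all add: hexa_boundary_def w_def)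
    then show ?thesis using norm_ge_zero[of a] by (auto simp: power2_eq_1_iff)
  qed
  have "unitary_op A"
  proof (rule unitary_if_approximate_eigenvalues[OF cl(1) A])
    fix a assume "almost_vanishing (\<lambda>x. norm (A x - a *\<^sub>C x))"
    then obtain z where "almost_vanishing (\<lambda>x. norm (A x - a *\<^sub>C x) + norm (X x - z *\<^sub>C x))"
      by (rule joint_approximate_eigenvalue[OF cl(1) A cl(2) X AX])
    then show "cmod a = 1" using joint by blast
  qed
  moreover have "unitary_op X"
  proof (rule unitary_if_approximate_eigenvalues[OF cl(2) X])
    fix z assume "almost_vanishing (\<lambda>x. norm (X x - z *\<^sub>C x))"
    then obtain a where "almost_vanishing (\<lambda>x. norm (X x - z *\<^sub>C x) + norm (A x - a *\<^sub>C x))"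
      by (rule joint_approximate_eigenvalue[OF cl(2) X cl(1) A XA])
    then show "cmod z = 1" using joint by (simp add: add.commute)
  qed
  ultimately show "commuting_ops A X \<and> unitary_op A \<and> unitary_op X" using AX by blast
qed

theorem corollary3p9:
  fixes A X\<^sub>3 S P :: "'a::chilbert_space \<Rightarrow>\<^sub>L 'a"
  assumes "complex_linear_op A" and "complex_linear_op X\<^sub>3"
    and "complex_linear_op S" and "complex_linear_op P"
  shows "(domain_unitary pentablock (vector [A, S, P]) \<longleftrightarrow>
          domain_unitary hexablock (vector [A, (1/2) *\<^sub>R S, (1/2) *\<^sub>R S, P])) \<and>
         (commuting_ops A X\<^sub>3 \<and> unitary_op A \<and> unitary_op X\<^sub>3 \<longleftrightarrow>
          domain_unitary hexablock (vector [A, 0, 0, X\<^sub>3]))"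
  using penta_unitary_iff_hexa_unitary[OF assms(1,3,4)] unitary_pair_iff_hexa_unitary[OF assms(1,2)] ..

end
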